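(* Let $\mu_+,\mu_-\in\mathbb{R}$, $\beta\in(-1,1)$, $q>0$, and let $X=(X_t)_{t\ge 0}$ be the refracted skew Brownian motion with parameters $(\beta,\mu_+,\mu_-)$, skew level $a=0$ and starting point $X_0=0$. Let $e_q$ be an exponential random variable with rate $q$, independent of $X$. Then the potential measure of $X$ is given by $$\mathbb{P}(X_{e_q}\in \mathrm{d}y)=\begin{cases}\dfrac{2(1+\beta)q}{(1+\beta)\mu_+-(1-\beta)\mu_-+(1+\beta)\sqrt{\mu_+^2+2q}+(1-\beta)\sqrt{\mu_-^2+2q}}\;e^{(\mu_+-\sqrt{\mu_+^2+2q})\,y}\,\mathrm{d}y, & y>0,\\[3mm] \dfrac{2(1-\beta)q}{(1+\beta)\mu_+-(1-\beta)\mu_-+(1+\beta)\sqrt{\mu_+^2+2q}+(1-\beta)\sqrt{\mu_-^2+2q}}\;e^{(\mu_-+\sqrt{\mu_-^2+2q})\,y}\,\mathrm{d}y, & y<0.\end{cases}$$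
   Context: The refracted skew Brownian motion with parameters $\beta\in(-1,1)$, $\mu_+,\mu_-\in\mathbb{R}$ and skew level $a\in\mathbb{R}$ is the pathwise unique (strong) solution $X$ of $$X_t=X_0+B_t+\beta L^X(t,a)+\mu_+\int_0^t \mathbf{1}_{\{X_s>a\}}\,\mathrm{d}s+\mu_-\int_0^t\mathbf{1}_{\{X_s<a\}}\,\mathrm{d}s,\qquad t\ge 0,$$ where $B$ is a standard Brownian motion and $L^X(t,a)=\lim_{\epsilon\to0^+}\frac{1}{2\epsilon}\mathrm{Leb}(\{s\le t:|X_s-a|\le\epsilon\})$ is the symmetric local time of $X$ at level $a$. "Potential measure" here means the law of $X_{e_q}$, i.e. $\mathbb{P}(X_{e_q}\in \mathrm{d}y)=\int_0^\infty q e^{-qt}\,\mathbb{P}(X_t\in \mathrm{d}y)\,\mathrm{d}t$. *)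

theory Defs
  imports "HOL-Probability.Probability"
begin

definition process_events ::
    "'w measure \<Rightarrow> (real \<Rightarrow> 'w \<Rightarrow> real) \<Rightarrow> real set \<Rightarrow> 'w set set" where
  "process_events M X I =
     sigma_sets (space M) {X t -` A \<inter> space M | t A. t \<in> I \<and> A \<in> sets borel}"

locale standard_brownian_motion = prob_space M for M :: "'w measure" +
  fixes B :: "real \<Rightarrow> 'w \<Rightarrow> real"
  assumes B_measurable: "\<And>t. 0 \<le> t \<Longrightarrow> B t \<in> borel_measurable M"
    and B_start: "AE \<omega> in M. B 0 \<omega> = 0"
    and B_continuous: "AE \<omega> in M. continuous_on {0..} (\<lambda>t. B t \<omega>)"
    and B_increments: "\<And>s t. 0 \<le> s \<Longrightarrow> s < t \<Longrightarrow>
          distributed M lborel (\<lambda>\<omega>. B t \<omega> - B s \<omega>) (normal_density 0 (sqrt (t - s)))"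
    and B_indep_increments: "\<And>(n::nat) (t :: nat \<Rightarrow> real).
          0 \<le> t 0 \<Longrightarrow> strict_mono_on {..n} t \<Longrightarrow>
          indep_vars (\<lambda>_. borel) (\<lambda>i \<omega>. B (t (Suc i)) \<omega> - B (t i) \<omega>) {..<n}"

text \<open>The filtration generated by \<open>B\<close>, augmented by the null sets of \<open>M\<close>. Only measurable null
  sets are added: \<open>M\<close> need not be complete, and processes are to stay \<open>M\<close>-measurable.\<close>

definition augmented_filtration ::
    "'w measure \<Rightarrow> (real \<Rightarrow> 'w \<Rightarrow> real) \<Rightarrow> real \<Rightarrow> 'w measure" where
  "augmented_filtration M B t =
     sigma (space M) (process_events M B {0..t} \<union> null_sets M)"

text \<open>Symmetric local time of a path \<open>x\<close> at level \<open>a\<close>. The value is only meaningful when the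
  limit exists; this is demanded separately below.\<close>

definition occupation_ratio :: "(real \<Rightarrow> real) \<Rightarrow> real \<Rightarrow> real \<Rightarrow> real \<Rightarrow> real" where
  "occupation_ratio x t a \<epsilon> = measure lborel {s \<in> {0..t}. \<bar>x s - a\<bar> \<le> \<epsilon>} / (2 * \<epsilon>)"

definition sym_local_time :: "(real \<Rightarrow> real) \<Rightarrow> real \<Rightarrow> real \<Rightarrow> real" where
  "sym_local_time x t a = Lim (at_right 0) (occupation_ratio x t a)"

text \<open>\<open>X\<close> is the strong solution, driven by \<open>B\<close> and started at the point \<open>x0\<close>. All of its paths
  (not just almost all) are continuous, so that \<open>X\<close> evaluated at a random time is measurable
  also when \<open>M\<close> is not complete.\<close>

locale refracted_skew_brownian_motion = standard_brownian_motion M B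
  for M :: "'w measure" and B :: "real \<Rightarrow> 'w \<Rightarrow> real" +
  fixes X :: "real \<Rightarrow> 'w \<Rightarrow> real" and \<beta> \<mu>\<^sub>p \<mu>\<^sub>m a x0 :: real
  assumes skewness: "-1 < \<beta>" "\<beta> < 1"
    and X_adapted: "\<And>t. 0 \<le> t \<Longrightarrow> X t \<in> borel_measurable (augmented_filtration M B t)"
    and X_continuous: "\<And>\<omega>. \<omega> \<in> space M \<Longrightarrow> continuous_on {0..} (\<lambda>t. X t \<omega>)"
    and X_start: "AE \<omega> in M. X 0 \<omega> = x0"
    and local_time_exists: "AE \<omega> in M. \<forall>t\<ge>0.
          (occupation_ratio (\<lambda>s. X s \<omega>) t a \<longlongrightarrow> sym_local_time (\<lambda>s. X s \<omega>) t a) (at_right 0)"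
    and X_equation: "AE \<omega> in M. \<forall>t\<ge>0.
          X t \<omega> = X 0 \<omega> + B t \<omega> + \<beta> * sym_local_time (\<lambda>s. X s \<omega>) t a
            + \<mu>\<^sub>p * (LBINT s:{0..t}. indicator {a<..} (X s \<omega>))
            + \<mu>\<^sub>m * (LBINT s:{0..t}. indicator {..<a} (X s \<omega>))"

end

theory Submission
  imports Defs
begin

text \<open>
  The law of \<open>X\<close> at the exponential time is found by letting the generator act on test functions
  that vanish on one side of \<open>0\<close>, so that the two half-lines decouple; on each of them an explicit
  family of test functions then gives the Fourier transform of the law.

  Write \<open>L\<close> for the local time at \<open>0\<close> and \<open>m(y)\<close> for the drift at \<open>y\<close>. The driving term is
  Brownian and \<open>X - B\<close> has bounded variation, so Ito's formula for a smooth bounded \<open>\<phi>\<close>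
  (\<open>ito_expectation\<close>) says that
  \<open>E[Z (\<phi>(X\<^sub>t) - \<phi>(X\<^sub>s))]\<close> equals \<open>E[Z (\<integral>\<^sub>s\<^sup>t (\<phi>''/2 + m \<phi>')(X\<^sub>r) dr + \<beta> \<phi>'(0) (L\<^sub>t - L\<^sub>s))]\<close>
  for bounded \<open>Z\<close> measurable with respect to the past of \<open>s\<close>. Only expectations occur, so no
  stochastic integral is needed: along a grid, the part of the increment of \<open>\<phi>(X)\<close> due to \<open>X - B\<close>
  converges path by path (\<open>grid_sum_tendsto\<close>), and the Brownian part is treated by Taylor expansion
  and the independence of increments (\<open>taylor_increment\<close>). The local time is integrable because it
  grows only at zeros of \<open>X\<close>: looking back to the last zero \<open>g\<close> before \<open>t\<close> gives
  \<open>|\<beta> L\<^sub>t| \<le> |B\<^sub>g| + K t\<close> with \<open>K\<close> a bound on the drift (\<open>local_time_at_zero\<close>), and the maximum of \<open>B\<close> is controlled by Doob's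
  inequality (\<open>running_max_moment\<close>).

  Next, Ito's formula is applied to \<open>g(w(\<sigma> X))\<close>, where \<open>\<sigma>\<close> is \<open>1\<close> or \<open>-1\<close> and \<open>w\<close> is a smoothed positive part
  whose second derivative is a narrow tent. When the tent shrinks, its time integral along \<open>X\<close>
  tends to \<open>L\<close>, almost surely because \<open>L\<close> is the symmetric occupation density, and in mean because of
  a uniform second moment bound (\<open>tent_time_second_moment\<close>). For \<open>g(0) = 0\<close> the limit is Tanaka's formula
  (\<open>tanaka_expectation\<close>): \<open>E g((\<sigma> X\<^sub>t)\<^sup>+)\<close> equals the mean time integral of the generator over
  \<open>{\<sigma> X > 0}\<close> plus \<open>g'(0) (1 + \<sigma> \<beta>) E[L\<^sub>t] / 2\<close>. The factor \<open>1 + \<sigma> \<beta>\<close> is where the skewness enters: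
  \<open>1\<close> comes from the tent and \<open>\<sigma> \<beta>\<close> from the local time term of the equation.

  Taking Laplace transforms in \<open>t\<close> (\<open>resolvent_tanaka\<close>) turns this into one identity for the
  restriction of the law to a half-line, \<open>stationary_identity\<close>. Let \<open>\<mu>\<close> be the drift towards infinity on that side.
  The function \<open>g(y) = exp(i u y) - exp(-r y)\<close> with \<open>r = \<mu> + sqrt(\<mu>\<^sup>2 + 2 q)\<close> vanishes at \<open>0\<close>, and
  \<open>exp(-r y)\<close> is annihilated by the operator \<open>q - \<mu> d/dy - (1/2) d\<^sup>2/dy\<^sup>2\<close>, of which the
  exponential \<open>exp(i u y)\<close> is an eigenfunction. Hence the Fourier transform on the half-line is
  \<open>(1 + \<sigma> \<beta>) \<ell> / (\<rho> - i u)\<close> with \<open>\<rho> = sqrt(\<mu>\<^sup>2 + 2 q) - \<mu>\<close> (\<open>half_transform\<close>), which is that of an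
  exponential density. The point \<open>0\<close> carries no mass, so the constant \<open>\<ell>\<close>, which is \<open>q\<close> times the
  mean local time at the exponential time, is determined by the total mass being \<open>1\<close>.
\<close>

section \<open>Taylor estimates and test functions\<close>

lemma real_mvt:
  fixes f f' :: "real \<Rightarrow> real"
  assumes d: "\<And>x. (f has_real_derivative f' x) (at x)"
  shows "\<exists>z. min u w \<le> z \<and> z \<le> max u w \<and> f w - f u = f' z * (w - u)"
proof (cases u w rule: linorder_cases)
  case less
  obtain z where "u < z" "z < w" "f w - f u = (w - u) * f' z" using MVT2[OF less d] by blast
  then show ?thesis using less by (intro exI[of _ z]) (auto simp: mult.commute)
next
  case greater
  obtain z where "w < z" "z < u" "f u - f w = (u - w) * f' z" using MVT2[OF greater d] by blast
  then show ?thesis using greater by (intro exI[of _ z]) (auto simp: algebra_simps)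
qed auto

text \<open>The remainder is cubic although only a Lipschitz second derivative is assumed; this is the regularity
  of the smoothed positive part below, whose second derivative has corners.\<close>

lemma taylor2:
  fixes \<phi> \<phi>' \<phi>'' :: "real \<Rightarrow> real"
  assumes d1: "\<And>x. (\<phi> has_real_derivative \<phi>' x) (at x)"
    and d2: "\<And>x. (\<phi>' has_real_derivative \<phi>'' x) (at x)"
    and lip: "\<And>x y. \<bar>\<phi>'' x - \<phi>'' y\<bar> \<le> C * \<bar>x - y\<bar>"
  shows "\<bar>\<phi> (x + y) - \<phi> x - \<phi>' x * y - \<phi>'' x * y\<^sup>2 / 2\<bar> \<le> C * \<bar>y\<bar> ^ 3"
proof -
  have mvt: "\<exists>z. \<bar>z\<bar> \<le> \<bar>y\<bar> \<and> f (x + y) - f x = f' (x + z) * y"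
    if dd: "\<And>x. (f has_real_derivative f' x) (at x)" for f f' :: "real \<Rightarrow> real" and x y
  proof -
    obtain z where "min x (x + y) \<le> z" "z \<le> max x (x + y)" "f (x + y) - f x = f' z * (x + y - x)"
      using real_mvt[OF dd] by blast
    then show ?thesis by (intro exI[of _ "z - x"]) (auto simp: min_def max_def split: if_splits)
  qed
  have C0: "0 \<le> C" using lip[of 0 1] by (auto intro: order_trans[OF abs_ge_zero])
  have one: "\<bar>\<phi>' (x + z) - \<phi>' x - \<phi>'' x * z\<bar> \<le> C * \<bar>z\<bar>\<^sup>2" for z
  proof -
    obtain w where w: "\<bar>w\<bar> \<le> \<bar>z\<bar>" "\<phi>' (x + z) - \<phi>' x = \<phi>'' (x + w) * z"
      using mvt[OF d2] by blast
    have "\<bar>\<phi>' (x + z) - \<phi>' x - \<phi>'' x * z\<bar> = \<bar>\<phi>'' (x + w) - \<phi>'' x\<bar> * \<bar>z\<bar>"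
      unfolding w(2) by (simp add: abs_mult[symmetric] algebra_simps)
    also have "\<dots> \<le> (C * \<bar>w\<bar>) * \<bar>z\<bar>" using lip[of "x + w" x] by (intro mult_right_mono) auto
    also have "\<dots> \<le> (C * \<bar>z\<bar>) * \<bar>z\<bar>" using w C0 by (intro mult_right_mono mult_left_mono) auto
    finally show ?thesis by (simp add: power2_eq_square)
  qed
  define k where "k v = \<phi> v - \<phi>' x * v - \<phi>'' x * (v - x)\<^sup>2 / 2" for v
  have "(k has_real_derivative \<phi>' v - \<phi>' x - \<phi>'' x * (v - x)) (at v)" for v
    unfolding k_def by (auto intro!: derivative_eq_intros d1)
  from mvt[of k "\<lambda>v. \<phi>' v - \<phi>' x - \<phi>'' x * (v - x)", OF this]
  obtain z where z: "\<bar>z\<bar> \<le> \<bar>y\<bar>" "k (x + y) - k x = (\<phi>' (x + z) - \<phi>' x - \<phi>'' x * z) * y"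
    by (metis add_diff_cancel_left')
  have "\<bar>\<phi> (x + y) - \<phi> x - \<phi>' x * y - \<phi>'' x * y\<^sup>2 / 2\<bar> = \<bar>k (x + y) - k x\<bar>"
    by (simp add: k_def algebra_simps)
  also have "\<dots> \<le> (C * \<bar>z\<bar>\<^sup>2) * \<bar>y\<bar>"
    unfolding z(2) abs_mult using one by (intro mult_right_mono) auto
  also have "\<dots> \<le> (C * \<bar>y\<bar>\<^sup>2) * \<bar>y\<bar>" using z C0 by (intro mult_right_mono mult_left_mono power_mono) auto
  finally show ?thesis by (simp add: power3_eq_cube power2_eq_square mult.assoc)
qed

section \<open>Smoothing the positive part\<close>

definition plus_pow :: "nat \<Rightarrow> real \<Rightarrow> real" where
  "plus_pow n x = (max 0 x) ^ n"

lemma DERIV_plus_pow: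
  "(plus_pow (Suc (Suc n)) has_real_derivative real (Suc (Suc n)) * plus_pow (Suc n) x) (at x)"
proof (cases x "0 :: real" rule: linorder_cases)
  case less
  have "((\<lambda>_. 0) has_real_derivative 0) (at x)" by simp
  moreover have "\<forall>\<^sub>F y in nhds x. plus_pow (Suc (Suc n)) y = 0"
    using eventually_nhds_in_open[of "{..<0}" x] less
    by (auto simp: plus_pow_def elim!: eventually_mono)
  ultimately have "(plus_pow (Suc (Suc n)) has_real_derivative 0) (at x)"
    by (subst DERIV_cong_ev[OF refl _ refl]) auto
  then show ?thesis using less by (simp add: plus_pow_def)
next
  case greater
  have "((\<lambda>y. y ^ Suc (Suc n)) has_real_derivative real (Suc (Suc n)) * x ^ Suc n) (at x)"
    using DERIV_pow[of "Suc (Suc n)" x] by simp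
  moreover have "\<forall>\<^sub>F y in nhds x. plus_pow (Suc (Suc n)) y = y ^ Suc (Suc n)"
    using eventually_nhds_in_open[of "{0<..}" x] greater
    by (auto simp: plus_pow_def max_def elim!: eventually_mono)
  ultimately have "(plus_pow (Suc (Suc n)) has_real_derivative real (Suc (Suc n)) * x ^ Suc n) (at x)"
    by (subst DERIV_cong_ev[OF refl _ refl]) auto
  then show ?thesis using greater by (simp add: plus_pow_def)
next
  case equal
  have "((\<lambda>h. plus_pow (Suc (Suc n)) h / h) \<longlongrightarrow> 0) (at 0)"
  proof (rule Lim_null_comparison)
    show "\<forall>\<^sub>F h in at 0. norm (plus_pow (Suc (Suc n)) h / h) \<le> \<bar>h\<bar> ^ Suc n"
    proof -
      have "norm (plus_pow (Suc (Suc n)) h / h) = max 0 h ^ Suc n * \<bar>max 0 h / h\<bar>" for h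
        by (simp add: plus_pow_def abs_mult power_abs)
      also have "\<dots> h \<le> \<bar>h\<bar> ^ Suc n * 1" for h :: real
        by (intro mult_mono power_mono) (auto simp: max_def)
      finally show ?thesis by (intro always_eventually) simp
    qed
    have "((\<lambda>h :: real. \<bar>h\<bar> ^ Suc n) \<longlongrightarrow> \<bar>0\<bar> ^ Suc n) (at 0)" by (intro tendsto_intros)
    then show "((\<lambda>h :: real. \<bar>h\<bar> ^ Suc n) \<longlongrightarrow> 0) (at 0)" by simp
  qed
  then show ?thesis using equal by (simp add: DERIV_def plus_pow_def)
qed

text \<open>The ladder \<open>ramp\<close>, \<open>ramp'\<close>, \<open>tent\<close> consists of a function and its first two derivatives. The first
  equals the positive part outside \<open>[-\<epsilon>, \<epsilon>]\<close>, and the last is the symmetric probability density of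
  tent shape on that interval. Writing all three as second differences of truncated powers makes
  differentiation immediate.\<close>

definition tent :: "real \<Rightarrow> real \<Rightarrow> real" where
  "tent \<epsilon> x = (plus_pow 1 (x + \<epsilon>) - 2 * plus_pow 1 x + plus_pow 1 (x - \<epsilon>)) / \<epsilon>\<^sup>2"

definition ramp' :: "real \<Rightarrow> real \<Rightarrow> real" where
  "ramp' \<epsilon> x = (plus_pow 2 (x + \<epsilon>) - 2 * plus_pow 2 x + plus_pow 2 (x - \<epsilon>)) / (2 * \<epsilon>\<^sup>2)"

definition ramp :: "real \<Rightarrow> real \<Rightarrow> real" where
  "ramp \<epsilon> x = (plus_pow 3 (x + \<epsilon>) - 2 * plus_pow 3 x + plus_pow 3 (x - \<epsilon>)) / (6 * \<epsilon>\<^sup>2)"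

lemma tent_eq: "\<epsilon> > 0 \<Longrightarrow> tent \<epsilon> x = max 0 (\<epsilon> - \<bar>x\<bar>) / \<epsilon>\<^sup>2"
  by (auto simp: tent_def plus_pow_def max_def)

lemma DERIV_plus_pow3: "(plus_pow 3 has_real_derivative 3 * plus_pow 2 x) (at x)"
  using DERIV_plus_pow[of 1 x] by (simp add: eval_nat_numeral)

lemma DERIV_plus_pow2: "(plus_pow 2 has_real_derivative 2 * plus_pow 1 x) (at x)"
  using DERIV_plus_pow[of 0 x] by (simp add: eval_nat_numeral)

lemma DERIV_ramp:
  assumes "\<epsilon> > 0" shows "(ramp \<epsilon> has_real_derivative ramp' \<epsilon> x) (at x)"
  unfolding ramp_def[abs_def] ramp'_def
  using assms by (auto intro!: derivative_eq_intros DERIV_chain2[OF DERIV_plus_pow3] simp: field_simps)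

lemma DERIV_ramp':
  assumes "\<epsilon> > 0" shows "(ramp' \<epsilon> has_real_derivative tent \<epsilon> x) (at x)"
  unfolding ramp'_def[abs_def] tent_def
  using assms by (auto intro!: derivative_eq_intros DERIV_chain2[OF DERIV_plus_pow2] simp: field_simps)

lemma tent_nonneg: "\<epsilon> > 0 \<Longrightarrow> 0 \<le> tent \<epsilon> x" and tent_le: "\<epsilon> > 0 \<Longrightarrow> tent \<epsilon> x \<le> 1 / \<epsilon>"
  and tent_outside: "\<epsilon> > 0 \<Longrightarrow> \<epsilon> \<le> \<bar>x\<bar> \<Longrightarrow> tent \<epsilon> x = 0"
  and tent_minus: "\<epsilon> > 0 \<Longrightarrow> tent \<epsilon> (- x) = tent \<epsilon> x"
  by (auto simp: tent_eq power2_eq_square field_simps max_def)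

lemma tent_lipschitz:
  assumes "\<epsilon> > 0" shows "\<bar>tent \<epsilon> x - tent \<epsilon> y\<bar> \<le> 1 / \<epsilon>\<^sup>2 * \<bar>x - y\<bar>"
proof -
  have "\<bar>tent \<epsilon> x - tent \<epsilon> y\<bar> = \<bar>max 0 (\<epsilon> - \<bar>x\<bar>) - max 0 (\<epsilon> - \<bar>y\<bar>)\<bar> / \<epsilon>\<^sup>2"
    using assms by (simp add: tent_eq diff_divide_distrib[symmetric])
  also have "\<dots> \<le> \<bar>x - y\<bar> / \<epsilon>\<^sup>2" by (intro divide_right_mono) auto
  finally show ?thesis by simp
qed

lemma ramp'_mono:
  assumes "\<epsilon> > 0" shows "x \<le> y \<Longrightarrow> ramp' \<epsilon> x \<le> ramp' \<epsilon> y"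
  using DERIV_nonneg_imp_nondecreasing[of x y "ramp' \<epsilon>"] DERIV_ramp'[OF assms] tent_nonneg[OF assms]
  by blast

lemma ramp_left: "\<epsilon> > 0 \<Longrightarrow> x \<le> - \<epsilon> \<Longrightarrow> ramp \<epsilon> x = 0"
  and ramp'_left: "\<epsilon> > 0 \<Longrightarrow> x \<le> - \<epsilon> \<Longrightarrow> ramp' \<epsilon> x = 0"
  by (auto simp: ramp_def ramp'_def plus_pow_def max_def)

lemma ramp_right: "\<epsilon> > 0 \<Longrightarrow> x \<ge> \<epsilon> \<Longrightarrow> ramp \<epsilon> x = x"
  and ramp'_right: "\<epsilon> > 0 \<Longrightarrow> x \<ge> \<epsilon> \<Longrightarrow> ramp' \<epsilon> x = 1"
  by (auto simp: ramp_def ramp'_def plus_pow_def max_def field_simps power2_eq_square power3_eq_cube)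

lemma ramp_0: "\<epsilon> > 0 \<Longrightarrow> ramp \<epsilon> 0 = \<epsilon> / 6" and ramp'_0: "\<epsilon> > 0 \<Longrightarrow> ramp' \<epsilon> 0 = 1 / 2"
  by (auto simp: ramp_def ramp'_def plus_pow_def max_def field_simps power2_eq_square power3_eq_cube)

lemma ramp'_bounds: assumes "\<epsilon> > 0" shows "0 \<le> ramp' \<epsilon> x" "ramp' \<epsilon> x \<le> 1"
  using ramp'_mono[OF assms, of "min x (- \<epsilon>)" x] ramp'_mono[OF assms, of x "max x \<epsilon>"]
    ramp'_left[OF assms, of "min x (- \<epsilon>)"] ramp'_right[OF assms, of "max x \<epsilon>"] by auto

lemma ramp_mono: assumes "\<epsilon> > 0" shows "x \<le> y \<Longrightarrow> ramp \<epsilon> x \<le> ramp \<epsilon> y"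
  using DERIV_nonneg_imp_nondecreasing[of x y "ramp \<epsilon>"] DERIV_ramp[OF assms] ramp'_bounds[OF assms]
  by blast

lemma ramp_nonneg: assumes "\<epsilon> > 0" shows "0 \<le> ramp \<epsilon> x"
  using ramp_mono[OF assms, of "min x (- \<epsilon>)" x] ramp_left[OF assms, of "min x (- \<epsilon>)"] by auto

lemma ramp_le: assumes "\<epsilon> > 0" "x \<le> \<epsilon>" shows "ramp \<epsilon> x \<le> \<epsilon>"
  using ramp_mono[OF assms] ramp_right[OF assms(1), of \<epsilon>] by auto

section \<open>Paths solving the equation\<close>

definition drift_coeff :: "real \<Rightarrow> real \<Rightarrow> real \<Rightarrow> real" where
  "drift_coeff \<mu>\<^sub>p \<mu>\<^sub>m y = \<mu>\<^sub>p * indicator {0<..} y + \<mu>\<^sub>m * indicator {..<0} y"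

lemma drift_coeff_bound: "\<bar>drift_coeff \<mu>\<^sub>p \<mu>\<^sub>m y\<bar> \<le> \<bar>\<mu>\<^sub>p\<bar> + \<bar>\<mu>\<^sub>m\<bar>"
  by (auto simp: drift_coeff_def split: split_indicator)

lemma drift_coeff_measurable [measurable]: "drift_coeff \<mu>\<^sub>p \<mu>\<^sub>m \<in> borel_measurable borel"
  unfolding drift_coeff_def[abs_def] by measurable

text \<open>A single constant serves as bound for the function, its derivatives and the Lipschitz modulus, which keeps the estimates below short.\<close>

definition test_function ::
    "real \<Rightarrow> (real \<Rightarrow> real) \<Rightarrow> (real \<Rightarrow> real) \<Rightarrow> (real \<Rightarrow> real) \<Rightarrow> bool" where
  "test_function C \<phi> \<phi>' \<phi>'' \<longleftrightarrow>
     (\<forall>x. (\<phi> has_real_derivative \<phi>' x) (at x)) \<and> (\<forall>x. (\<phi>' has_real_derivative \<phi>'' x) (at x)) \<and>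
     (\<forall>x. \<bar>\<phi> x\<bar> \<le> C \<and> \<bar>\<phi>' x\<bar> \<le> C \<and> \<bar>\<phi>'' x\<bar> \<le> C) \<and>
     (\<forall>x y. \<bar>\<phi>'' x - \<phi>'' y\<bar> \<le> C * \<bar>x - y\<bar>)"

lemma lipschitz_of_deriv_bound:
  fixes f f' :: "real \<Rightarrow> real"
  assumes "\<And>x. (f has_real_derivative f' x) (at x)" "\<And>x. \<bar>f' x\<bar> \<le> C"
  shows "\<bar>f x - f y\<bar> \<le> C * \<bar>x - y\<bar>"
proof -
  have "norm (f x - f y) \<le> C * norm (x - y)"
    by (rule field_differentiable_bound[of UNIV f f']) (use assms in auto)
  then show ?thesis by simp
qed

lemma continuous_of_lipschitz:
  fixes f :: "real \<Rightarrow> real"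
  assumes "\<And>x y. \<bar>f x - f y\<bar> \<le> C * \<bar>x - y\<bar>"
  shows "continuous_on UNIV f"
proof -
  have "C-lipschitz_on UNIV f"
    using assms[of 0 1] by (intro lipschitz_onI) (use assms in \<open>auto simp: dist_real_def intro: order_trans[OF abs_ge_zero]\<close>)
  then show ?thesis by (rule lipschitz_on_continuous_on)
qed

lemma test_functionD:
  assumes "test_function C \<phi> \<phi>' \<phi>''"
  shows "(\<phi> has_real_derivative \<phi>' x) (at x)" "(\<phi>' has_real_derivative \<phi>'' x) (at x)"
    "\<bar>\<phi> x\<bar> \<le> C" "\<bar>\<phi>' x\<bar> \<le> C" "\<bar>\<phi>'' x\<bar> \<le> C" "\<bar>\<phi>'' x - \<phi>'' y\<bar> \<le> C * \<bar>x - y\<bar>"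
    "\<bar>\<phi>' x - \<phi>' y\<bar> \<le> C * \<bar>x - y\<bar>" "0 \<le> C"
    "continuous_on UNIV \<phi>" "continuous_on UNIV \<phi>'" "continuous_on UNIV \<phi>''"
proof -
  have *: "\<And>x. (\<phi> has_real_derivative \<phi>' x) (at x)" "\<And>x. (\<phi>' has_real_derivative \<phi>'' x) (at x)"
    "\<And>x. \<bar>\<phi> x\<bar> \<le> C" "\<And>x. \<bar>\<phi>' x\<bar> \<le> C" "\<And>x. \<bar>\<phi>'' x\<bar> \<le> C" "\<And>x y. \<bar>\<phi>'' x - \<phi>'' y\<bar> \<le> C * \<bar>x - y\<bar>"
    using assms unfolding test_function_def by auto
  from * show "(\<phi> has_real_derivative \<phi>' x) (at x)" "(\<phi>' has_real_derivative \<phi>'' x) (at x)"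
    "\<bar>\<phi> x\<bar> \<le> C" "\<bar>\<phi>' x\<bar> \<le> C" "\<bar>\<phi>'' x\<bar> \<le> C" "\<bar>\<phi>'' x - \<phi>'' y\<bar> \<le> C * \<bar>x - y\<bar>" by blast+
  show "\<bar>\<phi>' x - \<phi>' y\<bar> \<le> C * \<bar>x - y\<bar>" by (rule lipschitz_of_deriv_bound) (use * in auto)
  show "0 \<le> C" using *(3)[of 0] by simp
  show "continuous_on UNIV \<phi>" "continuous_on UNIV \<phi>'"
    using *(1,2) by (auto intro!: continuous_at_imp_continuous_on DERIV_isCont)
  show "continuous_on UNIV \<phi>''" using *(6) by (rule continuous_of_lipschitz)
qed

lemma set_integrable_bounded_borel:
  fixes f :: "real \<Rightarrow> real"
  assumes [measurable]: "f \<in> borel_measurable borel" and bound: "\<And>x. x \<in> {a..b} \<Longrightarrow> \<bar>f x\<bar> \<le> C"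
  shows "set_integrable lborel {a..b} f"
proof -
  have "integrable lborel (indicator {a..b} :: real \<Rightarrow> real)"
    by (rule integrable_real_indicator) (auto simp: emeasure_lborel_Icc_eq)
  then have "set_integrable lborel {a..b} (\<lambda>_. C)" by (simp add: set_integrable_def)
  then show ?thesis
    unfolding set_integrable_def
    by (rule Bochner_Integration.integrable_bound) (use bound in \<open>force simp: indicator_def\<close>)+
qed

lemma set_integral_bounded:
  fixes f :: "real \<Rightarrow> real"
  assumes [measurable]: "f \<in> borel_measurable borel"
    and bound: "\<And>x. x \<in> {a..b} \<Longrightarrow> \<bar>f x\<bar> \<le> C" and "a \<le> b"
  shows "\<bar>LBINT x:{a..b}. f x\<bar> \<le> C * (b - a)"
proof -
  have "\<bar>LBINT x:{a..b}. f x\<bar> \<le> (LBINT x:{a..b}. C)"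
    unfolding set_lebesgue_integral_def
  proof (rule integral_abs_bound_integral)
    show "integrable lborel (\<lambda>x. indicator {a..b} x *\<^sub>R f x)"
      using set_integrable_bounded_borel[of f a b C] bound by (simp add: set_integrable_def)
    show "integrable lborel (\<lambda>x. indicator {a..b} x *\<^sub>R C)"
      using set_integrable_bounded_borel[of "\<lambda>_. C" a b "\<bar>C\<bar>"] by (simp add: set_integrable_def)
  qed (use bound in \<open>auto simp: indicator_def\<close>)
  then show ?thesis using assms by (simp add: mult.commute set_lebesgue_integral_def)
qed

lemma set_integral_additive:
  fixes f :: "real \<Rightarrow> real"
  assumes [measurable]: "f \<in> borel_measurable borel" and bound: "\<And>x. \<bar>f x\<bar> \<le> C" and "a \<le> b" "b \<le> c"
  shows "(LBINT x:{a..c}. f x) = (LBINT x:{a..b}. f x) + (LBINT x:{b..c}. f x)"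
proof -
  have int: "integrable lborel (\<lambda>x. indicator {u..v} x *\<^sub>R f x)" for u v
    using set_integrable_bounded_borel[of f u v C] bound by (simp add: set_integrable_def)
  have "AE x in lborel. x \<noteq> b" by (rule AE_lborel_singleton)
  then have "AE x in lborel. indicator {a..c} x *\<^sub>R f x
      = indicator {a..b} x *\<^sub>R f x + indicator {b..c} x *\<^sub>R f x"
    by eventually_elim (use assms(3,4) in \<open>auto simp: indicator_def\<close>)
  then have "(LBINT x:{a..c}. f x)
      = (\<integral>x. indicator {a..b} x *\<^sub>R f x + indicator {b..c} x *\<^sub>R f x \<partial>lborel)"
    unfolding set_lebesgue_integral_def by (intro integral_cong_AE) auto
  also have "\<dots> = (LBINT x:{a..b}. f x) + (LBINT x:{b..c}. f x)"
    unfolding set_lebesgue_integral_def by (intro Bochner_Integration.integral_add int)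
  finally show ?thesis .
qed

text \<open>All that is used about an individual trajectory. The paths are continuous on the whole line because they
  will be frozen before time \<open>0\<close>, and the local time \<open>l\<close> is given by its defining limit.\<close>

locale refracted_path =
  fixes x b l :: "real \<Rightarrow> real" and \<beta> \<mu>\<^sub>p \<mu>\<^sub>m :: real
  assumes x_cont: "continuous_on UNIV x" and b_cont: "continuous_on UNIV b"
    and x_start: "x 0 = 0" and b_start: "b 0 = 0"
    and l_limit: "\<And>t. 0 \<le> t \<Longrightarrow> (occupation_ratio x t 0 \<longlongrightarrow> l t) (at_right 0)"
    and x_eq: "\<And>t. 0 \<le> t \<Longrightarrow> x t = b t + \<beta> * l t + (LBINT s:{0..t}. drift_coeff \<mu>\<^sub>p \<mu>\<^sub>m (x s))"
begin

abbreviation "m \<equiv> drift_coeff \<mu>\<^sub>p \<mu>\<^sub>m"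
abbreviation "K \<equiv> \<bar>\<mu>\<^sub>p\<bar> + \<bar>\<mu>\<^sub>m\<bar>"

lemma x_measurable [measurable]: "x \<in> borel_measurable borel"
  using x_cont by (rule borel_measurable_continuous_onI)

lemma l_0: "l 0 = 0"
proof -
  have "occupation_ratio x 0 0 \<epsilon> = 0" for \<epsilon>
  proof -
    have "measure lborel {s \<in> {0..0::real}. \<bar>x s - 0\<bar> \<le> \<epsilon>} \<le> measure lborel {0::real}"
      by (rule measure_mono_fmeasurable) (auto intro: fmeasurableI)
    then show ?thesis by (simp add: occupation_ratio_def measure_le_0_iff)
  qed
  then have "(occupation_ratio x 0 0 \<longlongrightarrow> 0) (at_right 0)" by (simp add: tendsto_eventually)
  then show ?thesis using l_limit[of 0] by (metis order_refl tendsto_unique trivial_limit_at_right_real)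
qed

lemma level_set_fmeasurable: "{r \<in> {s..t}. \<bar>x r - 0\<bar> \<le> \<epsilon>} \<in> fmeasurable lborel"
proof (rule fmeasurableI2)
  show "{s..t} \<in> fmeasurable lborel" by (rule fmeasurableI) (auto simp: emeasure_lborel_Icc_eq)
  have "{r \<in> space borel. s \<le> r \<and> r \<le> t \<and> \<bar>x r - 0\<bar> \<le> \<epsilon>} \<in> sets borel" by measurable
  then show "{r \<in> {s..t}. \<bar>x r - 0\<bar> \<le> \<epsilon>} \<in> sets lborel" by (simp add: conj_assoc)
qed auto

lemma l_mono: assumes "0 \<le> s" "s \<le> t" shows "l s \<le> l t"
proof (rule tendsto_le[OF trivial_limit_at_right_real l_limit l_limit])
  show "\<forall>\<^sub>F \<epsilon> in at_right 0. occupation_ratio x s 0 \<epsilon> \<le> occupation_ratio x t 0 \<epsilon>"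
  proof (rule eventually_at_right_less[THEN eventually_mono])
    fix \<epsilon> :: real assume "0 < \<epsilon>"
    have "measure lborel {r \<in> {0..s}. \<bar>x r - 0\<bar> \<le> \<epsilon>} \<le> measure lborel {r \<in> {0..t}. \<bar>x r - 0\<bar> \<le> \<epsilon>}"
      by (rule measure_mono_fmeasurable[OF _ _ level_set_fmeasurable])
         (use assms level_set_fmeasurable in \<open>auto simp: fmeasurableD\<close>)
    then show "occupation_ratio x s 0 \<epsilon> \<le> occupation_ratio x t 0 \<epsilon>"
      using \<open>0 < \<epsilon>\<close> by (simp add: occupation_ratio_def divide_right_mono)
  qed
qed (use assms in auto)

text \<open>On a compact interval without zeros the path stays away from \<open>0\<close>, so a narrow band around \<open>0\<close>
  collects no further occupation time.\<close>

lemma l_const_off_zeros: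
  assumes "0 \<le> s" "s \<le> t" and nz: "\<And>r. r \<in> {s..t} \<Longrightarrow> x r \<noteq> 0"
  shows "l s = l t"
proof -
  have "continuous_on {s..t} (\<lambda>r. \<bar>x r\<bar>)"
    using continuous_on_subset[OF x_cont] by (intro continuous_intros) auto
  then obtain r0 where r0: "r0 \<in> {s..t}" "\<And>r. r \<in> {s..t} \<Longrightarrow> \<bar>x r0\<bar> \<le> \<bar>x r\<bar>"
    using continuous_attains_inf[of "{s..t}" "\<lambda>r. \<bar>x r\<bar>"] assms(2) by auto
  have pos: "0 < \<bar>x r0\<bar>" using nz[OF r0(1)] by simp
  have "\<forall>\<^sub>F \<epsilon> in at_right 0. occupation_ratio x s 0 \<epsilon> = occupation_ratio x t 0 \<epsilon>"
    using eventually_at_right_real[OF pos]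
  proof eventually_elim
    case (elim \<epsilon>)
    have "r \<le> s" if "r \<in> {0..t}" "\<bar>x r\<bar> \<le> \<epsilon>" for r
      using r0(2)[of r] that elim by (cases "r \<le> s") auto
    then have "{r \<in> {0..t}. \<bar>x r - 0\<bar> \<le> \<epsilon>} = {r \<in> {0..s}. \<bar>x r - 0\<bar> \<le> \<epsilon>}"
      using assms(2) by auto
    then show ?case by (simp add: occupation_ratio_def)
  qed
  then have "(occupation_ratio x t 0 \<longlongrightarrow> l s) (at_right 0)"
    using l_limit[OF assms(1)] by (subst tendsto_cong[symmetric])
  then show ?thesis using l_limit[of t] assms by (meson order_trans tendsto_unique trivial_limit_at_right_real)
qed

lemma drift_additive:
  assumes "0 \<le> s" "s \<le> t"
  shows "(LBINT r:{0..t}. m (x r)) = (LBINT r:{0..s}. m (x r)) + (LBINT r:{s..t}. m (x r))"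
  by (rule set_integral_additive[OF _ _ assms, of _ K]) (auto intro: drift_coeff_bound)

lemma drift_bound: "s \<le> t \<Longrightarrow> \<bar>LBINT r:{s..t}. m (x r)\<bar> \<le> K * (t - s)"
  by (rule set_integral_bounded) (auto intro: drift_coeff_bound)

text \<open>At the last zero \<open>g\<close> before \<open>t\<close> the equation reads \<open>0 = b g + \<beta> l g + drift\<close>, and \<open>\<beta> l\<close> does not change
  between \<open>g\<close> and \<open>t\<close>. Hence a maximal inequality for \<open>b\<close> alone gives moments of the local time.\<close>

lemma local_time_at_zero:
  assumes "0 \<le> t"
  shows "\<exists>g\<in>{0..t}. \<bar>\<beta> * l t\<bar> \<le> \<bar>b g\<bar> + K * t"
proof -
  define Z where "Z = {r \<in> {0..t}. x r = 0}"
  have "compact Z"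
  proof -
    have "closed ({0..t} \<inter> x -` {0})"
      using continuous_on_subset[OF x_cont] by (intro continuous_closed_preimage) auto
    then show ?thesis
      unfolding Z_def by (auto simp: compact_eq_bounded_closed vimage_def Int_def intro: bounded_subset[of "{0..t}"])
  qed
  moreover have "Z \<noteq> {}" using x_start assms by (auto simp: Z_def)
  ultimately obtain g where g: "g \<in> Z" "\<And>r. r \<in> Z \<Longrightarrow> r \<le> g" by (meson compact_attains_sup)
  have g0: "0 \<le> g" "g \<le> t" "x g = 0" using g(1) by (auto simp: Z_def)
  \<comment> \<open>The local time is constant on each \<open>[r n, t]\<close>; since \<open>\<beta> l\<close> is continuous by the equation, the value persists at \<open>g\<close>.\<close>
  define r where "r n = g + (t - g) / real (Suc n)" for n
  have r: "g \<le> r n" "r n \<le> t" for n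
  proof -
    have "(t - g) / real (Suc n) \<le> (t - g) / 1" using g0 by (intro divide_left_mono) auto
    then show "g \<le> r n" "r n \<le> t" using g0 by (auto simp: r_def)
  qed
  have Y_eq: "\<beta> * l (r n) = \<beta> * l t" if "g < t" for n
  proof -
    have "g < r n" using that by (simp add: r_def)
    have "x v \<noteq> 0" if "v \<in> {r n..t}" for v
    proof
      assume "x v = 0"
      then have "v \<in> Z" using that g0 r[of n] by (auto simp: Z_def)
      then show False using g(2)[of v] that \<open>g < r n\<close> by simp
    qed
    then have "l (r n) = l t"
      using g0 r[of n] by (intro l_const_off_zeros) auto
    then show ?thesis by simp
  qed
  have r_lim: "r \<longlonglongrightarrow> g"
    using tendsto_add[OF tendsto_const tendsto_mult_left[OF LIMSEQ_inverse_real_of_nat], of g "t - g"]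
    by (simp add: r_def[abs_def] divide_inverse)
  have "(\<lambda>n. LBINT u:{g..r n}. m (x u)) \<longlonglongrightarrow> 0"
  proof (rule Lim_null_comparison)
    show "\<forall>\<^sub>F n in sequentially. norm (LBINT u:{g..r n}. m (x u)) \<le> K * (r n - g)"
      using drift_bound r by simp
    have "(\<lambda>n. K * (r n - g)) \<longlonglongrightarrow> K * (g - g)" by (intro tendsto_intros r_lim)
    then show "(\<lambda>n. K * (r n - g)) \<longlonglongrightarrow> 0" by simp
  qed
  moreover have "(\<lambda>n. x (r n)) \<longlonglongrightarrow> x g" "(\<lambda>n. b (r n)) \<longlonglongrightarrow> b g"
    by (rule continuous_on_tendsto_compose[OF x_cont r_lim] continuous_on_tendsto_compose[OF b_cont r_lim]; simp)+
  ultimately have "(\<lambda>n. x (r n) - b (r n) - (LBINT u:{0..g}. m (x u)) - (LBINT u:{g..r n}. m (x u)))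
      \<longlonglongrightarrow> x g - b g - (LBINT u:{0..g}. m (x u)) - 0"
    by (intro tendsto_intros)
  moreover have "x (r n) - b (r n) - (LBINT u:{0..g}. m (x u)) - (LBINT u:{g..r n}. m (x u)) = \<beta> * l (r n)" for n
    using x_eq[of "r n"] drift_additive[of g "r n"] g0 r[of n] by simp
  ultimately have lim: "(\<lambda>n. \<beta> * l (r n)) \<longlonglongrightarrow> - b g - (LBINT u:{0..g}. m (x u))"
    using g0 by simp
  have "\<beta> * l t = - b g - (LBINT u:{0..g}. m (x u))"
  proof (cases "g < t")
    case True
    then show ?thesis using lim Y_eq by (simp add: LIMSEQ_const_iff)
  next
    case False
    then show ?thesis using x_eq[of g] g0 by simp
  qed
  moreover have "\<bar>LBINT u:{0..g}. m (x u)\<bar> \<le> K * t"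
    using drift_bound[of 0 g] g0 mult_left_mono[of g t K] by simp
  ultimately show ?thesis using g0 by (intro bexI[of _ g]) auto
qed

end

section \<open>Ito sums along a path\<close>

definition grid :: "real \<Rightarrow> real \<Rightarrow> nat \<Rightarrow> nat \<Rightarrow> real" where
  "grid s t n i = s + real i * ((t - s) / real n)"

text \<open>The increment of \<open>\<phi>(x)\<close> over each grid cell, after removing the part caused by \<open>b\<close> alone and adding
  the quadratic term which that part contributes on average.\<close>

definition grid_sum ::
    "(real \<Rightarrow> real) \<Rightarrow> (real \<Rightarrow> real) \<Rightarrow> (real \<Rightarrow> real) \<Rightarrow> (real \<Rightarrow> real) \<Rightarrow> real \<Rightarrow> real \<Rightarrow> nat \<Rightarrow> real" where
  "grid_sum x b \<phi> \<phi>'' s t n = (\<Sum>i<n. \<phi> (x (grid s t n (Suc i))) -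
     \<phi> (x (grid s t n i) + (b (grid s t n (Suc i)) - b (grid s t n i))) + \<phi>'' (x (grid s t n i)) / 2 * ((t - s) / real n))"

context refracted_path begin

abbreviation generator :: "(real \<Rightarrow> real) \<Rightarrow> (real \<Rightarrow> real) \<Rightarrow> real \<Rightarrow> real" where
  "generator \<phi>' \<phi>'' y \<equiv> m y * \<phi>' y + \<phi>'' y / 2"

text \<open>By the mean value theorem the increment equals \<open>\<phi>'(\<xi>)\<close> times the increment of \<open>x - b\<close>, whose absolutely
  continuous part is compared with the integral. If the local time part is not zero, the path
  visits \<open>0\<close> within the cell, so \<open>\<phi>'(\<xi>)\<close> may be replaced by \<open>\<phi>'(0)\<close>.\<close>

lemma ito_step:
  assumes tf: "test_function C \<phi> \<phi>' \<phi>''" and r: "0 \<le> r0" "r0 \<le> r1"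
    and oscx: "\<And>r r'. r \<in> {r0..r1} \<Longrightarrow> r' \<in> {r0..r1} \<Longrightarrow> \<bar>x r - x r'\<bar> \<le> d" and oscb: "\<bar>b r1 - b r0\<bar> \<le> d"
  shows "\<bar>\<phi> (x r1) - \<phi> (x r0 + (b r1 - b r0)) + \<phi>'' (x r0) / 2 * (r1 - r0)
      - (LBINT r:{r0..r1}. generator \<phi>' \<phi>'' (x r)) - \<phi>' 0 * (\<beta> * (l r1 - l r0))\<bar>
    \<le> d * (2 * C * (K * (r1 - r0) + \<bar>\<beta>\<bar> * (l r1 - l r0)) + C * (r1 - r0))"
proof -
  note [measurable] = test_functionD(9-11)[OF tf, THEN borel_measurable_continuous_onI]
  have C0: "0 \<le> C" and d0: "0 \<le> d" using test_functionD(8)[OF tf] oscb by auto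
  define \<Delta> where "\<Delta> = l r1 - l r0"
  have \<Delta>0: "0 \<le> \<Delta>" using l_mono[OF r] by (simp add: \<Delta>_def)
  define u where "u = x r0 + (b r1 - b r0)"
  obtain \<xi> where \<xi>: "min u (x r1) \<le> \<xi>" "\<xi> \<le> max u (x r1)" "\<phi> (x r1) - \<phi> u = \<phi>' \<xi> * (x r1 - u)"
    using real_mvt[OF test_functionD(1)[OF tf]] by blast
  have \<xi>_near: "\<bar>\<xi> - x r\<bar> \<le> 2 * d" if "r \<in> {r0..r1}" for r
  proof -
    have "\<bar>x r0 - x r\<bar> \<le> d" "\<bar>x r1 - x r\<bar> \<le> d" using oscx that r by auto
    then show ?thesis using \<xi>(1,2) oscb unfolding u_def by (auto simp: min_def max_def abs_le_iff split: if_splits)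
  qed
  have \<phi>'_near: "\<bar>\<phi>' \<xi> - \<phi>' (x r)\<bar> \<le> 2 * d * C" if "r \<in> {r0..r1}" for r
  proof -
    have "\<bar>\<phi>' \<xi> - \<phi>' (x r)\<bar> \<le> C * \<bar>\<xi> - x r\<bar>" by (rule test_functionD(7)[OF tf])
    also have "\<dots> \<le> C * (2 * d)" by (intro mult_left_mono \<xi>_near that C0)
    finally show ?thesis by (simp add: mult_ac)
  qed
  have v: "x r1 - u = \<beta> * \<Delta> + (LBINT r:{r0..r1}. m (x r))"
    using x_eq[of r0] x_eq[of r1] drift_additive[OF r] r by (simp add: u_def \<Delta>_def algebra_simps)
  have local: "\<bar>(\<phi>' \<xi> - \<phi>' 0) * (\<beta> * \<Delta>)\<bar> \<le> 2 * d * C * (\<bar>\<beta>\<bar> * \<Delta>)"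
  proof (cases "\<Delta> = 0")
    case False
    then obtain r where "r \<in> {r0..r1}" "x r = 0" using l_const_off_zeros[OF r] by (auto simp: \<Delta>_def)
    then have "\<bar>\<phi>' \<xi> - \<phi>' 0\<bar> \<le> 2 * d * C" using \<phi>'_near by metis
    then show ?thesis using \<Delta>0 by (auto simp: abs_mult intro!: mult_right_mono)
  qed auto
  have bnd: "\<bar>\<phi>' y\<bar> \<le> C" "\<bar>\<phi>'' y\<bar> \<le> C" "\<bar>m y * \<phi>' y\<bar> \<le> K * C" for y
    using test_functionD(4,5)[OF tf] drift_coeff_bound[of \<mu>\<^sub>p \<mu>\<^sub>m y] C0
    by (auto simp: abs_mult intro!: mult_mono)
  have int: "set_integrable lborel {r0..r1} (\<lambda>r. m (x r))"
    "set_integrable lborel {r0..r1} (\<lambda>r. m (x r) * \<phi>' (x r))" "set_integrable lborel {r0..r1} (\<lambda>r. \<phi>'' (x r))"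
    using set_integrable_bounded_borel[of "\<lambda>r. m (x r)" _ _ K] drift_coeff_bound
      set_integrable_bounded_borel[of "\<lambda>r. m (x r) * \<phi>' (x r)" _ _ "K * C"]
      set_integrable_bounded_borel[of "\<lambda>r. \<phi>'' (x r)" _ _ C] bnd by auto
  have int_const: "set_integrable lborel {r0..r1} (\<lambda>_. c)" for c :: real
    by (rule set_integrable_bounded_borel[of _ _ _ "\<bar>c\<bar>"]) auto
  have "\<phi>' \<xi> * (LBINT r:{r0..r1}. m (x r)) + \<phi>'' (x r0) / 2 * (r1 - r0)
      - (LBINT r:{r0..r1}. generator \<phi>' \<phi>'' (x r))
    = (LBINT r:{r0..r1}. (\<phi>' \<xi> - \<phi>' (x r)) * m (x r) + (\<phi>'' (x r0) - \<phi>'' (x r)) / 2)"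
  proof -
    have "(LBINT r:{r0..r1}. (\<phi>' \<xi> - \<phi>' (x r)) * m (x r) + (\<phi>'' (x r0) - \<phi>'' (x r)) / 2)
      = (LBINT r:{r0..r1}. (\<phi>' \<xi> * m (x r) + \<phi>'' (x r0) / 2) - generator \<phi>' \<phi>'' (x r))"
      by (rule set_lebesgue_integral_cong) (auto simp: algebra_simps diff_divide_distrib)
    also have "\<dots> = (LBINT r:{r0..r1}. \<phi>' \<xi> * m (x r) + \<phi>'' (x r0) / 2) - (LBINT r:{r0..r1}. generator \<phi>' \<phi>'' (x r))"
      using int by (intro set_integral_diff(2) set_integral_add(1)) (auto intro: int_const)
    also have "(LBINT r:{r0..r1}. \<phi>' \<xi> * m (x r) + \<phi>'' (x r0) / 2) = \<phi>' \<xi> * (LBINT r:{r0..r1}. m (x r)) + \<phi>'' (x r0) / 2 * (r1 - r0)"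
      using int r by (subst set_integral_add(2)) (auto simp: int_const set_lebesgue_integral_def)
    finally show ?thesis by simp
  qed
  moreover have arith_aux: "\<bar>B\<bar> \<le> c \<Longrightarrow> \<bar>A\<bar> \<le> k \<Longrightarrow> 0 \<le> c \<Longrightarrow> \<bar>A + B / 2\<bar> \<le> k + c" for A B c k :: real
    by arith
  moreover have "\<bar>LBINT r:{r0..r1}. (\<phi>' \<xi> - \<phi>' (x r)) * m (x r) + (\<phi>'' (x r0) - \<phi>'' (x r)) / 2\<bar>
      \<le> (2 * d * C * K + d * C) * (r1 - r0)"
  proof (rule set_integral_bounded)
    fix r assume r': "r \<in> {r0..r1}"
    have "\<bar>\<phi>'' (x r0) - \<phi>'' (x r)\<bar> \<le> C * d"
      using test_functionD(6)[OF tf, of "x r0" "x r"] oscx[of r0 r] r r' C0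
      by (auto intro: order_trans mult_left_mono)
    moreover have "\<bar>(\<phi>' \<xi> - \<phi>' (x r)) * m (x r)\<bar> \<le> 2 * d * C * K"
      unfolding abs_mult using \<phi>'_near[OF r'] drift_coeff_bound C0 d0 by (intro mult_mono) auto
    moreover have "0 \<le> C * d" using C0 d0 by simp
    ultimately show "\<bar>(\<phi>' \<xi> - \<phi>' (x r)) * m (x r) + (\<phi>'' (x r0) - \<phi>'' (x r)) / 2\<bar> \<le> 2 * d * C * K + d * C"
      unfolding mult.commute[of d C] using arith_aux by blast
  qed (use r in auto)
  moreover have "\<phi> (x r1) - \<phi> (x r0 + (b r1 - b r0)) = \<phi>' \<xi> * (\<beta> * \<Delta>) + \<phi>' \<xi> * (LBINT r:{r0..r1}. m (x r))"
    using \<xi>(3) unfolding v distrib_left by (simp add: u_def)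
  ultimately have eq: "\<phi> (x r1) - \<phi> (x r0 + (b r1 - b r0)) + \<phi>'' (x r0) / 2 * (r1 - r0)
      - (LBINT r:{r0..r1}. generator \<phi>' \<phi>'' (x r)) - \<phi>' 0 * (\<beta> * \<Delta>)
    = (LBINT r:{r0..r1}. (\<phi>' \<xi> - \<phi>' (x r)) * m (x r) + (\<phi>'' (x r0) - \<phi>'' (x r)) / 2)
      + (\<phi>' \<xi> - \<phi>' 0) * (\<beta> * \<Delta>)"
    and bound: "\<bar>LBINT r:{r0..r1}. (\<phi>' \<xi> - \<phi>' (x r)) * m (x r) + (\<phi>'' (x r0) - \<phi>'' (x r)) / 2\<bar>
      \<le> (2 * d * C * K + d * C) * (r1 - r0)"
    unfolding left_diff_distrib by linarith+
  have "(2 * d * C * K + d * C) * (r1 - r0) + 2 * d * C * (\<bar>\<beta>\<bar> * \<Delta>)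
      = d * (2 * C * (K * (r1 - r0) + \<bar>\<beta>\<bar> * \<Delta>) + C * (r1 - r0))"
    by (simp add: algebra_simps)
  then show ?thesis unfolding \<Delta>_def[symmetric] eq using bound local by linarith
qed

lemma generator_bound:
  assumes tf: "test_function C \<phi> \<phi>' \<phi>''"
  shows "\<bar>generator \<phi>' \<phi>'' y\<bar> \<le> (K + 1) * C"
proof -
  have "\<bar>m y * \<phi>' y\<bar> \<le> K * C"
    unfolding abs_mult using test_functionD(4,8)[OF tf] drift_coeff_bound by (intro mult_mono) auto
  then show ?thesis using test_functionD(5)[OF tf, of y] by (simp add: algebra_simps abs_le_iff)
qed

lemma generator_measurable:
  assumes tf: "test_function C \<phi> \<phi>' \<phi>''"
  shows "generator \<phi>' \<phi>'' \<in> borel_measurable borel"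
proof -
  note [measurable] = test_functionD(10,11)[OF tf, THEN borel_measurable_continuous_onI]
  show ?thesis by measurable
qed

lemma grid_sum_close:
  assumes tf: "test_function C \<phi> \<phi>' \<phi>''" and st: "0 \<le> s" "s \<le> t" and n: "0 < n"
    and osc: "\<And>r r'. r \<in> {s..t} \<Longrightarrow> r' \<in> {s..t} \<Longrightarrow> \<bar>r - r'\<bar> \<le> (t - s) / real n \<Longrightarrow> \<bar>x r - x r'\<bar> \<le> d \<and> \<bar>b r - b r'\<bar> \<le> d"
  shows "\<bar>grid_sum x b \<phi> \<phi>'' s t n - (LBINT r:{s..t}. generator \<phi>' \<phi>'' (x r)) - \<phi>' 0 * (\<beta> * (l t - l s))\<bar>
    \<le> d * (2 * C * (K * (t - s) + \<bar>\<beta>\<bar> * (l t - l s)) + C * (t - s))"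
proof -
  note [measurable] = generator_measurable[OF tf]
  define g where "g = grid s t n"
  define G where "G u = (LBINT r:{0..u}. generator \<phi>' \<phi>'' (x r))" for u
  have g_ends: "g 0 = s" "g n = t" using n by (auto simp: g_def grid_def)
  have g_step: "g (Suc i) = g i + (t - s) / real n" for i by (simp add: g_def grid_def distrib_right add_divide_distrib)
  have g_le: "g i \<le> g (Suc i)" for i using st by (simp add: g_step)
  have g_mono: "mono g" using g_le by (rule mono_iff_le_Suc[THEN iffD2, rule_format])
  have g_range: "s \<le> g i" "i \<le> n \<Longrightarrow> g i \<le> t" for i
    using monoD[OF g_mono, of 0 i] monoD[OF g_mono, of i n] g_ends by auto
  have G_diff: "(LBINT r:{u..v}. generator \<phi>' \<phi>'' (x r)) = G v - G u" if "0 \<le> u" "u \<le> v" for u v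
    unfolding G_def using set_integral_additive[of "\<lambda>r. generator \<phi>' \<phi>'' (x r)" "(K + 1) * C", OF _ generator_bound[OF tf] that]
    by simp
  define err where "err i = \<phi> (x (g (Suc i))) - \<phi> (x (g i) + (b (g (Suc i)) - b (g i)))
    + \<phi>'' (x (g i)) / 2 * ((t - s) / real n) - (G (g (Suc i)) - G (g i)) - \<phi>' 0 * (\<beta> * (l (g (Suc i)) - l (g i)))" for i
  have err_bound: "\<bar>err i\<bar> \<le> d * (2 * C * (K * (g (Suc i) - g i) + \<bar>\<beta>\<bar> * (l (g (Suc i)) - l (g i))) + C * (g (Suc i) - g i))"
    if "i < n" for i
  proof -
    have i: "0 \<le> g i" "g i \<le> g (Suc i)" "s \<le> g i" "g (Suc i) \<le> t"
      using g_range[of i] g_range(2)[of "Suc i"] st g_le that by auto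
    have "\<bar>\<phi> (x (g (Suc i))) - \<phi> (x (g i) + (b (g (Suc i)) - b (g i))) + \<phi>'' (x (g i)) / 2 * (g (Suc i) - g i)
      - (LBINT r:{g i..g (Suc i)}. generator \<phi>' \<phi>'' (x r)) - \<phi>' 0 * (\<beta> * (l (g (Suc i)) - l (g i)))\<bar>
      \<le> d * (2 * C * (K * (g (Suc i) - g i) + \<bar>\<beta>\<bar> * (l (g (Suc i)) - l (g i))) + C * (g (Suc i) - g i))"
    proof (rule ito_step[OF tf i(1,2)])
      fix r r' assume "r \<in> {g i..g (Suc i)}" "r' \<in> {g i..g (Suc i)}"
      then have "r \<in> {s..t}" "r' \<in> {s..t}" "\<bar>r - r'\<bar> \<le> (t - s) / real n" using i g_step[of i] by auto
      then show "\<bar>x r - x r'\<bar> \<le> d" using osc by blast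
    next
      show "\<bar>b (g (Suc i)) - b (g i)\<bar> \<le> d" using i g_step[of i] osc[of "g (Suc i)" "g i"] by auto
    qed
    then show ?thesis using G_diff[OF i(1,2)] g_step[of i] by (simp add: err_def)
  qed
  have "grid_sum x b \<phi> \<phi>'' s t n - (LBINT r:{s..t}. generator \<phi>' \<phi>'' (x r)) - \<phi>' 0 * (\<beta> * (l t - l s)) = (\<Sum>i<n. err i)"
  proof -
    have "(\<Sum>i<n. \<phi>' 0 * (\<beta> * (l (g (Suc i)) - l (g i)))) = \<phi>' 0 * (\<beta> * (\<Sum>i<n. l (g (Suc i)) - l (g i)))"
      by (simp only: sum_distrib_left)
    then have "(\<Sum>i<n. err i) = grid_sum x b \<phi> \<phi>'' s t n - (\<Sum>i<n. G (g (Suc i)) - G (g i)) - \<phi>' 0 * (\<beta> * (\<Sum>i<n. l (g (Suc i)) - l (g i)))"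
      unfolding err_def grid_sum_def g_def[symmetric] by (simp only: sum_subtractf)
    then show ?thesis using G_diff[OF st] g_ends
      by (simp add: sum_lessThan_telescope sum_lessThan_telescope[of "\<lambda>i. G (g i)"] sum_lessThan_telescope[of "\<lambda>i. l (g i)"])
  qed
  also have "\<bar>\<dots>\<bar> \<le> (\<Sum>i<n. d * (2 * C * (K * (g (Suc i) - g i) + \<bar>\<beta>\<bar> * (l (g (Suc i)) - l (g i))) + C * (g (Suc i) - g i)))"
    by (rule order_trans[OF sum_abs sum_mono]) (use err_bound in auto)
  also have "\<dots> = d * (2 * C * (K * (\<Sum>i<n. g (Suc i) - g i) + \<bar>\<beta>\<bar> * (\<Sum>i<n. l (g (Suc i)) - l (g i))) + C * (\<Sum>i<n. g (Suc i) - g i))"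
    by (simp only: sum_distrib_left[symmetric] sum.distrib)
  also have "\<dots> = d * (2 * C * (K * (t - s) + \<bar>\<beta>\<bar> * (l t - l s)) + C * (t - s))"
    by (simp add: sum_lessThan_telescope[of g] sum_lessThan_telescope[of "\<lambda>i. l (g i)"] g_ends)
  finally show ?thesis .
qed

lemma grid_sum_tendsto:
  assumes tf: "test_function C \<phi> \<phi>' \<phi>''" and st: "0 \<le> s" "s \<le> t"
  shows "grid_sum x b \<phi> \<phi>'' s t \<longlonglongrightarrow> (LBINT r:{s..t}. generator \<phi>' \<phi>'' (x r)) + \<phi>' 0 * (\<beta> * (l t - l s))"
proof (rule LIMSEQ_I)
  fix e :: real assume e: "0 < e"
  define A where "A = 2 * C * (K * (t - s) + \<bar>\<beta>\<bar> * (l t - l s)) + C * (t - s)"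
  have A0: "0 \<le> A" using test_functionD(8)[OF tf] l_mono[OF st] st by (simp add: A_def)
  define d where "d = e / (2 * (A + 1))"
  have d: "0 < d" "d * A < e"
  proof -
    show "0 < d" using e A0 by (simp add: d_def)
    have "e * A < e * (2 * (A + 1))" using e A0 by (intro mult_strict_left_mono) auto
    then show "d * A < e" using A0 by (simp add: d_def divide_less_eq)
  qed
  have uc: "\<exists>\<delta>>0. \<forall>r\<in>{s..t}. \<forall>r'\<in>{s..t}. \<bar>r - r'\<bar> < \<delta> \<longrightarrow> \<bar>f r - f r'\<bar> < d" if "continuous_on UNIV f" for f :: "real \<Rightarrow> real"
    using compact_uniformly_continuous[OF continuous_on_subset[OF that, of "{s..t}"]] d(1)
    unfolding uniformly_continuous_on_def dist_real_def by (metis abs_minus_commute compact_Icc subset_UNIV)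
  obtain \<delta>1 where \<delta>1: "\<delta>1 > 0" "\<And>r r'. r \<in> {s..t} \<Longrightarrow> r' \<in> {s..t} \<Longrightarrow> \<bar>r - r'\<bar> < \<delta>1 \<Longrightarrow> \<bar>x r - x r'\<bar> < d"
    using uc[OF x_cont] by blast
  obtain \<delta>2 where \<delta>2: "\<delta>2 > 0" "\<And>r r'. r \<in> {s..t} \<Longrightarrow> r' \<in> {s..t} \<Longrightarrow> \<bar>r - r'\<bar> < \<delta>2 \<Longrightarrow> \<bar>b r - b r'\<bar> < d"
    using uc[OF b_cont] by blast
  have "(\<lambda>n. (t - s) / real n) \<longlonglongrightarrow> 0" by (rule lim_const_over_n)
  then have "\<forall>\<^sub>F n in sequentially. (t - s) / real n < min \<delta>1 \<delta>2"
    using \<delta>1(1) \<delta>2(1) by (intro order_tendstoD(2)) auto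
  with eventually_gt_at_top[of 0]
  have "\<forall>\<^sub>F n in sequentially. norm (grid_sum x b \<phi> \<phi>'' s t n - ((LBINT r:{s..t}. generator \<phi>' \<phi>'' (x r)) + \<phi>' 0 * (\<beta> * (l t - l s)))) < e"
  proof eventually_elim
    case (elim n)
    have "\<bar>grid_sum x b \<phi> \<phi>'' s t n - (LBINT r:{s..t}. generator \<phi>' \<phi>'' (x r)) - \<phi>' 0 * (\<beta> * (l t - l s))\<bar> \<le> d * A"
      unfolding A_def using elim \<delta>1(2) \<delta>2(2) by (intro grid_sum_close[OF tf st]) (auto intro!: less_imp_le)
    then show ?case using d(2) by (simp add: diff_diff_eq)
  qed
  then show "\<exists>no. \<forall>n\<ge>no. norm (grid_sum x b \<phi> \<phi>'' s t n - ((LBINT r:{s..t}. generator \<phi>' \<phi>'' (x r)) + \<phi>' 0 * (\<beta> * (l t - l s)))) < e"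
    by (simp add: eventually_sequentially)
qed

text \<open>This bound does not depend on the mesh and is the dominating function when expectations are taken.\<close>

lemma grid_sum_bound:
  assumes tf: "test_function C \<phi> \<phi>' \<phi>''" and st: "0 \<le> s" "s \<le> t"
  shows "\<bar>grid_sum x b \<phi> \<phi>'' s t n\<bar> \<le> C * (K * (t - s) + \<bar>\<beta>\<bar> * (l t - l s)) + C * (t - s)"
proof (cases "n = 0")
  case True
  have "0 \<le> C * (K * (t - s) + \<bar>\<beta>\<bar> * (l t - l s)) + C * (t - s)"
    using test_functionD(8)[OF tf] l_mono[OF st] st by simp
  then show ?thesis using True by (simp add: grid_sum_def)
next
  case False
  define g where "g = grid s t n"
  have C0: "0 \<le> C" by (rule test_functionD(8)[OF tf])
  have g_ends: "g 0 = s" "g n = t" using False by (auto simp: g_def grid_def)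
  have g_step: "g (Suc i) = g i + (t - s) / real n" for i by (simp add: g_def grid_def distrib_right add_divide_distrib)
  have g_le: "s \<le> g i" "g i \<le> g (Suc i)" for i using st by (auto simp: g_step) (simp add: g_def grid_def)
  have "\<bar>\<phi> (x (g (Suc i))) - \<phi> (x (g i) + (b (g (Suc i)) - b (g i))) + \<phi>'' (x (g i)) / 2 * ((t - s) / real n)\<bar>
      \<le> C * (K * (g (Suc i) - g i) + \<bar>\<beta>\<bar> * (l (g (Suc i)) - l (g i))) + C * (g (Suc i) - g i)" (is "_ \<le> ?B i") for i
  proof -
    have i: "0 \<le> g i" "g i \<le> g (Suc i)" using g_le st by (auto intro: order_trans)
    have "\<bar>\<phi> (x (g (Suc i))) - \<phi> (x (g i) + (b (g (Suc i)) - b (g i)))\<bar> \<le> C * \<bar>x (g (Suc i)) - (x (g i) + (b (g (Suc i)) - b (g i)))\<bar>"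
      by (rule lipschitz_of_deriv_bound) (use test_functionD[OF tf] in auto)
    also have "x (g (Suc i)) - (x (g i) + (b (g (Suc i)) - b (g i))) = \<beta> * (l (g (Suc i)) - l (g i)) + (LBINT r:{g i..g (Suc i)}. m (x r))"
      using x_eq[of "g i"] x_eq[of "g (Suc i)"] drift_additive[OF i] i by (simp add: algebra_simps)
    also have "\<bar>\<dots>\<bar> \<le> \<bar>\<beta>\<bar> * (l (g (Suc i)) - l (g i)) + K * (g (Suc i) - g i)"
      using drift_bound[OF i(2)] l_mono[OF i] by (intro order_trans[OF abs_triangle_ineq] add_mono) (auto simp: abs_mult)
    finally have 1: "\<bar>\<phi> (x (g (Suc i))) - \<phi> (x (g i) + (b (g (Suc i)) - b (g i)))\<bar>
      \<le> C * (K * (g (Suc i) - g i) + \<bar>\<beta>\<bar> * (l (g (Suc i)) - l (g i)))" using C0 by (simp add: mult_left_mono add.commute)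
    have "\<bar>\<phi>'' (x (g i)) / 2 * ((t - s) / real n)\<bar> \<le> C * (g (Suc i) - g i)"
    proof -
      have "\<bar>\<phi>'' (x (g i)) / 2\<bar> * ((t - s) / real n) \<le> C * ((t - s) / real n)"
        using test_functionD(5)[OF tf, of "x (g i)"] C0 st by (intro mult_right_mono) auto
      then show ?thesis using st by (simp add: abs_mult g_step)
    qed
    with 1 show ?thesis by linarith
  qed
  then have "\<bar>grid_sum x b \<phi> \<phi>'' s t n\<bar> \<le> (\<Sum>i<n. ?B i)"
    unfolding grid_sum_def g_def[symmetric] by (intro order_trans[OF sum_abs sum_mono])
  also have "\<dots> = C * (K * (\<Sum>i<n. g (Suc i) - g i) + \<bar>\<beta>\<bar> * (\<Sum>i<n. l (g (Suc i)) - l (g i))) + C * (\<Sum>i<n. g (Suc i) - g i)"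
    by (simp only: sum_distrib_left[symmetric] sum.distrib)
  also have "\<dots> = C * (K * (t - s) + \<bar>\<beta>\<bar> * (l t - l s)) + C * (t - s)"
    by (simp add: sum_lessThan_telescope[of g] sum_lessThan_telescope[of "\<lambda>i. l (g i)"] g_ends)
  finally show ?thesis .
qed

section \<open>Occupation time and local time\<close>

lemma zero_set_measure:
  assumes "0 \<le> t"
  shows "measure lborel {r \<in> {0..t}. \<bar>x r\<bar> \<le> 0} = 0"
proof -
  have "measure lborel {r \<in> {0..t}. \<bar>x r - 0\<bar> \<le> 0} \<le> 2 * \<epsilon> * occupation_ratio x t 0 \<epsilon>" if "\<epsilon> > 0" for \<epsilon>
  proof -
    have "measure lborel {r \<in> {0..t}. \<bar>x r - 0\<bar> \<le> 0} \<le> measure lborel {r \<in> {0..t}. \<bar>x r - 0\<bar> \<le> \<epsilon>}"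
      using that level_set_fmeasurable by (intro measure_mono_fmeasurable) (auto simp: fmeasurableD)
    then show ?thesis using that by (simp add: occupation_ratio_def)
  qed
  then have "\<forall>\<^sub>F \<epsilon> in at_right 0. measure lborel {r \<in> {0..t}. \<bar>x r - 0\<bar> \<le> 0} \<le> 2 * \<epsilon> * occupation_ratio x t 0 \<epsilon>"
    by (auto simp: eventually_at_filter)
  moreover have "((\<lambda>\<epsilon>. 2 * \<epsilon> * occupation_ratio x t 0 \<epsilon>) \<longlongrightarrow> 2 * 0 * l t) (at_right 0)"
    by (intro tendsto_intros l_limit assms)
  ultimately have "measure lborel {r \<in> {0..t}. \<bar>x r - 0\<bar> \<le> 0} \<le> 2 * 0 * l t"
    by (intro tendsto_lowerbound[OF _ _ trivial_limit_at_right_real])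
  then show ?thesis by (simp add: measure_le_0_iff)
qed

text \<open>A tent is an average of indicators of centred intervals, so its time integral is an average of occupation times.\<close>

lemma tent_integral_eq:
  assumes "0 < \<epsilon>" "0 \<le> t"
  shows "(LBINT r:{0..t}. tent \<epsilon> (x r)) = (LBINT u:{0..\<epsilon>}. measure lborel {r \<in> {0..t}. \<bar>x r\<bar> \<le> u}) / \<epsilon>\<^sup>2"
proof -
  define f where "f = (\<lambda>(r, u). indicator {0..t} r * (indicator {0..\<epsilon>} u * indicator {v. \<bar>x r\<bar> \<le> v} u) :: real)"
  have f_meas: "f \<in> borel_measurable (lborel \<Otimes>\<^sub>M lborel)"
  proof -
    have "f = (\<lambda>p. indicator {0..t} (fst p) * (indicator {0..\<epsilon>} (snd p) * indicator {p. \<bar>x (fst p)\<bar> \<le> snd p} p))"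
      by (auto simp: f_def split: split_indicator)
    moreover have "{p \<in> space (lborel \<Otimes>\<^sub>M lborel). \<bar>x (fst p)\<bar> \<le> snd p} \<in> sets (lborel \<Otimes>\<^sub>M lborel)" by measurable
    ultimately show ?thesis by (simp add: space_pair_measure)
  qed
  have "integrable (lborel \<Otimes>\<^sub>M lborel) (indicator ({0..t} \<times> {0..\<epsilon>}) :: real \<times> real \<Rightarrow> real)"
    by (rule integrable_real_indicator)
       (auto simp: lborel.emeasure_pair_measure_Times emeasure_lborel_Icc_eq ennreal_mult_less_top)
  then have "integrable (lborel \<Otimes>\<^sub>M lborel) f"
    by (rule Bochner_Integration.integrable_bound[OF _ f_meas])
       (intro AE_I2, auto simp: f_def indicator_def)
  then have swap: "(\<integral>u. (\<integral>r. f (r, u) \<partial>lborel) \<partial>lborel) = (\<integral>r. (\<integral>u. f (r, u) \<partial>lborel) \<partial>lborel)"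
    by (rule lborel_pair.Fubini_integral[of "\<lambda>r u. f (r, u)", simplified])
  have "(\<integral>u. f (r, u) \<partial>lborel) = \<epsilon>\<^sup>2 * (indicator {0..t} r *\<^sub>R tent \<epsilon> (x r))" for r
  proof -
    have "f (r, u) = indicator {0..t} r * indicator {\<bar>x r\<bar>..\<epsilon>} u" for u
      by (auto simp: f_def split: split_indicator)
    then have "(\<integral>u. f (r, u) \<partial>lborel) = indicator {0..t} r * (\<integral>u. indicator {\<bar>x r\<bar>..\<epsilon>} u \<partial>lborel)"
      by (simp del: of_bool_eq_iff)
    also have "(\<integral>u. indicator {\<bar>x r\<bar>..\<epsilon>} u \<partial>lborel) = \<epsilon>\<^sup>2 * tent \<epsilon> (x r)"
      using assms(1) by (simp add: tent_eq max_def)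
    finally show ?thesis by simp
  qed
  moreover have "(\<integral>r. f (r, u) \<partial>lborel) = indicator {0..\<epsilon>} u *\<^sub>R measure lborel {r \<in> {0..t}. \<bar>x r\<bar> \<le> u}" for u
  proof -
    have "f (r, u) = indicator {0..\<epsilon>} u * indicator {r \<in> {0..t}. \<bar>x r\<bar> \<le> u} r" for r
      by (auto simp: f_def split: split_indicator)
    then show ?thesis by (simp del: of_bool_eq_iff)
  qed
  ultimately show ?thesis
    using swap assms by (simp add: set_lebesgue_integral_def)
qed

lemma tent_integral_tendsto:
  assumes "0 \<le> t"
  shows "((\<lambda>\<epsilon>. LBINT r:{0..t}. tent \<epsilon> (x r)) \<longlongrightarrow> l t) (at_right 0)"
proof (rule tendstoI)
  fix e :: real assume e: "0 < e"
  have "\<forall>\<^sub>F \<epsilon> in at_right 0. dist (occupation_ratio x t 0 \<epsilon>) (l t) < e / 2"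
    using l_limit[OF assms] e by (intro tendstoD) auto
  then obtain \<delta> where \<delta>: "0 < \<delta>" "\<And>\<epsilon>. 0 < \<epsilon> \<Longrightarrow> \<epsilon> < \<delta> \<Longrightarrow> \<bar>occupation_ratio x t 0 \<epsilon> - l t\<bar> < e / 2"
    by (auto simp: eventually_at_right_field dist_real_def)
  have "dist (LBINT r:{0..t}. tent \<epsilon> (x r)) (l t) < e" if \<epsilon>: "0 < \<epsilon>" "\<epsilon> < \<delta>" for \<epsilon>
  proof -
    define F where "F u = measure lborel {r \<in> {0..t}. \<bar>x r\<bar> \<le> u}" for u
    have F_mono: "mono F"
      unfolding F_def mono_def using level_set_fmeasurable[of 0 t]
      by (auto intro!: measure_mono_fmeasurable)
    then have [measurable]: "F \<in> borel_measurable borel" by (rule borel_measurable_mono)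
    have F_near: "\<bar>F u - 2 * u * l t\<bar> \<le> e * u" if "u \<in> {0<..\<epsilon>}" for u
    proof -
      have "F u - 2 * u * l t = 2 * u * (occupation_ratio x t 0 u - l t)"
        using that by (simp add: F_def occupation_ratio_def field_simps)
      also have "\<bar>\<dots>\<bar> = 2 * u * \<bar>occupation_ratio x t 0 u - l t\<bar>" using that by (simp add: abs_mult)
      also have "\<dots> \<le> 2 * u * (e / 2)"
        using \<delta>(2)[of u] that \<epsilon> by (intro mult_left_mono less_imp_le) auto
      finally show ?thesis by (simp add: mult.commute)
    qed
    have lin: "has_bochner_integral lborel (\<lambda>u. indicator {0..\<epsilon>} u *\<^sub>R (c * u)) (c * \<epsilon>\<^sup>2 / 2)" for c
    proof -
      have "((\<lambda>u. c * u\<^sup>2 / 2) has_real_derivative c * u) (at u)" for u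
        by (auto intro!: derivative_eq_intros)
      then show ?thesis
        using has_bochner_integral_FTC_Icc_real[of 0 \<epsilon> "\<lambda>u. c * u\<^sup>2 / 2" "\<lambda>u. c * u"] \<epsilon>
        by (auto intro!: continuous_intros simp: mult.commute)
    qed
    have F_int: "integrable lborel (\<lambda>u. indicator {0..\<epsilon>} u *\<^sub>R F u)"
      using set_integrable_bounded_borel[of F 0 \<epsilon> "F \<epsilon>"] monoD[OF F_mono] by (auto simp: set_integrable_def F_def)
    have "(LBINT r:{0..t}. tent \<epsilon> (x r)) - l t = ((LBINT u:{0..\<epsilon>}. F u) - l t * \<epsilon>\<^sup>2) / \<epsilon>\<^sup>2"
      using tent_integral_eq[OF \<epsilon>(1) assms] \<epsilon> by (simp add: F_def field_simps)
    also have "(LBINT u:{0..\<epsilon>}. F u) - l t * \<epsilon>\<^sup>2 = (\<integral>u. indicator {0..\<epsilon>} u *\<^sub>R F u - indicator {0..\<epsilon>} u *\<^sub>R (2 * l t * u) \<partial>lborel)"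
      using has_bochner_integral_integral_eq[OF lin[of "2 * l t"]] F_int integrable.intros[OF lin[of "2 * l t"]]
      by (subst Bochner_Integration.integral_diff) (auto simp: set_lebesgue_integral_def)
    also have "\<bar>\<dots> / \<epsilon>\<^sup>2\<bar> \<le> (e * \<epsilon>\<^sup>2 / 2) / \<epsilon>\<^sup>2"
    proof -
      have "\<bar>\<integral>u. indicator {0..\<epsilon>} u *\<^sub>R F u - indicator {0..\<epsilon>} u *\<^sub>R (2 * l t * u) \<partial>lborel\<bar>
          \<le> (\<integral>u. indicator {0..\<epsilon>} u *\<^sub>R (e * u) \<partial>lborel)"
      proof (rule integral_abs_bound_integral)
        show "\<bar>indicator {0..\<epsilon>} u *\<^sub>R F u - indicator {0..\<epsilon>} u *\<^sub>R (2 * l t * u)\<bar> \<le> indicator {0..\<epsilon>} u *\<^sub>R (e * u)" for u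
          using F_near[of u] zero_set_measure[OF assms] by (cases "u = 0") (auto simp: F_def indicator_def mult_ac)
      qed (use integrable.intros[OF lin] F_int in auto)
      then show ?thesis unfolding has_bochner_integral_integral_eq[OF lin[of e]]
        by (simp only: abs_divide abs_power2 divide_right_mono zero_le_power2)
    qed
    also have "\<dots> < e" using e \<epsilon> by simp
    finally show ?thesis by (simp add: dist_real_def)
  qed
  then show "\<forall>\<^sub>F \<epsilon> in at_right 0. dist (LBINT r:{0..t}. tent \<epsilon> (x r)) (l t) < e"
    using \<delta>(1) by (auto simp: eventually_at_right_field)
qed

end

section \<open>Brownian increments and the past\<close>

lemma sets_Collect_mem:
  assumes "f \<in> measurable N L" "A \<in> sets L" shows "{x \<in> space N. f x \<in> A} \<in> sets N"
  using measurable_sets[OF assms] by (simp add: vimage_def Int_def conj_commute)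

lemma abs_integral_le:
  fixes f g :: "'a \<Rightarrow> real"
  assumes "integrable N f" "integrable N g" "\<And>x. x \<in> space N \<Longrightarrow> \<bar>f x\<bar> \<le> g x"
  shows "\<bar>integral\<^sup>L N f\<bar> \<le> integral\<^sup>L N g"
proof -
  have "\<bar>integral\<^sup>L N f\<bar> \<le> (\<integral>x. \<bar>f x\<bar> \<partial>N)" using integral_norm_bound[of N f] by simp
  also have "\<dots> \<le> integral\<^sup>L N g" using assms by (intro integral_mono) auto
  finally show ?thesis .
qed

fun running_max :: "(nat \<Rightarrow> real) \<Rightarrow> nat \<Rightarrow> real" where
  "running_max S 0 = \<bar>S 0\<bar>"
| "running_max S (Suc n) = max (running_max S n) \<bar>S (Suc n)\<bar>"

lemma running_max_ge: "k \<le> n \<Longrightarrow> \<bar>S k\<bar> \<le> running_max S n"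
  by (induction n) (auto simp: le_Suc_eq)

lemma running_max_nonneg: "0 \<le> running_max S n"
  using running_max_ge[of 0 n S] by simp

lemma running_max_le_sum: "running_max S n \<le> (\<Sum>k\<le>n. \<bar>S k\<bar>)"
  by (induction n) (auto intro: add_increasing2 add_increasing sum_nonneg)

text \<open>An \<open>L\<^sup>2\<close> maximal inequality that holds for every sequence: the sum on the right is a discrete stochastic
  integral, of mean zero when \<open>S\<close> is a martingale. Summation by parts works because the running maximum \<open>r\<close> increases only
  at times when it equals \<open>|S|\<close>.\<close>

lemma pathwise_doob:
  "(running_max S n)\<^sup>2 \<le> 4 * (S n)\<^sup>2 - 4 * (\<Sum>k<n. running_max S k * sgn (S k) * (S (Suc k) - S k))"
proof -
  let ?r = "running_max S"
  have main: "(?r n)\<^sup>2 \<le> 2 * (?r n * \<bar>S n\<bar>) - 2 * (\<Sum>k<n. ?r k * (\<bar>S (Suc k)\<bar> - \<bar>S k\<bar>))"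
  proof (induction n)
    case (Suc n)
    show ?case
    proof (cases "\<bar>S (Suc n)\<bar> \<le> ?r n")
      case True
      then show ?thesis using Suc by (simp add: max_absorb1 algebra_simps)
    next
      case False
      have "0 \<le> (\<bar>S (Suc n)\<bar> - ?r n)\<^sup>2" by simp
      then show ?thesis using Suc False by (simp add: max_absorb2 algebra_simps power2_eq_square)
    qed
  qed (simp add: power2_eq_square)
  have "(\<Sum>k<n. ?r k * sgn (S k) * (S (Suc k) - S k)) \<le> (\<Sum>k<n. ?r k * (\<bar>S (Suc k)\<bar> - \<bar>S k\<bar>))"
  proof (rule sum_mono)
    fix k
    have "sgn (S k) * (S (Suc k) - S k) \<le> \<bar>S (Suc k)\<bar> - \<bar>S k\<bar>" by (auto simp: sgn_if)
    then show "?r k * sgn (S k) * (S (Suc k) - S k) \<le> ?r k * (\<bar>S (Suc k)\<bar> - \<bar>S k\<bar>)"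
      unfolding mult.assoc by (intro mult_left_mono running_max_nonneg)
  qed
  moreover have "2 * (?r n * \<bar>S n\<bar>) \<le> (?r n)\<^sup>2 / 2 + 2 * (S n)\<^sup>2"
  proof -
    have "0 \<le> (?r n - 2 * \<bar>S n\<bar>)\<^sup>2" by simp
    then show ?thesis by (simp add: power2_eq_square algebra_simps)
  qed
  ultimately show ?thesis using main by linarith
qed

context standard_brownian_motion begin

abbreviation "\<F> \<equiv> augmented_filtration M B"

lemma filtration_sets:
  assumes "0 \<le> s"
  shows "sets (\<F> s) = sigma_sets (space M) (process_events M B {0..s} \<union> null_sets M)"
    and "space (\<F> s) = space M" and "sets (\<F> s) \<subseteq> sets M"
proof -
  have "process_events M B {0..s} \<union> null_sets M \<subseteq> sets M"
  proof -
    have "process_events M B {0..s} \<subseteq> sets M"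
      unfolding process_events_def
    proof (rule sets.sigma_sets_subset, clarify)
      fix t :: real and A :: "real set" assume "t \<in> {0..s}" "A \<in> sets borel"
      then show "B t -` A \<inter> space M \<in> sets M" by (intro measurable_sets[OF B_measurable]) auto
    qed
    then show ?thesis by auto
  qed
  then have *: "process_events M B {0..s} \<union> null_sets M \<subseteq> sets M" "process_events M B {0..s} \<union> null_sets M \<subseteq> Pow (space M)"
    using sets.sets_into_space by auto
  then show "sets (\<F> s) = sigma_sets (space M) (process_events M B {0..s} \<union> null_sets M)"
    "space (\<F> s) = space M" "sets (\<F> s) \<subseteq> sets M"
    by (auto simp: augmented_filtration_def sets.sigma_sets_subset)
qed

lemma filtration_mono:
  assumes "0 \<le> s" "s \<le> t" shows "sets (\<F> s) \<subseteq> sets (\<F> t)"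
proof -
  have "process_events M B {0..s} \<subseteq> process_events M B {0..t}"
    unfolding process_events_def
  proof (rule sigma_sets_mono')
    show "{B r -` A \<inter> space M |r A. r \<in> {0..s} \<and> A \<in> sets borel} \<subseteq> {B r -` A \<inter> space M |r A. r \<in> {0..t} \<and> A \<in> sets borel}"
      using assms(2) by (force intro: order_trans)
  qed
  then show ?thesis using assms by (subst (1 2) filtration_sets(1)) (auto intro!: sigma_sets_mono')
qed

lemma measurable_filtration_mono:
  assumes "W \<in> borel_measurable (\<F> s)" "0 \<le> s" "s \<le> t" shows "W \<in> borel_measurable (\<F> t)"
  using assms filtration_mono[OF assms(2,3)] by (auto simp: measurable_def filtration_sets)

lemma measurable_filtration_M:
  assumes "W \<in> borel_measurable (\<F> s)" "0 \<le> s" shows "W \<in> borel_measurable M"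
  using assms filtration_sets[OF assms(2)] by (auto simp: measurable_def)

lemma B_adapted:
  assumes "0 \<le> s" shows "B s \<in> borel_measurable (\<F> s)"
proof (rule measurableI)
  fix A :: "real set" assume "A \<in> sets borel"
  then have "B s -` A \<inter> space M \<in> process_events M B {0..s}"
    unfolding process_events_def using assms by (intro sigma_sets.Basic) auto
  then show "B s -` A \<inter> space (\<F> s) \<in> sets (\<F> s)"
    using assms by (auto simp: filtration_sets intro: sigma_sets.Basic)
qed simp

text \<open>Finitely many values of \<open>B\<close> up to time \<open>s\<close> are, almost surely, sums of increments over an ordered partition, and these are
  independent of the next increment.\<close>

lemma cylinder_indep:
  assumes J: "finite J" "J \<subseteq> {0..s}" and A: "\<And>t. A t \<in> sets borel" and C: "C \<in> sets borel"
    and su: "0 \<le> s" "s < u"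
  shows "prob ({\<omega> \<in> space M. \<forall>t\<in>J. B t \<omega> \<in> A t} \<inter> {\<omega> \<in> space M. B u \<omega> - B s \<omega> \<in> C})
    = prob {\<omega> \<in> space M. \<forall>t\<in>J. B t \<omega> \<in> A t} * prob {\<omega> \<in> space M. B u \<omega> - B s \<omega> \<in> C}"
proof -
  \<comment> \<open>The points \<open>0\<close> and \<open>s\<close> are added so that the partition starts where \<open>B\<close> vanishes and ends where the next increment begins.\<close>
  define xs where "xs = sorted_list_of_set (J \<union> {0, s})"
  define n where "n = length xs - 1"
  have set_xs: "set xs = J \<union> {0, s}" and sorted: "sorted_wrt (<) xs"
    using J(1) set_sorted_list_of_set[of "J \<union> {0, s}"] strict_sorted_list_of_set[of "J \<union> {0, s}"]
    unfolding xs_def by blast+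
  have "xs \<noteq> []" using set_xs by auto
  then have len: "length xs = Suc n" by (simp add: n_def)
  have lt: "xs ! i < xs ! j" if "i < j" "j \<le> n" for i j
    using sorted_wrt_nth_less[OF sorted that(1)] that len by simp
  have idx: "\<exists>k\<le>n. xs ! k = t" if "t \<in> J \<union> {0, s}" for t
    using that unfolding set_xs[symmetric] in_set_conv_nth len by (auto simp: less_Suc_eq_le)
  have mem: "xs ! k \<in> {0..s}" if "k \<le> n" for k
    using nth_mem[of k xs] that len set_xs J su by auto
  have xs_0: "xs ! 0 = 0"
  proof -
    obtain k where "k \<le> n" "xs ! k = 0" using idx[of 0] by auto
    then show ?thesis using lt[of 0 k] mem[of 0] by (cases "k = 0") auto
  qed
  have xs_n: "xs ! n = s"
  proof -
    obtain k where "k \<le> n" "xs ! k = s" using idx[of s] by auto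
    then show ?thesis using lt[of k n] mem[of n] by (cases "k = n") auto
  qed
  define T where "T i = (if i \<le> n then xs ! i else u)" for i
  have "strict_mono_on {..Suc n} T"
  proof (rule strict_mono_onI)
    fix i j assume "i \<in> {..Suc n}" "j \<in> {..Suc n}" "i < j"
    then show "T i < T j" using lt[of i j] mem[of i] su by (auto simp: T_def)
  qed
  moreover have "0 \<le> T 0" using xs_0 by (simp add: T_def)
  ultimately have iv: "indep_vars (\<lambda>_. borel) (\<lambda>i \<omega>. B (T (Suc i)) \<omega> - B (T i) \<omega>) {..<Suc n}"
    by (rule B_indep_increments[rotated])
  let ?D = "\<lambda>i \<omega>. B (T (Suc i)) \<omega> - B (T i) \<omega>"
  have ind: "indep_var (PiM {..<n} (\<lambda>_. borel)) (\<lambda>\<omega>. restrict (\<lambda>i. ?D i \<omega>) {..<n})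
      (PiM {n} (\<lambda>_. borel)) (\<lambda>\<omega>. restrict (\<lambda>i. ?D i \<omega>) {n})"
    by (rule indep_var_restrict[OF iv]) auto
  define k where "k t = (SOME k. k \<le> n \<and> xs ! k = t)" for t
  have k: "k t \<le> n" "xs ! k t = t" if "t \<in> J" for t
    using someI_ex[of "\<lambda>k. k \<le> n \<and> xs ! k = t"] idx[of t] that by (auto simp: k_def)
  define E1 where "E1 = {v \<in> space (PiM {..<n} (\<lambda>_. borel :: real measure)). \<forall>t\<in>J. (\<Sum>i<k t. v i) \<in> A t}"
  define E2 where "E2 = {v \<in> space (PiM {n} (\<lambda>_. borel :: real measure)). v n \<in> C}"
  have E1: "E1 \<in> sets (PiM {..<n} (\<lambda>_. borel))"
  proof -
    have [measurable]: "A t \<in> sets borel" for t by (rule A)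
    have "(\<lambda>v. \<Sum>i<k t. v i) \<in> borel_measurable (PiM {..<n} (\<lambda>_. borel :: real measure))" if "t \<in> J" for t
      using k(1)[OF that] by (intro borel_measurable_sum measurable_component_singleton) auto
    then show ?thesis unfolding E1_def
      by (intro sets.sets_Collect_finite_All[OF _ J(1)] sets_Collect_mem[OF _ A])
  qed
  have E2: "E2 \<in> sets (PiM {n} (\<lambda>_. borel))"
    unfolding E2_def by (intro sets_Collect_mem[OF _ C] measurable_component_singleton) simp
  have "prob ((\<lambda>\<omega>. (restrict (\<lambda>i. ?D i \<omega>) {..<n}, restrict (\<lambda>i. ?D i \<omega>) {n})) -` (E1 \<times> E2) \<inter> space M)
    = prob ((\<lambda>\<omega>. restrict (\<lambda>i. ?D i \<omega>) {..<n}) -` E1 \<inter> space M) * prob ((\<lambda>\<omega>. restrict (\<lambda>i. ?D i \<omega>) {n}) -` E2 \<inter> space M)"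
    by (rule indep_varD[OF ind E1 E2])
  moreover have "(\<lambda>\<omega>. restrict (\<lambda>i. ?D i \<omega>) {n}) -` E2 \<inter> space M = {\<omega> \<in> space M. B u \<omega> - B s \<omega> \<in> C}"
    by (auto simp: E2_def space_PiM T_def xs_n)
  moreover have "prob ((\<lambda>\<omega>. restrict (\<lambda>i. ?D i \<omega>) {..<n}) -` E1 \<inter> space M) = prob {\<omega> \<in> space M. \<forall>t\<in>J. B t \<omega> \<in> A t}"
    and "prob ((\<lambda>\<omega>. (restrict (\<lambda>i. ?D i \<omega>) {..<n}, restrict (\<lambda>i. ?D i \<omega>) {n})) -` (E1 \<times> E2) \<inter> space M)
      = prob ({\<omega> \<in> space M. \<forall>t\<in>J. B t \<omega> \<in> A t} \<inter> {\<omega> \<in> space M. B u \<omega> - B s \<omega> \<in> C})"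
  proof -
    have tele: "(\<Sum>i<k t. restrict (\<lambda>i. ?D i \<omega>) {..<n} i) = B t \<omega> - B 0 \<omega>" if "t \<in> J" for t \<omega>
    proof -
      have "(\<Sum>i<k t. restrict (\<lambda>i. ?D i \<omega>) {..<n} i) = (\<Sum>i<k t. B (T (Suc i)) \<omega> - B (T i) \<omega>)"
        using k(1)[OF that] by (intro sum.cong) auto
      also have "\<dots> = B (T (k t)) \<omega> - B (T 0) \<omega>" by (rule sum_lessThan_telescope)
      finally show ?thesis using k[OF that] xs_0 by (simp add: T_def)
    qed
    have [measurable]: "B t \<in> borel_measurable M" if "t \<in> J \<union> {s, u}" for t
      using that J su by (intro B_measurable) auto
    have S[measurable]: "{\<omega> \<in> space M. \<forall>t\<in>J. B t \<omega> \<in> A t} \<in> sets M"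
      using J su by (intro sets.sets_Collect_finite_All sets_Collect_mem[OF _ A] B_measurable) auto
    have S2[measurable]: "{\<omega> \<in> space M. B u \<omega> - B s \<omega> \<in> C} \<in> sets M"
      using su by (intro sets_Collect_mem[OF _ C] borel_measurable_diff B_measurable) auto
    have R1: "(\<lambda>\<omega>. restrict (\<lambda>i. ?D i \<omega>) {..<n}) -` E1 \<inter> space M \<in> sets M"
      by (rule measurable_sets[OF indep_var_rv1[OF ind] E1])
    have R2: "(\<lambda>\<omega>. restrict (\<lambda>i. ?D i \<omega>) {n}) -` E2 \<inter> space M \<in> sets M"
      by (rule measurable_sets[OF indep_var_rv2[OF ind] E2])
    have pre: "AE \<omega> in M. (restrict (\<lambda>i. ?D i \<omega>) {..<n} \<in> E1) = (\<forall>t\<in>J. B t \<omega> \<in> A t)"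
      using B_start by eventually_elim (auto simp: E1_def tele space_PiM simp del: restrict_apply)
    show "prob ((\<lambda>\<omega>. restrict (\<lambda>i. ?D i \<omega>) {..<n}) -` E1 \<inter> space M) = prob {\<omega> \<in> space M. \<forall>t\<in>J. B t \<omega> \<in> A t}"
      by (rule finite_measure_eq_AE[OF _ R1 S]) (use pre in auto)
    have eq: "(\<lambda>\<omega>. (restrict (\<lambda>i. ?D i \<omega>) {..<n}, restrict (\<lambda>i. ?D i \<omega>) {n})) -` (E1 \<times> E2) \<inter> space M
       = ((\<lambda>\<omega>. restrict (\<lambda>i. ?D i \<omega>) {..<n}) -` E1 \<inter> space M) \<inter> {\<omega> \<in> space M. B u \<omega> - B s \<omega> \<in> C}"
      by (auto simp: E2_def space_PiM T_def xs_n)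
    show "prob ((\<lambda>\<omega>. (restrict (\<lambda>i. ?D i \<omega>) {..<n}, restrict (\<lambda>i. ?D i \<omega>) {n})) -` (E1 \<times> E2) \<inter> space M)
      = prob ({\<omega> \<in> space M. \<forall>t\<in>J. B t \<omega> \<in> A t} \<inter> {\<omega> \<in> space M. B u \<omega> - B s \<omega> \<in> C})"
      unfolding eq by (rule finite_measure_eq_AE) (use pre R1 in auto)
  qed
  ultimately show ?thesis by simp
qed

text \<open>The sets that agree almost surely with a cylinder event form an intersection-stable system that
  contains both the generators of the past and the null sets, so the augmentation is covered by the same argument.\<close>

lemma increment_indep:
  assumes s: "0 \<le> s" "s < u" and W: "W \<in> borel_measurable (\<F> s)"
  shows "indep_var borel W borel (\<lambda>\<omega>. B u \<omega> - B s \<omega>)"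
proof -
  define cyl where "cyl J A D \<longleftrightarrow> finite J \<and> J \<subseteq> {0..s} \<and> (\<forall>t. A t \<in> sets borel) \<and>
    (AE \<omega> in M. \<omega> \<in> D \<longleftrightarrow> (\<forall>t\<in>J. B t \<omega> \<in> A t))" for J and A :: "real \<Rightarrow> real set" and D
  define P where "P = {D \<in> sets M. \<exists>J A. cyl J A D}"
  define Q where "Q = {(\<lambda>\<omega>. B u \<omega> - B s \<omega>) -` C \<inter> space M | C. C \<in> sets borel}"
  have incr: "(\<lambda>\<omega>. B u \<omega> - B s \<omega>) \<in> borel_measurable M"
    using s by (intro borel_measurable_diff B_measurable) auto
  have "indep_set P Q"
  proof (rule indep_setI)
    show "P \<subseteq> events" by (auto simp: P_def)
    show "Q \<subseteq> events" using incr by (auto simp: Q_def intro: measurable_sets)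
    fix D E assume "D \<in> P" "E \<in> Q"
    then obtain J A C where D: "D \<in> sets M" "cyl J A D"
      and C: "C \<in> sets borel" "E = (\<lambda>\<omega>. B u \<omega> - B s \<omega>) -` C \<inter> space M"
      unfolding P_def Q_def by blast
    have J: "finite J" "J \<subseteq> {0..s}" "\<And>t. A t \<in> sets borel" using D(2) by (auto simp: cyl_def)
    have E_eq: "E = {\<omega> \<in> space M. B u \<omega> - B s \<omega> \<in> C}" using C by auto
    have E: "E \<in> sets M" unfolding E_eq by (intro sets_Collect_mem[OF incr C(1)])
    define D' where "D' = {\<omega> \<in> space M. \<forall>t\<in>J. B t \<omega> \<in> A t}"
    have D': "D' \<in> sets M"
      unfolding D'_def using J s by (intro sets.sets_Collect_finite_All sets_Collect_mem[OF _ J(3)] B_measurable) auto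
    have ae: "AE \<omega> in M. \<omega> \<in> D \<longleftrightarrow> \<omega> \<in> D'"
      using D(2) by (auto simp: cyl_def D'_def elim!: AE_mp)
    have "prob (D \<inter> E) = prob (D' \<inter> E)" "prob D = prob D'"
      using ae D(1) D' E by (auto intro!: finite_measure_eq_AE elim!: AE_mp)
    then show "prob (D \<inter> E) = prob D * prob E"
      using cylinder_indep[OF J C(1) s] unfolding D'_def E_eq by simp
  qed
  moreover have "Int_stable P"
  proof (rule Int_stableI)
    fix D1 D2 assume "D1 \<in> P" "D2 \<in> P"
    then obtain J1 A1 J2 A2 where D: "D1 \<in> sets M" "D2 \<in> sets M" "cyl J1 A1 D1" "cyl J2 A2 D2"
      unfolding P_def by blast
    have "cyl (J1 \<union> J2) (\<lambda>t. (if t \<in> J1 then A1 t else UNIV) \<inter> (if t \<in> J2 then A2 t else UNIV)) (D1 \<inter> D2)"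
      using D(3,4) unfolding cyl_def by (auto elim!: AE_mp)
    then show "D1 \<inter> D2 \<in> P" using D(1,2) unfolding P_def by auto
  qed
  moreover have "Int_stable Q"
  proof (rule Int_stableI)
    fix a b assume "a \<in> Q" "b \<in> Q"
    then obtain C1 C2 where "C1 \<in> sets borel" "C2 \<in> sets borel" "a = (\<lambda>\<omega>. B u \<omega> - B s \<omega>) -` C1 \<inter> space M"
       "b = (\<lambda>\<omega>. B u \<omega> - B s \<omega>) -` C2 \<inter> space M" unfolding Q_def by blast
    then show "a \<inter> b \<in> Q" unfolding Q_def by (intro CollectI exI[of _ "C1 \<inter> C2"]) auto
  qed
  ultimately have PQ: "indep_set (sigma_sets (space M) P) (sigma_sets (space M) Q)"
    by (rule indep_set_sigma_sets)
  have "sets (\<F> s) \<subseteq> sigma_sets (space M) P"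
  proof -
    have "process_events M B {0..s} \<subseteq> sigma_sets (space M) P"
      unfolding process_events_def
    proof (rule sigma_sets_mono, clarify)
      fix t :: real and A :: "real set" assume t: "t \<in> {0..s}" "A \<in> sets borel"
      then have "cyl {t} (\<lambda>_. A) (B t -` A \<inter> space M)" by (auto simp: cyl_def)
      moreover have "B t -` A \<inter> space M \<in> sets M"
        using t by (intro measurable_sets[OF B_measurable]) auto
      ultimately show "B t -` A \<inter> space M \<in> sigma_sets (space M) P"
        unfolding P_def by (blast intro: sigma_sets.Basic)
    qed
    moreover have "null_sets M \<subseteq> sigma_sets (space M) P"
    proof
      fix N assume "N \<in> null_sets M"
      then have "cyl {0} (\<lambda>_. {}) N" using s AE_not_in[of N M] by (auto simp: cyl_def)
      then show "N \<in> sigma_sets (space M) P"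
        using \<open>N \<in> null_sets M\<close> unfolding P_def by (blast intro: sigma_sets.Basic)
    qed
    ultimately show ?thesis unfolding filtration_sets(1)[OF s(1)] by (intro sigma_sets_mono) auto
  qed
  moreover have "sigma_sets (space M) {W -` A \<inter> space M |A. A \<in> sets borel} \<subseteq> sets (\<F> s)"
  proof -
    have "{W -` A \<inter> space M |A. A \<in> sets borel} \<subseteq> sets (\<F> s)"
      using measurable_sets[OF W] filtration_sets(2)[OF s(1)] by auto
    then show ?thesis using sets.sigma_sets_subset[of _ "\<F> s"] filtration_sets(2)[OF s(1)] by simp
  qed
  ultimately have "indep_set (sigma_sets (space M) {W -` A \<inter> space M |A. A \<in> sets borel}) (sigma_sets (space M) Q)"
    using PQ unfolding indep_sets2_eq by blast
  then show ?thesis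
    using incr measurable_filtration_M[OF W s(1)] by (simp add: indep_var_eq Q_def)
qed

lemma increment_moments:
  assumes "0 \<le> s" "s < u"
  defines "D \<equiv> \<lambda>\<omega>. B u \<omega> - B s \<omega>"
  shows "integrable M D" "expectation D = 0"
    and "integrable M (\<lambda>\<omega>. (D \<omega>)\<^sup>2)" "expectation (\<lambda>\<omega>. (D \<omega>)\<^sup>2) = u - s"
    and "integrable M (\<lambda>\<omega>. \<bar>D \<omega>\<bar> ^ 3)" "expectation (\<lambda>\<omega>. \<bar>D \<omega>\<bar> ^ 3) \<le> 2 * (u - s) * sqrt (u - s)"
proof -
  define \<sigma> where "\<sigma> = sqrt (u - s)"
  have \<sigma>: "0 < \<sigma>" "\<sigma>\<^sup>2 = u - s" using assms by (auto simp: \<sigma>_def)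
  have dist: "distributed M lborel D (normal_density 0 \<sigma>)"
    unfolding D_def \<sigma>_def by (rule B_increments[OF assms(1,2)])
  note int = distributed_integrable[OF dist _ normal_density_nonneg]
    and expct = distributed_integral[OF dist _ normal_density_nonneg]
  note m1 = normal_moment_odd[OF \<sigma>(1), of 0 0] and m2 = normal_moment_even[OF \<sigma>(1), of 0 1]
    and m3 = normal_moment_abs_odd[OF \<sigma>(1), of 0 1]
  show "integrable M D" "expectation D = 0"
    using int[of "\<lambda>x. x"] expct[of "\<lambda>x. x"] integrable.intros[OF m1] has_bochner_integral_integral_eq[OF m1] by auto
  show "integrable M (\<lambda>\<omega>. (D \<omega>)\<^sup>2)" "expectation (\<lambda>\<omega>. (D \<omega>)\<^sup>2) = u - s"
    using int[of "\<lambda>x. x\<^sup>2"] expct[of "\<lambda>x. x\<^sup>2"] integrable.intros[OF m2] has_bochner_integral_integral_eq[OF m2] \<sigma> by auto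
  show "integrable M (\<lambda>\<omega>. \<bar>D \<omega>\<bar> ^ 3)"
    using int[of "\<lambda>x. \<bar>x\<bar> ^ 3"] integrable.intros[OF m3] by auto
  have "expectation (\<lambda>\<omega>. \<bar>D \<omega>\<bar> ^ 3) = 2 * \<sigma> ^ 3 * sqrt (2 / pi)"
    using expct[of "\<lambda>x. \<bar>x\<bar> ^ 3"] has_bochner_integral_integral_eq[OF m3] by auto
  also have "\<dots> \<le> 2 * \<sigma> ^ 3 * 1"
    using pi_gt3 \<sigma> by (intro mult_left_mono) auto
  also have "\<dots> = 2 * \<sigma>\<^sup>2 * \<sigma>" by (simp add: power2_eq_square power3_eq_cube)
  also have "\<dots> = 2 * (u - s) * sqrt (u - s)" unfolding \<sigma>(2) by (simp add: \<sigma>_def)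
  finally show "expectation (\<lambda>\<omega>. \<bar>D \<omega>\<bar> ^ 3) \<le> 2 * (u - s) * sqrt (u - s)" .
qed

lemma increment_times:
  assumes s: "0 \<le> s" "s < u" and W: "W \<in> borel_measurable (\<F> s)" "integrable M W"
  defines "D \<equiv> \<lambda>\<omega>. B u \<omega> - B s \<omega>"
  shows "integrable M (\<lambda>\<omega>. W \<omega> * D \<omega>)" "expectation (\<lambda>\<omega>. W \<omega> * D \<omega>) = 0"
    and "integrable M (\<lambda>\<omega>. W \<omega> * (D \<omega>)\<^sup>2)" "expectation (\<lambda>\<omega>. W \<omega> * (D \<omega>)\<^sup>2) = (u - s) * expectation W"
proof -
  have D_app: "B u \<omega> - B s \<omega> = D \<omega>" for \<omega> by (simp add: D_def)
  note mom = increment_moments[OF s, unfolded D_app]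
  have i: "indep_var borel W borel D" unfolding D_def by (rule increment_indep[OF s W(1)])
  have i2: "indep_var borel W borel (\<lambda>\<omega>. (D \<omega>)\<^sup>2)"
    using indep_var_compose[OF i, of "\<lambda>x. x" borel "\<lambda>x. x\<^sup>2" borel] by (simp add: comp_def)
  show "integrable M (\<lambda>\<omega>. W \<omega> * D \<omega>)" "integrable M (\<lambda>\<omega>. W \<omega> * (D \<omega>)\<^sup>2)"
    using indep_var_integrable[OF i W(2) mom(1)] indep_var_integrable[OF i2 W(2) mom(3)] by auto
  show "expectation (\<lambda>\<omega>. W \<omega> * D \<omega>) = 0" "expectation (\<lambda>\<omega>. W \<omega> * (D \<omega>)\<^sup>2) = (u - s) * expectation W"
    using indep_var_lebesgue_integral[OF i W(2) mom(1)] indep_var_lebesgue_integral[OF i2 W(2) mom(3)] mom by auto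
qed

text \<open>The linear term has mean zero, the quadratic term has mean \<open>u - s\<close>, and the third absolute moment is of order \<open>(u - s)\<close> to the power
  \<open>3/2\<close>, which is summable to zero over a grid.\<close>

lemma taylor_increment:
  assumes s: "0 \<le> s" "s < u" and tf: "test_function C \<phi> \<phi>' \<phi>''"
    and Z: "Z \<in> borel_measurable (\<F> s)" "\<And>\<omega>. \<bar>Z \<omega>\<bar> \<le> c" and Y: "Y \<in> borel_measurable (\<F> s)"
  defines "D \<equiv> \<lambda>\<omega>. B u \<omega> - B s \<omega>"
  shows "\<bar>expectation (\<lambda>\<omega>. Z \<omega> * (\<phi> (Y \<omega> + D \<omega>) - \<phi> (Y \<omega>)))
      - (u - s) * expectation (\<lambda>\<omega>. Z \<omega> * (\<phi>'' (Y \<omega>) / 2))\<bar> \<le> c * C * (2 * (u - s) * sqrt (u - s))"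
proof -
  note [measurable] = test_functionD(9-11)[OF tf, THEN borel_measurable_continuous_onI]
  have D_app: "B u \<omega> - B s \<omega> = D \<omega>" for \<omega> by (simp add: D_def)
  note mom = increment_moments[OF s, unfolded D_app]
  have C0: "0 \<le> C" "0 \<le> c" using test_functionD(8)[OF tf] Z(2)[THEN order_trans[OF abs_ge_zero]] by auto
  have ZY: "(\<lambda>\<omega>. Z \<omega> * \<phi>' (Y \<omega>)) \<in> borel_measurable (\<F> s)" "(\<lambda>\<omega>. Z \<omega> * (\<phi>'' (Y \<omega>) / 2)) \<in> borel_measurable (\<F> s)"
    using Z Y by measurable
  have [measurable]: "Z \<in> borel_measurable M" "Y \<in> borel_measurable M" "D \<in> borel_measurable M"
    using measurable_filtration_M[OF _ s(1)] Z Y mom(1) by auto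
  have bd: "\<bar>Z \<omega> * v\<bar> \<le> c * k" if "\<bar>v\<bar> \<le> k" for \<omega> v k
    unfolding abs_mult using that Z(2) C0 by (intro mult_mono) auto
  have int1: "integrable M (\<lambda>\<omega>. Z \<omega> * \<phi>' (Y \<omega>))"
    by (rule integrable_const_bound[where B = "c * C"]) (use test_functionD(4)[OF tf] in \<open>auto intro!: bd\<close>)
  have int2: "integrable M (\<lambda>\<omega>. Z \<omega> * (\<phi>'' (Y \<omega>) / 2))"
  proof (rule integrable_const_bound[where B = "c * C"])
    have "\<bar>\<phi>'' v / 2\<bar> \<le> C" for v using test_functionD(5)[OF tf, of v] by simp
    then show "AE \<omega> in M. norm (Z \<omega> * (\<phi>'' (Y \<omega>) / 2)) \<le> c * C"
      unfolding real_norm_def by (intro AE_I2 bd)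
  qed measurable
  have int3: "integrable M (\<lambda>\<omega>. Z \<omega> * (\<phi> (Y \<omega> + D \<omega>) - \<phi> (Y \<omega>)))"
  proof (rule integrable_const_bound[where B = "c * (2 * C)"])
    have "\<bar>\<phi> a - \<phi> b\<bar> \<le> 2 * C" for a b
      using test_functionD(3)[OF tf, of a] test_functionD(3)[OF tf, of b] by linarith
    then show "AE \<omega> in M. norm (Z \<omega> * (\<phi> (Y \<omega> + D \<omega>) - \<phi> (Y \<omega>))) \<le> c * (2 * C)"
      unfolding real_norm_def by (intro AE_I2 bd)
  qed measurable
  note t1 = increment_times[OF s ZY(1) int1, unfolded D_app] and t2 = increment_times[OF s ZY(2) int2, unfolded D_app]
  define R where "R \<omega> = Z \<omega> * (\<phi> (Y \<omega> + D \<omega>) - \<phi> (Y \<omega>)) - Z \<omega> * \<phi>' (Y \<omega>) * D \<omega> - Z \<omega> * (\<phi>'' (Y \<omega>) / 2) * (D \<omega>)\<^sup>2" for \<omega>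
  have "expectation R = expectation (\<lambda>\<omega>. Z \<omega> * (\<phi> (Y \<omega> + D \<omega>) - \<phi> (Y \<omega>))) - 0 - (u - s) * expectation (\<lambda>\<omega>. Z \<omega> * (\<phi>'' (Y \<omega>) / 2))"
    unfolding R_def[abs_def] using int3 t1 t2 by (simp only: Bochner_Integration.integral_diff Bochner_Integration.integrable_diff)
  moreover have "\<bar>expectation R\<bar> \<le> expectation (\<lambda>\<omega>. c * (C * \<bar>D \<omega>\<bar> ^ 3))"
  proof (rule abs_integral_le)
    show "integrable M R" unfolding R_def[abs_def] using int3 t1 t2 by (intro Bochner_Integration.integrable_diff)
    show "integrable M (\<lambda>\<omega>. c * (C * \<bar>D \<omega>\<bar> ^ 3))" using mom(5) by simp
    fix \<omega>
    have "R \<omega> = Z \<omega> * (\<phi> (Y \<omega> + D \<omega>) - \<phi> (Y \<omega>) - \<phi>' (Y \<omega>) * D \<omega> - \<phi>'' (Y \<omega>) * (D \<omega>)\<^sup>2 / 2)"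
      by (simp add: R_def algebra_simps)
    then show "\<bar>R \<omega>\<bar> \<le> c * (C * \<bar>D \<omega>\<bar> ^ 3)"
      using taylor2[OF test_functionD(1,2,6)[OF tf]] by (auto intro!: bd)
  qed
  moreover have "\<dots> \<le> c * (C * (2 * (u - s) * sqrt (u - s)))"
    using mom(5,6) C0 by (simp add: mult_left_mono)
  ultimately show ?thesis by (simp add: mult.assoc)
qed

lemma B_square:
  assumes "0 \<le> t" shows "integrable M (\<lambda>\<omega>. (B t \<omega>)\<^sup>2)" "expectation (\<lambda>\<omega>. (B t \<omega>)\<^sup>2) = t" "integrable M (B t)"
proof -
  have [measurable]: "B t \<in> borel_measurable M" "B 0 \<in> borel_measurable M" using B_measurable assms by auto
  show "integrable M (\<lambda>\<omega>. (B t \<omega>)\<^sup>2)" "expectation (\<lambda>\<omega>. (B t \<omega>)\<^sup>2) = t" "integrable M (B t)"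
  proof (atomize (full), cases "t = 0")
    case True
    have 1: "AE \<omega> in M. (B 0 \<omega>)\<^sup>2 = 0" using B_start by auto
    have "integrable M (\<lambda>\<omega>. (B 0 \<omega>)\<^sup>2) \<longleftrightarrow> integrable M (\<lambda>_. 0 :: real)" "integrable M (B 0) \<longleftrightarrow> integrable M (\<lambda>_. 0 :: real)"
      "expectation (\<lambda>\<omega>. (B 0 \<omega>)\<^sup>2) = expectation (\<lambda>_. 0)"
      using 1 B_start by (intro integrable_cong_AE integral_cong_AE; simp)+
    then show "integrable M (\<lambda>\<omega>. (B t \<omega>)\<^sup>2) \<and> expectation (\<lambda>\<omega>. (B t \<omega>)\<^sup>2) = t \<and> integrable M (B t)" using True by simp
  next
    case False
    then have t: "0 < t" using assms by simp
    have 1: "AE \<omega> in M. B t \<omega> = B t \<omega> - B 0 \<omega>" "AE \<omega> in M. (B t \<omega>)\<^sup>2 = (B t \<omega> - B 0 \<omega>)\<^sup>2" using B_start by auto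
    have "integrable M (\<lambda>\<omega>. (B t \<omega>)\<^sup>2) \<longleftrightarrow> integrable M (\<lambda>\<omega>. (B t \<omega> - B 0 \<omega>)\<^sup>2)" "integrable M (B t) \<longleftrightarrow> integrable M (\<lambda>\<omega>. B t \<omega> - B 0 \<omega>)"
      "expectation (\<lambda>\<omega>. (B t \<omega>)\<^sup>2) = expectation (\<lambda>\<omega>. (B t \<omega> - B 0 \<omega>)\<^sup>2)"
      using 1 by (intro integrable_cong_AE integral_cong_AE; simp)+
    then show "integrable M (\<lambda>\<omega>. (B t \<omega>)\<^sup>2) \<and> expectation (\<lambda>\<omega>. (B t \<omega>)\<^sup>2) = t \<and> integrable M (B t)"
      using increment_moments[OF order_refl t] by simp
  qed
qed

text \<open>\<open>pathwise_doob\<close> gives a second moment, from which a first moment follows by \<open>r \<le> 1 + r\<^sup>2\<close>. The estimate is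
  uniform in the grid, which is what Fatou's lemma needs.\<close>

lemma running_max_moment:
  assumes "0 \<le> T"
  defines "R \<equiv> \<lambda>n \<omega>. running_max (\<lambda>i. B (grid 0 T n i) \<omega>)"
  shows "R n \<omega> k \<ge> 0" and "(\<lambda>\<omega>. R n \<omega> n) \<in> borel_measurable M" and "(\<integral>\<^sup>+\<omega>. ennreal (R n \<omega> n) \<partial>M) \<le> ennreal (1 + 4 * T)"
proof -
  show R_nonneg: "R n \<omega> k \<ge> 0" for \<omega> k by (simp add: R_def running_max_nonneg)
  define g where "g = grid 0 T n"
  have g0: "0 \<le> g i" "g i \<le> g (Suc i)" for i using assms(1) by (auto simp: g_def grid_def divide_right_mono mult_right_mono)
  have g_mono: "mono g" using g0(2) by (rule mono_iff_le_Suc[THEN iffD2, rule_format])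
  have g_n: "g n \<le> T" using assms(1) by (auto simp: g_def grid_def)
  have R_eq: "R n \<omega> k = running_max (\<lambda>i. B (g i) \<omega>) k" for \<omega> k by (simp add: R_def g_def)
  have R_meas: "(\<lambda>\<omega>. R n \<omega> k) \<in> borel_measurable (\<F> (g k))" for k
  proof (induction k)
    case 0
    show ?case unfolding R_eq using B_adapted[OF g0(1)[of 0]] by simp
  next
    case (Suc k)
    then show ?case
      using measurable_filtration_mono[OF Suc g0] B_adapted[OF g0(1)[of "Suc k"]] unfolding R_eq by simp
  qed
  then have R_M: "(\<lambda>\<omega>. R n \<omega> k) \<in> borel_measurable M" for k
    using measurable_filtration_M g0(1) by blast
  then show "(\<lambda>\<omega>. R n \<omega> n) \<in> borel_measurable M" .
  have R_int: "integrable M (\<lambda>\<omega>. R n \<omega> k)" for k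
  proof (rule Bochner_Integration.integrable_bound[OF _ R_M])
    show "integrable M (\<lambda>\<omega>. \<Sum>i\<le>k. \<bar>B (g i) \<omega>\<bar>)"
      using B_square(3)[OF g0(1)] by (intro Bochner_Integration.integrable_sum integrable_abs)
    show "AE \<omega> in M. norm (R n \<omega> k) \<le> norm (\<Sum>i\<le>k. \<bar>B (g i) \<omega>\<bar>)"
    proof (rule AE_I2)
      fix \<omega>
      have "\<bar>R n \<omega> k\<bar> \<le> \<bar>\<Sum>i\<le>k. \<bar>B (g i) \<omega>\<bar>\<bar>"
        using running_max_le_sum[of "\<lambda>i. B (g i) \<omega>" k] R_nonneg[of \<omega> k] unfolding R_eq by linarith
      then show "norm (R n \<omega> k) \<le> norm (\<Sum>i\<le>k. \<bar>B (g i) \<omega>\<bar>)" by simp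
    qed
  qed
  have mart: "integrable M (\<lambda>\<omega>. R n \<omega> k * sgn (B (g k) \<omega>) * (B (g (Suc k)) \<omega> - B (g k) \<omega>))"
    "expectation (\<lambda>\<omega>. R n \<omega> k * sgn (B (g k) \<omega>) * (B (g (Suc k)) \<omega> - B (g k) \<omega>)) = 0" for k
  proof (atomize (full), cases "g k < g (Suc k)")
    case True
    have W: "(\<lambda>\<omega>. R n \<omega> k * sgn (B (g k) \<omega>)) \<in> borel_measurable (\<F> (g k))"
      using R_meas[of k] B_adapted[OF g0(1)[of k]] by measurable
    have "integrable M (\<lambda>\<omega>. R n \<omega> k * sgn (B (g k) \<omega>))"
      by (rule Bochner_Integration.integrable_bound[OF R_int measurable_filtration_M[OF W g0(1)]])
         (auto simp: abs_mult sgn_if)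
    from increment_times(1,2)[OF g0(1) True W this]
    show "integrable M (\<lambda>\<omega>. R n \<omega> k * sgn (B (g k) \<omega>) * (B (g (Suc k)) \<omega> - B (g k) \<omega>)) \<and>
      expectation (\<lambda>\<omega>. R n \<omega> k * sgn (B (g k) \<omega>) * (B (g (Suc k)) \<omega> - B (g k) \<omega>)) = 0" by simp
  next
    case False
    then have "g (Suc k) = g k" using g0(2)[of k] by simp
    then show "integrable M (\<lambda>\<omega>. R n \<omega> k * sgn (B (g k) \<omega>) * (B (g (Suc k)) \<omega> - B (g k) \<omega>)) \<and>
      expectation (\<lambda>\<omega>. R n \<omega> k * sgn (B (g k) \<omega>) * (B (g (Suc k)) \<omega> - B (g k) \<omega>)) = 0" by simp
  qed
  \<comment> \<open>One plus the right-hand side of \<open>pathwise_doob\<close>, whose sum has mean \<open>0\<close>.\<close>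
  define G where "G \<omega> = 1 + (4 * (B (g n) \<omega>)\<^sup>2 - 4 * (\<Sum>k<n. R n \<omega> k * sgn (B (g k) \<omega>) * (B (g (Suc k)) \<omega> - B (g k) \<omega>)))" for \<omega>
  have R_le: "R n \<omega> n \<le> G \<omega>" for \<omega>
  proof -
    have "0 \<le> (R n \<omega> n - 1)\<^sup>2" by simp
    then have "2 * R n \<omega> n \<le> 1 + (R n \<omega> n)\<^sup>2" by (simp add: power2_eq_square algebra_simps)
    then have "R n \<omega> n \<le> 1 + (R n \<omega> n)\<^sup>2" using R_nonneg[of \<omega> n] by linarith
    also have "\<dots> \<le> G \<omega>"
      using pathwise_doob[of "\<lambda>i. B (g i) \<omega>" n] unfolding G_def R_eq by simp
    finally show ?thesis .
  qed
  have G_int: "integrable M G" "expectation G = 1 + 4 * g n"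
    unfolding G_def[abs_def] using mart B_square[OF g0(1)[of n]] by (simp_all add: prob_space)
  have "(\<integral>\<^sup>+\<omega>. ennreal (R n \<omega> n) \<partial>M) \<le> (\<integral>\<^sup>+\<omega>. ennreal (G \<omega>) \<partial>M)"
    using R_le by (intro nn_integral_mono ennreal_leI)
  also have "\<dots> = ennreal (expectation G)"
    using R_le R_nonneg by (intro nn_integral_eq_integral G_int AE_I2) (meson order_trans)
  also have "\<dots> \<le> ennreal (1 + 4 * T)" unfolding G_int using g_n by (intro ennreal_leI) simp
  finally show "(\<integral>\<^sup>+\<omega>. ennreal (R n \<omega> n) \<partial>M) \<le> ennreal (1 + 4 * T)" .
qed

end

lemma grid_running_max_limit:
  assumes b: "continuous_on UNIV b" and g: "0 \<le> g" "g \<le> T"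
  shows "\<exists>h. h \<longlonglongrightarrow> \<bar>b g\<bar> \<and> (\<forall>n>0. h n \<le> running_max (\<lambda>i. b (grid 0 T n i)) n)"
proof (cases "T = 0")
  case True
  then have "\<bar>b g\<bar> \<le> running_max (\<lambda>i. b (grid 0 T n i)) n" for n
    using running_max_ge[of 0 n "\<lambda>i. b (grid 0 T n i)"] g by (simp add: grid_def)
  then show ?thesis by (intro exI[of _ "\<lambda>_. \<bar>b g\<bar>"]) auto
next
  case False
  then have T: "0 < T" using g by simp
  define k where "k n = nat \<lfloor>g * real n / T\<rfloor>" for n
  have k_le: "k n \<le> n" for n
  proof -
    have "g * real n / T \<le> real n" using g T by (simp add: divide_le_eq mult_right_mono mult.commute)
    then have "\<lfloor>g * real n / T\<rfloor> \<le> int n" by linarith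
    then show ?thesis by (simp add: k_def)
  qed
  have near: "\<bar>grid 0 T n (k n) - g\<bar> \<le> T / real n" if "n > 0" for n
  proof -
    have k: "real (k n) = of_int \<lfloor>g * real n / T\<rfloor>" using g T by (simp add: k_def)
    have "real (k n) \<le> g * real n / T" "g * real n / T \<le> real (k n) + 1" unfolding k by linarith+
    then have "real (k n) * (T / real n) \<le> g * real n / T * (T / real n)"
      "g * real n / T * (T / real n) \<le> (real (k n) + 1) * (T / real n)" using T that by (intro mult_right_mono; simp)+
    moreover have "g * real n / T * (T / real n) = g" using T that by simp
    ultimately have "real (k n) * (T / real n) \<le> g" "g \<le> real (k n) * (T / real n) + T / real n"
      by (simp_all only: distrib_right mult_1)
    then show ?thesis by (simp add: grid_def)
  qed
  have "(\<lambda>n. grid 0 T n (k n) - g) \<longlonglongrightarrow> 0"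
    by (rule Lim_null_comparison[OF _ lim_const_over_n[of T]])
       (use near in \<open>auto intro: eventually_mono[OF eventually_gt_at_top[of 0]]\<close>)
  then have "(\<lambda>n. grid 0 T n (k n)) \<longlonglongrightarrow> g" by (simp add: LIM_zero_cancel)
  then have "(\<lambda>n. \<bar>b (grid 0 T n (k n))\<bar>) \<longlonglongrightarrow> \<bar>b g\<bar>"
    by (intro tendsto_rabs continuous_on_tendsto_compose[OF b]) auto
  then show ?thesis
    using running_max_ge[OF k_le, of "\<lambda>i. b (grid 0 T _ i)"]
    by (intro exI[of _ "\<lambda>n. \<bar>b (grid 0 T n (k n))\<bar>"]) auto
qed

section \<open>Ito's formula in expectation\<close>

lemma jointly_measurable_of_continuous:
  fixes X :: "real \<Rightarrow> 'w \<Rightarrow> real"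
  assumes meas: "\<And>t. 0 \<le> t \<Longrightarrow> X t \<in> borel_measurable N"
    and cont: "\<And>\<omega>. \<omega> \<in> space N \<Longrightarrow> continuous_on {0..} (\<lambda>t. X t \<omega>)"
  shows "(\<lambda>p. X (max 0 (fst p)) (snd p)) \<in> borel_measurable (borel \<Otimes>\<^sub>M N)"
proof -
  define d where "d n = real (Suc n)" for n
  define k where "k n t = nat \<lfloor>max 0 t * d n\<rfloor>" for n and t :: real
  have d: "0 < d n" for n by (simp add: d_def)
  have inv_d: "(\<lambda>n. 1 / d n) \<longlonglongrightarrow> 0" unfolding d_def by (rule LIMSEQ_Suc[OF lim_const_over_n])
  have near: "\<bar>real (k n t) / d n - max 0 t\<bar> \<le> 1 / d n" for n t
  proof -
    have "0 \<le> max 0 t * d n" using d[of n] by simp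
    then have le: "\<bar>real (k n t) - max 0 t * d n\<bar> \<le> 1" unfolding k_def by linarith
    have "real (k n t) / d n - max 0 t = (real (k n t) - max 0 t * d n) / d n" using d[of n] by (simp add: diff_divide_distrib)
    then have "\<bar>real (k n t) / d n - max 0 t\<bar> = \<bar>real (k n t) - max 0 t * d n\<bar> / d n" using d[of n] by (simp only: abs_divide abs_of_pos)
    also have "\<dots> \<le> 1 / d n" using le d[of n] by (intro divide_right_mono) auto
    finally show ?thesis .
  qed
  have lim: "(\<lambda>n. real (k n t) / d n) \<longlonglongrightarrow> max 0 t" for t
    by (rule LIM_zero_cancel, rule Lim_null_comparison[OF _ inv_d]) (simp only: real_norm_def near eventually_True)
  have nonneg: "0 \<le> real i / d n" for i n using d[of n] by simp
  show ?thesis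
  proof (rule borel_measurable_LIMSEQ_real)
    fix p :: "real \<times> 'w" assume "p \<in> space (borel \<Otimes>\<^sub>M N)"
    then have "snd p \<in> space N" by (simp add: space_pair_measure mem_Times_iff)
    then show "(\<lambda>n. X (real (k n (fst p)) / d n) (snd p)) \<longlonglongrightarrow> X (max 0 (fst p)) (snd p)"
      by (rule continuous_on_tendsto_compose[OF cont lim]) (simp_all only: atLeast_iff nonneg eventually_True max.cobounded1)
  next
    fix n
    show "(\<lambda>p. X (real (k n (fst p)) / d n) (snd p)) \<in> borel_measurable (borel \<Otimes>\<^sub>M N)"
    proof (rule measurable_compose_countable[where f = "\<lambda>i p. X (real i / d n) (snd p)"])
      show "(\<lambda>p. X (real i / d n) (snd p)) \<in> borel_measurable (borel \<Otimes>\<^sub>M N)" for i :: nat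
        by (rule measurable_compose[OF measurable_snd meas[OF nonneg]])
      have "k n \<in> borel \<rightarrow>\<^sub>M count_space UNIV" unfolding k_def by measurable
      from measurable_compose[OF measurable_fst this]
      show "(\<lambda>p. k n (fst p)) \<in> borel \<Otimes>\<^sub>M N \<rightarrow>\<^sub>M count_space UNIV" .
    qed
  qed
qed

lemma continuous_on_max0:
  fixes f :: "real \<Rightarrow> real"
  assumes "continuous_on {0..} f" shows "continuous_on UNIV (\<lambda>t. f (max 0 t))"
  by (rule continuous_on_compose2[OF assms]) (auto intro!: continuous_intros)

locale skew_bm = refracted_skew_brownian_motion M B X \<beta> \<mu>\<^sub>p \<mu>\<^sub>m 0 0
  for M :: "'w measure" and B X :: "real \<Rightarrow> 'w \<Rightarrow> real" and \<beta> \<mu>\<^sub>p \<mu>\<^sub>m :: real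
begin

abbreviation "drift \<equiv> drift_coeff \<mu>\<^sub>p \<mu>\<^sub>m"
abbreviation "drift_sup \<equiv> \<bar>\<mu>\<^sub>p\<bar> + \<bar>\<mu>\<^sub>m\<bar>"
abbreviation "gen \<phi>' \<phi>'' y \<equiv> drift y * \<phi>' y + \<phi>'' y / 2"

definition "x t \<omega> = X (max 0 t) \<omega>"
definition "b t \<omega> = B (max 0 t) \<omega>"
definition "L t \<omega> = sym_local_time (\<lambda>s. X s \<omega>) t 0"
definition "good \<omega> \<longleftrightarrow> refracted_path (\<lambda>t. x t \<omega>) (\<lambda>t. b t \<omega>) (\<lambda>t. L t \<omega>) \<beta> \<mu>\<^sub>p \<mu>\<^sub>m"

lemma x_nonneg_time: "0 \<le> t \<Longrightarrow> x t = X t" and b_nonneg_time: "0 \<le> t \<Longrightarrow> b t = B t"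
  by (auto simp: x_def b_def fun_eq_iff)

lemma AE_good: "AE \<omega> in M. good \<omega>"
proof -
  have cont: "AE \<omega> in M. continuous_on {0..} (\<lambda>t. X t \<omega>)" using X_continuous by (auto intro: AE_I2)
  show ?thesis
    using cont B_continuous B_start X_start local_time_exists X_equation
  proof eventually_elim
    case (elim \<omega>)
    have occ: "occupation_ratio (\<lambda>t. x t \<omega>) t 0 \<epsilon> = occupation_ratio (\<lambda>s. X s \<omega>) t 0 \<epsilon>" for t \<epsilon>
    proof -
      have "{s \<in> {0..t}. \<bar>x s \<omega> - 0\<bar> \<le> \<epsilon>} = {s \<in> {0..t}. \<bar>X s \<omega> - 0\<bar> \<le> \<epsilon>}" by (auto simp: x_def max_def)
      then show ?thesis unfolding occupation_ratio_def by simp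
    qed
    have ind: "(\<lambda>r. indicator A (x r \<omega>) :: real) \<in> borel_measurable borel" if "A \<in> sets borel" for A
    proof -
      have "(\<lambda>r. x r \<omega>) \<in> borel_measurable borel"
        unfolding x_def by (rule borel_measurable_continuous_onI[OF continuous_on_max0[OF elim(1)]])
      then show ?thesis using that by measurable
    qed
    have drift_eq: "\<mu>\<^sub>p * (LBINT s:{0..t}. indicator {0<..} (X s \<omega>)) + \<mu>\<^sub>m * (LBINT s:{0..t}. indicator {..<0} (X s \<omega>))
        = (LBINT s:{0..t}. drift (x s \<omega>))" for t
    proof -
      have "(LBINT s:{0..t}. indicator {0<..} (X s \<omega>) :: real) = (LBINT s:{0..t}. indicator {0<..} (x s \<omega>))"
        "(LBINT s:{0..t}. indicator {..<0} (X s \<omega>) :: real) = (LBINT s:{0..t}. indicator {..<0} (x s \<omega>))"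
        unfolding set_lebesgue_integral_def
        by (intro Bochner_Integration.integral_cong refl; auto simp: x_def max_def split: split_indicator)+
      moreover have "(LBINT s:{0..t}. drift (x s \<omega>)) = \<mu>\<^sub>p * (LBINT s:{0..t}. indicator {0<..} (x s \<omega>)) + \<mu>\<^sub>m * (LBINT s:{0..t}. indicator {..<0} (x s \<omega>))"
        unfolding drift_coeff_def
        using set_integrable_bounded_borel[OF ind, of "{0<..}" 0 t 1] set_integrable_bounded_borel[OF ind, of "{..<0}" 0 t 1]
        by (subst set_integral_add(2)) (auto simp: indicator_def)
      ultimately show ?thesis by simp
    qed
    show ?case unfolding good_def
    proof unfold_locales
      show "continuous_on UNIV (\<lambda>t. x t \<omega>)" "continuous_on UNIV (\<lambda>t. b t \<omega>)"
        unfolding x_def b_def by (rule continuous_on_max0[OF elim(1)] continuous_on_max0[OF elim(2)])+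
      show "x 0 \<omega> = 0" "b 0 \<omega> = 0" using elim(3,4) by (simp_all add: x_def b_def)
      fix t :: real assume t: "0 \<le> t"
      show "(occupation_ratio (\<lambda>t. x t \<omega>) t 0 \<longlongrightarrow> L t \<omega>) (at_right 0)"
        using elim(5)[rule_format, OF t] unfolding occ[abs_def] L_def .
      show "x t \<omega> = b t \<omega> + \<beta> * L t \<omega> + (LBINT s:{0..t}. drift (x s \<omega>))"
        using elim(6)[rule_format, OF t] drift_eq[of t] unfolding x_nonneg_time[OF t] b_nonneg_time[OF t] L_def elim(4)
        by linarith
    qed
  qed
qed

lemma x_joint: "(\<lambda>p. x (fst p) (snd p)) \<in> borel_measurable (borel \<Otimes>\<^sub>M M)"
  unfolding x_def
  by (rule jointly_measurable_of_continuous[OF measurable_filtration_M[OF X_adapted] X_continuous])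

lemma x_adapted: "0 \<le> t \<Longrightarrow> x t \<in> borel_measurable (\<F> t)"
  using X_adapted by (simp add: x_nonneg_time)

lemma x_measurable [measurable]: "x t \<in> borel_measurable M"
  unfolding x_def[abs_def] using measurable_filtration_M[OF X_adapted, of "max 0 t"] by simp

lemma b_measurable [measurable]: "b t \<in> borel_measurable M"
  unfolding b_def[abs_def] using B_measurable[of "max 0 t"] by simp

lemma path_measurable: "\<omega> \<in> space M \<Longrightarrow> (\<lambda>t. x t \<omega>) \<in> borel_measurable borel"
  unfolding x_def by (intro borel_measurable_continuous_onI continuous_on_max0 X_continuous)

lemma time_integral_measurable:
  fixes f :: "real \<Rightarrow> real"
  assumes [measurable]: "f \<in> borel_measurable borel"
  shows "(\<lambda>\<omega>. LBINT r:{s..t}. f (x r \<omega>)) \<in> borel_measurable M"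
proof -
  have "(\<lambda>p. x (snd p) (fst p)) \<in> borel_measurable (M \<Otimes>\<^sub>M lborel)"
  proof -
    have "(\<lambda>p. (snd p, fst p)) \<in> measurable (M \<Otimes>\<^sub>M lborel) (borel \<Otimes>\<^sub>M M)" by measurable
    from measurable_compose[OF this x_joint] show ?thesis by simp
  qed
  then have "(\<lambda>(\<omega>, r). indicator {s..t} r *\<^sub>R f (x r \<omega>)) \<in> borel_measurable (M \<Otimes>\<^sub>M lborel)"
    unfolding case_prod_beta by measurable
  from lborel.borel_measurable_lebesgue_integral[OF this]
  show ?thesis unfolding set_lebesgue_integral_def .
qed

lemma time_integral_bound:
  fixes f :: "real \<Rightarrow> real"
  assumes "f \<in> borel_measurable borel" "\<And>y. \<bar>f y\<bar> \<le> C" "s \<le> t" "\<omega> \<in> space M"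
  shows "\<bar>LBINT r:{s..t}. f (x r \<omega>)\<bar> \<le> C * (t - s)"
  using measurable_compose[OF path_measurable[OF assms(4)] assms(1)] assms(2,3) by (intro set_integral_bounded) auto

text \<open>Almost surely \<open>V = \<beta> L\<close>, but unlike \<open>L\<close>, which is defined path by path as a limit, \<open>V\<close> is measurable by construction.\<close>

definition "V t \<omega> = x t \<omega> - b t \<omega> - (LBINT r:{0..t}. drift (x r \<omega>))"

lemma V_measurable [measurable]: "V t \<in> borel_measurable M"
  unfolding V_def[abs_def] by (intro borel_measurable_diff x_measurable b_measurable time_integral_measurable drift_coeff_measurable)

lemma good_V: "good \<omega> \<Longrightarrow> 0 \<le> t \<Longrightarrow> V t \<omega> = \<beta> * L t \<omega>"
  unfolding good_def V_def by (drule refracted_path.x_eq) auto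

text \<open>Almost surely \<open>|V\<^sub>t|\<close> is at most \<open>|B\<^sub>g|\<close> plus \<open>t\<close> times the drift bound, where \<open>g\<close> is the last zero, and \<open>|B\<^sub>g|\<close> is at most the lower limit of the
  running maxima of \<open>B\<close> along finer and finer grids.\<close>

lemma V_integrable:
  assumes t: "0 \<le> t" shows "integrable M (V t)"
proof (rule integrableI_bounded[OF V_measurable])
  define R where "R n \<omega> = running_max (\<lambda>i. B (grid 0 t n i) \<omega>) n" for n \<omega>
  have R: "(\<lambda>\<omega>. R n \<omega>) \<in> borel_measurable M" "(\<integral>\<^sup>+\<omega>. ennreal (R n \<omega>) \<partial>M) \<le> ennreal (1 + 4 * t)" "0 \<le> R n \<omega>" for n \<omega>
    using running_max_moment[OF t, of n] unfolding R_def by auto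
  have "(\<integral>\<^sup>+\<omega>. ennreal (norm (V t \<omega>)) \<partial>M) \<le> (\<integral>\<^sup>+\<omega>. liminf (\<lambda>n. ennreal (R n \<omega> + drift_sup * t)) \<partial>M)"
  proof (rule nn_integral_mono_AE)
    show "AE \<omega> in M. ennreal (norm (V t \<omega>)) \<le> liminf (\<lambda>n. ennreal (R n \<omega> + drift_sup * t))"
      using AE_good
    proof eventually_elim
      case (elim \<omega>)
      interpret refracted_path "\<lambda>t. x t \<omega>" "\<lambda>t. b t \<omega>" "\<lambda>t. L t \<omega>" \<beta> \<mu>\<^sub>p \<mu>\<^sub>m
        using elim by (simp add: good_def)
      obtain g where g: "0 \<le> g" "g \<le> t" "\<bar>V t \<omega>\<bar> \<le> \<bar>b g \<omega>\<bar> + drift_sup * t"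
        using local_time_at_zero[OF t] good_V[OF elim t] by auto
      obtain h where h: "h \<longlonglongrightarrow> \<bar>b g \<omega>\<bar>" "\<And>n. n > 0 \<Longrightarrow> h n \<le> running_max (\<lambda>i. b (grid 0 t n i) \<omega>) n"
        using grid_running_max_limit[OF b_cont g(1,2)] by blast
      have hR: "h n \<le> R n \<omega>" if "n > 0" for n
      proof -
        have "0 \<le> grid 0 t n i" for i using t by (simp add: grid_def)
        then show ?thesis using h(2)[OF that] by (simp add: R_def b_nonneg_time)
      qed
      have "ennreal (norm (V t \<omega>)) \<le> ennreal (\<bar>b g \<omega>\<bar> + drift_sup * t)" using g(3) by (intro ennreal_leI) simp
      also have "\<dots> = liminf (\<lambda>n. ennreal (h n + drift_sup * t))"
        by (rule lim_imp_Liminf[symmetric]) (auto intro!: tendsto_intros tendsto_ennrealI h(1))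
      also have "\<dots> \<le> liminf (\<lambda>n. ennreal (R n \<omega> + drift_sup * t))"
        by (rule Liminf_mono) (use hR in \<open>auto intro!: eventually_mono[OF eventually_gt_at_top[of 0]] ennreal_leI\<close>)
      finally show ?case .
    qed
  qed
  also have "\<dots> \<le> liminf (\<lambda>n. \<integral>\<^sup>+\<omega>. ennreal (R n \<omega> + drift_sup * t) \<partial>M)"
    using R(1) by (intro nn_integral_liminf measurable_compose[OF _ measurable_ennreal] borel_measurable_add borel_measurable_const)
  also have "\<dots> \<le> liminf (\<lambda>n. ennreal (1 + 4 * t) + ennreal (drift_sup * t))"
  proof (rule Liminf_mono, rule always_eventually, rule allI)
    fix n
    have "(\<integral>\<^sup>+\<omega>. ennreal (R n \<omega> + drift_sup * t) \<partial>M) = (\<integral>\<^sup>+\<omega>. ennreal (R n \<omega>) + ennreal (drift_sup * t) \<partial>M)"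
      using R(3) t by (simp add: ennreal_plus)
    also have "\<dots> = (\<integral>\<^sup>+\<omega>. ennreal (R n \<omega>) \<partial>M) + ennreal (drift_sup * t)"
      using R(1) by (subst nn_integral_add) (auto simp: emeasure_space_1)
    also have "\<dots> \<le> ennreal (1 + 4 * t) + ennreal (drift_sup * t)" by (rule add_right_mono[OF R(2)])
    finally show "(\<integral>\<^sup>+\<omega>. ennreal (R n \<omega> + drift_sup * t) \<partial>M) \<le> ennreal (1 + 4 * t) + ennreal (drift_sup * t)" .
  qed
  also have "\<dots> = ennreal (1 + 4 * t) + ennreal (drift_sup * t)" by (simp add: Liminf_const)
  also have "\<dots> < \<infinity>" by simp
  finally show "(\<integral>\<^sup>+\<omega>. ennreal (norm (V t \<omega>)) \<partial>M) < \<infinity>" .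
qed

text \<open>Along a grid with \<open>n\<close> cells, the increment of \<open>\<phi>(x)\<close> is the pathwise sum \<open>GS n\<close> plus the Taylor errors of the
  Brownian increments. The sums converge dominatedly, and the errors are of order \<open>n\<close> to the power \<open>-1/2\<close> in mean.\<close>

lemma ito_expectation:
  assumes st: "0 \<le> s" "s < t" and tf: "test_function C \<phi> \<phi>' \<phi>''"
    and Z: "Z \<in> borel_measurable (\<F> s)" "\<And>\<omega>. \<bar>Z \<omega>\<bar> \<le> c"
  shows "expectation (\<lambda>\<omega>. Z \<omega> * (\<phi> (x t \<omega>) - \<phi> (x s \<omega>)))
    = expectation (\<lambda>\<omega>. Z \<omega> * ((LBINT r:{s..t}. gen \<phi>' \<phi>'' (x r \<omega>)) + \<phi>' 0 * (V t \<omega> - V s \<omega>)))"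
proof -
  note [measurable] = test_functionD(9-11)[OF tf, THEN borel_measurable_continuous_onI] measurable_filtration_M[OF Z(1) st(1)]
  have C0: "0 \<le> C" "0 \<le> c" using test_functionD(8)[OF tf] Z(2)[THEN order_trans[OF abs_ge_zero]] by auto
  define GS where "GS n \<omega> = grid_sum (\<lambda>t. x t \<omega>) (\<lambda>t. b t \<omega>) \<phi> \<phi>'' s t n" for n \<omega>
  have [measurable]: "GS n \<in> borel_measurable M" for n
    unfolding GS_def[abs_def] grid_sum_def by measurable
  have lim: "(\<lambda>n. expectation (\<lambda>\<omega>. Z \<omega> * GS n \<omega>))
    \<longlonglongrightarrow> expectation (\<lambda>\<omega>. Z \<omega> * ((LBINT r:{s..t}. gen \<phi>' \<phi>'' (x r \<omega>)) + \<phi>' 0 * (V t \<omega> - V s \<omega>)))"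
  proof (rule integral_dominated_convergence[where w = "\<lambda>\<omega>. c * (C * (drift_sup * (t - s) + \<bar>V t \<omega> - V s \<omega>\<bar>) + C * (t - s))"])
    show "integrable M (\<lambda>\<omega>. c * (C * (drift_sup * (t - s) + \<bar>V t \<omega> - V s \<omega>\<bar>) + C * (t - s)))"
      using V_integrable st by (intro integrable_mult_right Bochner_Integration.integrable_add integrable_abs Bochner_Integration.integrable_diff) auto
    have [measurable]: "(\<lambda>\<omega>. LBINT r:{s..t}. gen \<phi>' \<phi>'' (x r \<omega>)) \<in> borel_measurable M"
      by (rule time_integral_measurable) measurable
    show "(\<lambda>\<omega>. Z \<omega> * ((LBINT r:{s..t}. gen \<phi>' \<phi>'' (x r \<omega>)) + \<phi>' 0 * (V t \<omega> - V s \<omega>))) \<in> borel_measurable M" by measurable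
    show "(\<lambda>\<omega>. Z \<omega> * GS n \<omega>) \<in> borel_measurable M" for n by measurable
    show "AE \<omega> in M. (\<lambda>n. Z \<omega> * GS n \<omega>) \<longlonglongrightarrow> Z \<omega> * ((LBINT r:{s..t}. gen \<phi>' \<phi>'' (x r \<omega>)) + \<phi>' 0 * (V t \<omega> - V s \<omega>))"
      using AE_good
    proof eventually_elim
      case (elim \<omega>)
      interpret refracted_path "\<lambda>t. x t \<omega>" "\<lambda>t. b t \<omega>" "\<lambda>t. L t \<omega>" \<beta> \<mu>\<^sub>p \<mu>\<^sub>m
        using elim by (simp add: good_def)
      have "V t \<omega> - V s \<omega> = \<beta> * (L t \<omega> - L s \<omega>)" using good_V[OF elim] st by (simp add: algebra_simps)
      then show ?case
        unfolding GS_def using grid_sum_tendsto[OF tf st(1) less_imp_le[OF st(2)]] by (auto intro!: tendsto_mult_left)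
    qed
    show "AE \<omega> in M. norm (Z \<omega> * GS n \<omega>) \<le> c * (C * (drift_sup * (t - s) + \<bar>V t \<omega> - V s \<omega>\<bar>) + C * (t - s))" for n
      using AE_good
    proof eventually_elim
      case (elim \<omega>)
      interpret refracted_path "\<lambda>t. x t \<omega>" "\<lambda>t. b t \<omega>" "\<lambda>t. L t \<omega>" \<beta> \<mu>\<^sub>p \<mu>\<^sub>m
        using elim by (simp add: good_def)
      have "V t \<omega> - V s \<omega> = \<beta> * (L t \<omega> - L s \<omega>)" using good_V[OF elim] st by (simp add: algebra_simps)
      then have "\<bar>V t \<omega> - V s \<omega>\<bar> = \<bar>\<beta>\<bar> * (L t \<omega> - L s \<omega>)" using l_mono[of s t] st by (simp add: abs_mult)
      then show ?case
        unfolding GS_def using grid_sum_bound[OF tf st(1) less_imp_le[OF st(2)], of n] Z(2)[of \<omega>] C0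
        by (auto simp: abs_mult intro!: mult_mono)
    qed
  qed
  have err: "\<bar>expectation (\<lambda>\<omega>. Z \<omega> * (\<phi> (x t \<omega>) - \<phi> (x s \<omega>))) - expectation (\<lambda>\<omega>. Z \<omega> * GS n \<omega>)\<bar>
      \<le> c * C * (2 * (t - s)) * sqrt ((t - s) / real n)" if n: "n > 0" for n
  proof -
    define g where "g = grid s t n"
    define h where "h = (t - s) / real n"
    have g_ends: "g 0 = s" "g n = t" using n by (auto simp: g_def grid_def)
    have g_step: "g (Suc i) = g i + h" for i by (simp add: g_def grid_def h_def distrib_right add_divide_distrib)
    have h: "0 < h" using st n by (simp add: h_def)
    have g0: "0 \<le> g i" "s \<le> g i" for i using st by (auto simp: g_def grid_def)
    define \<Delta> where "\<Delta> i \<omega> = b (g (Suc i)) \<omega> - b (g i) \<omega>" for i \<omega>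
    define E where "E i \<omega> = Z \<omega> * (\<phi> (x (g i) \<omega> + \<Delta> i \<omega>) - \<phi> (x (g i) \<omega>))" for i \<omega>
    define F where "F i \<omega> = Z \<omega> * (\<phi>'' (x (g i) \<omega>) / 2)" for i \<omega>
    have step: "\<bar>expectation (E i) - h * expectation (F i)\<bar> \<le> c * C * (2 * h * sqrt h)" for i
    proof -
      have "g i < g (Suc i)" using h by (simp add: g_step)
      from taylor_increment[OF g0(1) this tf measurable_filtration_mono[OF Z(1) st(1) g0(2)] Z(2) x_adapted[OF g0(1)]]
      show ?thesis unfolding E_def[abs_def] F_def[abs_def] \<Delta>_def using g0(1)[of i] g0(1)[of "Suc i"] by (simp add: b_nonneg_time g_step)
    qed
    have bd: "\<bar>Z \<omega> * v\<bar> \<le> c * k" if "\<bar>v\<bar> \<le> k" for \<omega> v k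
      unfolding abs_mult using that Z(2) C0 by (intro mult_mono) auto
    have d2: "\<bar>\<phi> y - \<phi> z\<bar> \<le> 2 * C" for y z
      using test_functionD(3)[OF tf, of y] test_functionD(3)[OF tf, of z] by linarith
    have [measurable]: "\<Delta> i \<in> borel_measurable M" for i unfolding \<Delta>_def[abs_def] by measurable
    have intE: "integrable M (E i)" for i
      unfolding E_def[abs_def] real_norm_def
      by (rule integrable_const_bound[where B = "c * (2 * C)"], unfold real_norm_def, intro AE_I2 bd d2) measurable
    have intF: "integrable M (F i)" for i
    proof -
      have "\<bar>\<phi>'' v / 2\<bar> \<le> C" for v using test_functionD(5)[OF tf, of v] by simp
      then show ?thesis
        unfolding F_def[abs_def]
        by (intro integrable_const_bound[where B = "c * C"], unfold real_norm_def, intro AE_I2 bd) measurable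
    qed
    have int1: "integrable M (\<lambda>\<omega>. Z \<omega> * (\<phi> (x t \<omega>) - \<phi> (x s \<omega>)))"
      by (rule integrable_const_bound[where B = "c * (2 * C)"], unfold real_norm_def, intro AE_I2 bd d2) measurable
    have id: "Z \<omega> * GS n \<omega> = Z \<omega> * (\<phi> (x t \<omega>) - \<phi> (x s \<omega>)) - (\<Sum>i<n. E i \<omega> - h * F i \<omega>)" for \<omega>
    proof -
      have "(\<Sum>i<n. \<phi> (x (g (Suc i)) \<omega>) - \<phi> (x (g i) \<omega>)) = \<phi> (x t \<omega>) - \<phi> (x s \<omega>)"
        using sum_lessThan_telescope[of "\<lambda>i. \<phi> (x (g i) \<omega>)" n] g_ends by simp
      then have "Z \<omega> * (\<phi> (x t \<omega>) - \<phi> (x s \<omega>)) - Z \<omega> * GS n \<omega>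
        = Z \<omega> * (\<Sum>i<n. (\<phi> (x (g (Suc i)) \<omega>) - \<phi> (x (g i) \<omega>)) - (\<phi> (x (g (Suc i)) \<omega>) -
            \<phi> (x (g i) \<omega> + \<Delta> i \<omega>) + \<phi>'' (x (g i) \<omega>) / 2 * h))"
        unfolding GS_def grid_sum_def g_def[symmetric] h_def[symmetric] \<Delta>_def[symmetric]
        by (simp only: sum_subtractf right_diff_distrib)
      also have "\<dots> = (\<Sum>i<n. E i \<omega> - h * F i \<omega>)"
        unfolding sum_distrib_left E_def F_def by (intro sum.cong refl) (simp add: algebra_simps)
      finally show ?thesis by simp
    qed
    have "expectation (\<lambda>\<omega>. Z \<omega> * (\<phi> (x t \<omega>) - \<phi> (x s \<omega>))) - expectation (\<lambda>\<omega>. Z \<omega> * GS n \<omega>)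
      = (\<Sum>i<n. expectation (E i) - h * expectation (F i))"
      unfolding id using int1 intE intF
      by (simp add: Bochner_Integration.integral_diff Bochner_Integration.integral_sum)
    also have "\<bar>\<dots>\<bar> \<le> (\<Sum>i<n. c * C * (2 * h * sqrt h))"
      by (rule order_trans[OF sum_abs sum_mono]) (rule step)
    also have "\<dots> = c * C * (2 * (t - s)) * sqrt ((t - s) / real n)"
      using n by (simp add: h_def)
    finally show ?thesis .
  qed
  have "(\<lambda>n. expectation (\<lambda>\<omega>. Z \<omega> * (\<phi> (x t \<omega>) - \<phi> (x s \<omega>))) - expectation (\<lambda>\<omega>. Z \<omega> * GS n \<omega>)) \<longlonglongrightarrow> 0"
  proof (rule Lim_null_comparison)
    show "\<forall>\<^sub>F n in sequentially. norm (expectation (\<lambda>\<omega>. Z \<omega> * (\<phi> (x t \<omega>) - \<phi> (x s \<omega>))) - expectation (\<lambda>\<omega>. Z \<omega> * GS n \<omega>))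
       \<le> c * C * (2 * (t - s)) * sqrt ((t - s) / real n)"
      using err by (auto intro: eventually_mono[OF eventually_gt_at_top[of 0]])
    have "(\<lambda>n. c * C * (2 * (t - s)) * sqrt ((t - s) / real n)) \<longlonglongrightarrow> c * C * (2 * (t - s)) * sqrt 0"
      by (intro tendsto_intros lim_const_over_n)
    then show "(\<lambda>n. c * C * (2 * (t - s)) * sqrt ((t - s) / real n)) \<longlonglongrightarrow> 0" by simp
  qed
  from tendsto_add[OF this lim]
  have "(\<lambda>n. expectation (\<lambda>\<omega>. Z \<omega> * (\<phi> (x t \<omega>) - \<phi> (x s \<omega>))))
    \<longlonglongrightarrow> 0 + expectation (\<lambda>\<omega>. Z \<omega> * ((LBINT r:{s..t}. gen \<phi>' \<phi>'' (x r \<omega>)) + \<phi>' 0 * (V t \<omega> - V s \<omega>)))" by simp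
  then show ?thesis by (simp add: LIMSEQ_const_iff)
qed

end

section \<open>Test functions on a half-line\<close>

definition bounded_lipschitz :: "(real \<Rightarrow> real) \<Rightarrow> bool" where
  "bounded_lipschitz f \<longleftrightarrow> (\<exists>C. (\<forall>x. \<bar>f x\<bar> \<le> C) \<and> (\<forall>x y. \<bar>f x - f y\<bar> \<le> C * \<bar>x - y\<bar>))"

lemma bounded_lipschitzI:
  assumes "\<And>x. \<bar>f x\<bar> \<le> C" "\<And>x y. \<bar>f x - f y\<bar> \<le> D * \<bar>x - y\<bar>"
  shows "bounded_lipschitz f"
proof -
  have "\<bar>f x\<bar> \<le> max C D" "\<bar>f x - f y\<bar> \<le> max C D * \<bar>x - y\<bar>" for x y
    using assms(1)[of x] assms(2)[of x y] mult_right_mono[of D "max C D" "\<bar>x - y\<bar>"] by linarith+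
  then show ?thesis unfolding bounded_lipschitz_def by blast
qed

lemma bounded_lipschitz_const: "bounded_lipschitz (\<lambda>_. c)"
  by (rule bounded_lipschitzI[where C = "\<bar>c\<bar>" and D = 0]) auto

lemma bounded_lipschitz_mult:
  assumes "bounded_lipschitz f" "bounded_lipschitz g"
  shows "bounded_lipschitz (\<lambda>x. f x * g x)"
proof -
  obtain C where C: "\<And>x. \<bar>f x\<bar> \<le> C" "\<And>x y. \<bar>f x - f y\<bar> \<le> C * \<bar>x - y\<bar>"
    using assms(1) unfolding bounded_lipschitz_def by blast
  obtain D where D: "\<And>x. \<bar>g x\<bar> \<le> D" "\<And>x y. \<bar>g x - g y\<bar> \<le> D * \<bar>x - y\<bar>"
    using assms(2) unfolding bounded_lipschitz_def by blast
  have CD: "0 \<le> C" "0 \<le> D" using order_trans[OF abs_ge_zero C(1)] order_trans[OF abs_ge_zero D(1)] by blast+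
  show ?thesis
  proof (rule bounded_lipschitzI)
    show "\<bar>f x * g x\<bar> \<le> C * D" for x
      unfolding abs_mult using C(1) D(1) CD by (intro mult_mono) auto
    show "\<bar>f x * g x - f y * g y\<bar> \<le> (2 * C * D) * \<bar>x - y\<bar>" for x y
    proof -
      have "f x * g x - f y * g y = f x * (g x - g y) + (f x - f y) * g y" by (simp add: algebra_simps)
      then have "\<bar>f x * g x - f y * g y\<bar> \<le> \<bar>f x\<bar> * \<bar>g x - g y\<bar> + \<bar>f x - f y\<bar> * \<bar>g y\<bar>"
        by (metis abs_mult abs_triangle_ineq)
      also have "\<dots> \<le> C * (D * \<bar>x - y\<bar>) + (C * \<bar>x - y\<bar>) * D"
        using C D CD by (intro add_mono mult_mono) auto
      finally show ?thesis by (simp add: mult_ac)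
    qed
  qed
qed

lemma bounded_lipschitz_add:
  assumes "bounded_lipschitz f" "bounded_lipschitz g"
  shows "bounded_lipschitz (\<lambda>x. f x + g x)"
proof -
  obtain C where C: "\<And>x. \<bar>f x\<bar> \<le> C" "\<And>x y. \<bar>f x - f y\<bar> \<le> C * \<bar>x - y\<bar>"
    using assms(1) unfolding bounded_lipschitz_def by blast
  obtain D where D: "\<And>x. \<bar>g x\<bar> \<le> D" "\<And>x y. \<bar>g x - g y\<bar> \<le> D * \<bar>x - y\<bar>"
    using assms(2) unfolding bounded_lipschitz_def by blast
  show ?thesis
  proof (rule bounded_lipschitzI)
    show "\<bar>f x + g x\<bar> \<le> C + D" for x using C(1)[of x] D(1)[of x] by linarith
    show "\<bar>f x + g x - (f y + g y)\<bar> \<le> (C + D) * \<bar>x - y\<bar>" for x y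
      using C(2)[of x y] D(2)[of x y] unfolding distrib_right by linarith
  qed
qed

lemma test_function_ex:
  assumes "\<And>x. (\<phi> has_real_derivative \<phi>' x) (at x)" "\<And>x. (\<phi>' has_real_derivative \<phi>'' x) (at x)"
    and "\<And>x. \<bar>\<phi> x\<bar> \<le> A" and "bounded_lipschitz \<phi>'" and "bounded_lipschitz \<phi>''"
  shows "\<exists>C. test_function C \<phi> \<phi>' \<phi>''"
proof -
  obtain C where C: "\<And>x. \<bar>\<phi>' x\<bar> \<le> C"
    using assms(4) unfolding bounded_lipschitz_def by blast
  obtain D where D: "\<And>x. \<bar>\<phi>'' x\<bar> \<le> D" "\<And>x y. \<bar>\<phi>'' x - \<phi>'' y\<bar> \<le> D * \<bar>x - y\<bar>"
    using assms(5) unfolding bounded_lipschitz_def by blast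
  define S where "S = max A (max C D)"
  have "\<bar>\<phi> x\<bar> \<le> S" "\<bar>\<phi>' x\<bar> \<le> S" "\<bar>\<phi>'' x\<bar> \<le> S" "\<bar>\<phi>'' x - \<phi>'' y\<bar> \<le> S * \<bar>x - y\<bar>" for x y
    using assms(3)[of x] C[of x] D(1)[of x] D(2)[of x y] mult_right_mono[of D S "\<bar>x - y\<bar>"]
    unfolding S_def by linarith+
  then show ?thesis using assms(1,2) unfolding test_function_def by blast
qed

text \<open>The bounds are required only for nonnegative arguments: the functions will be applied to the smoothed
  positive part, and exponentials such as \<open>exp (- r * x)\<close> are unbounded on the other side.\<close>

definition half_line_test ::
    "real \<Rightarrow> (real \<Rightarrow> real) \<Rightarrow> (real \<Rightarrow> real) \<Rightarrow> (real \<Rightarrow> real) \<Rightarrow> bool" where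
  "half_line_test C g g' g'' \<longleftrightarrow>
     (\<forall>x. (g has_real_derivative g' x) (at x)) \<and> (\<forall>x. (g' has_real_derivative g'' x) (at x)) \<and>
     (\<forall>x\<ge>0. \<bar>g x\<bar> \<le> C \<and> \<bar>g' x\<bar> \<le> C \<and> \<bar>g'' x\<bar> \<le> C) \<and>
     (\<forall>x\<ge>0. \<forall>y\<ge>0. \<bar>g'' x - g'' y\<bar> \<le> C * \<bar>x - y\<bar>)"

lemma half_line_testD:
  assumes "half_line_test C g g' g''"
  shows "(g has_real_derivative g' x) (at x)" "(g' has_real_derivative g'' x) (at x)"
    "0 \<le> x \<Longrightarrow> \<bar>g x\<bar> \<le> C" "0 \<le> x \<Longrightarrow> \<bar>g' x\<bar> \<le> C" "0 \<le> x \<Longrightarrow> \<bar>g'' x\<bar> \<le> C"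
    "0 \<le> x \<Longrightarrow> 0 \<le> y \<Longrightarrow> \<bar>g'' x - g'' y\<bar> \<le> C * \<bar>x - y\<bar>" "0 \<le> C"
proof -
  show "(g has_real_derivative g' x) (at x)" "(g' has_real_derivative g'' x) (at x)"
    "0 \<le> x \<Longrightarrow> \<bar>g x\<bar> \<le> C" "0 \<le> x \<Longrightarrow> \<bar>g' x\<bar> \<le> C" "0 \<le> x \<Longrightarrow> \<bar>g'' x\<bar> \<le> C"
    "0 \<le> x \<Longrightarrow> 0 \<le> y \<Longrightarrow> \<bar>g'' x - g'' y\<bar> \<le> C * \<bar>x - y\<bar>"
    using assms unfolding half_line_test_def by blast+
  have "\<bar>g 0\<bar> \<le> C" using assms unfolding half_line_test_def by blast
  then show "0 \<le> C" by linarith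
qed

text \<open>The second derivative contains the tent with weight \<open>g'\<close>; everything else stays bounded as \<open>\<epsilon>\<close> tends to \<open>0\<close>.\<close>

lemma ramp_test:
  assumes h: "half_line_test C g g' g''" and e: "0 < \<epsilon>" and \<sigma>: "\<sigma> = 1 \<or> \<sigma> = - 1"
  shows "\<exists>D. test_function D (\<lambda>x. g (ramp \<epsilon> (\<sigma> * x))) (\<lambda>x. \<sigma> * (g' (ramp \<epsilon> (\<sigma> * x)) * ramp' \<epsilon> (\<sigma> * x)))
      (\<lambda>x. g'' (ramp \<epsilon> (\<sigma> * x)) * (ramp' \<epsilon> (\<sigma> * x) * ramp' \<epsilon> (\<sigma> * x)) + g' (ramp \<epsilon> (\<sigma> * x)) * tent \<epsilon> (\<sigma> * x))"
proof -
  have \<sigma>_abs: "\<bar>\<sigma> * x - \<sigma> * y\<bar> = \<bar>x - y\<bar>" for x y using \<sigma> by auto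
  have \<sigma>2: "\<sigma> * (\<sigma> * x) = x" for x using \<sigma> by auto
  note w0 = ramp_nonneg[OF e] and w1 = ramp'_bounds[OF e]
  have d_ramp: "((\<lambda>x. ramp \<epsilon> (\<sigma> * x)) has_real_derivative ramp' \<epsilon> (\<sigma> * x) * \<sigma>) (at x)"
    and d_ramp': "((\<lambda>x. ramp' \<epsilon> (\<sigma> * x)) has_real_derivative tent \<epsilon> (\<sigma> * x) * \<sigma>) (at x)" for x
    by (rule DERIV_chain2[OF DERIV_ramp[OF e]] DERIV_chain2[OF DERIV_ramp'[OF e]], auto intro!: derivative_eq_intros)+
  note d_g = DERIV_chain2[OF half_line_testD(1)[OF h] d_ramp] and d_g' = DERIV_chain2[OF half_line_testD(2)[OF h] d_ramp]
  have ramp_lip: "\<bar>ramp \<epsilon> x - ramp \<epsilon> y\<bar> \<le> 1 * \<bar>x - y\<bar>" for x y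
    by (rule lipschitz_of_deriv_bound[OF DERIV_ramp[OF e]]) (use w1 in simp)
  have bl_ramp': "bounded_lipschitz (\<lambda>x. ramp' \<epsilon> (\<sigma> * x))"
  proof (rule bounded_lipschitzI)
    show "\<bar>ramp' \<epsilon> (\<sigma> * x)\<bar> \<le> 1" for x using w1[of "\<sigma> * x"] by simp
    have "\<bar>ramp' \<epsilon> x - ramp' \<epsilon> y\<bar> \<le> (1 / \<epsilon>) * \<bar>x - y\<bar>" for x y
      by (rule lipschitz_of_deriv_bound[OF DERIV_ramp'[OF e]]) (use tent_nonneg[OF e] tent_le[OF e] in simp)
    from this[of "\<sigma> * _" "\<sigma> * _"] show "\<bar>ramp' \<epsilon> (\<sigma> * x) - ramp' \<epsilon> (\<sigma> * y)\<bar> \<le> (1 / \<epsilon>) * \<bar>x - y\<bar>" for x y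
      unfolding \<sigma>_abs .
  qed
  have bl_tent: "bounded_lipschitz (\<lambda>x. tent \<epsilon> (\<sigma> * x))"
  proof (rule bounded_lipschitzI)
    show "\<bar>tent \<epsilon> (\<sigma> * x)\<bar> \<le> 1 / \<epsilon>" for x using tent_nonneg[OF e] tent_le[OF e] by simp
    show "\<bar>tent \<epsilon> (\<sigma> * x) - tent \<epsilon> (\<sigma> * y)\<bar> \<le> 1 / \<epsilon>\<^sup>2 * \<bar>x - y\<bar>" for x y
      using tent_lipschitz[OF e, of "\<sigma> * x" "\<sigma> * y"] unfolding \<sigma>_abs .
  qed
  have C0: "0 \<le> C" by (rule half_line_testD(7)[OF h])
  have bl_g': "bounded_lipschitz (\<lambda>x. g' (ramp \<epsilon> (\<sigma> * x)))"
  proof (rule bounded_lipschitzI)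
    show "\<bar>g' (ramp \<epsilon> (\<sigma> * x))\<bar> \<le> C" for x by (rule half_line_testD(4)[OF h w0])
    have "\<bar>g'' (ramp \<epsilon> (\<sigma> * x)) * (ramp' \<epsilon> (\<sigma> * x) * \<sigma>)\<bar> \<le> C * 1" for x
      unfolding abs_mult using half_line_testD(5)[OF h w0] w1[of "\<sigma> * x"] \<sigma> C0 by (intro mult_mono) auto
    from lipschitz_of_deriv_bound[OF d_g' this]
    show "\<bar>g' (ramp \<epsilon> (\<sigma> * x)) - g' (ramp \<epsilon> (\<sigma> * y))\<bar> \<le> C * 1 * \<bar>x - y\<bar>" for x y .
  qed
  have bl_g'': "bounded_lipschitz (\<lambda>x. g'' (ramp \<epsilon> (\<sigma> * x)))"
  proof (rule bounded_lipschitzI)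
    show "\<bar>g'' (ramp \<epsilon> (\<sigma> * x))\<bar> \<le> C" for x by (rule half_line_testD(5)[OF h w0])
    show "\<bar>g'' (ramp \<epsilon> (\<sigma> * x)) - g'' (ramp \<epsilon> (\<sigma> * y))\<bar> \<le> C * \<bar>x - y\<bar>" for x y
    proof -
      have "\<bar>g'' (ramp \<epsilon> (\<sigma> * x)) - g'' (ramp \<epsilon> (\<sigma> * y))\<bar> \<le> C * \<bar>ramp \<epsilon> (\<sigma> * x) - ramp \<epsilon> (\<sigma> * y)\<bar>"
        by (rule half_line_testD(6)[OF h w0 w0])
      also have "\<dots> \<le> C * \<bar>x - y\<bar>"
        using ramp_lip[of "\<sigma> * x" "\<sigma> * y"] C0 unfolding \<sigma>_abs by (intro mult_left_mono) auto
      finally show ?thesis .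
    qed
  qed
  show ?thesis
  proof (rule test_function_ex)
    show "((\<lambda>x. g (ramp \<epsilon> (\<sigma> * x))) has_real_derivative \<sigma> * (g' (ramp \<epsilon> (\<sigma> * x)) * ramp' \<epsilon> (\<sigma> * x))) (at x)" for x
      using d_g[of x] by (simp add: mult_ac)
    show "((\<lambda>x. \<sigma> * (g' (ramp \<epsilon> (\<sigma> * x)) * ramp' \<epsilon> (\<sigma> * x))) has_real_derivative
        g'' (ramp \<epsilon> (\<sigma> * x)) * (ramp' \<epsilon> (\<sigma> * x) * ramp' \<epsilon> (\<sigma> * x)) + g' (ramp \<epsilon> (\<sigma> * x)) * tent \<epsilon> (\<sigma> * x)) (at x)" for x
    proof -
      have "((\<lambda>x. \<sigma> * (g' (ramp \<epsilon> (\<sigma> * x)) * ramp' \<epsilon> (\<sigma> * x))) has_real_derivative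
        \<sigma> * (g'' (ramp \<epsilon> (\<sigma> * x)) * (ramp' \<epsilon> (\<sigma> * x) * \<sigma>) * ramp' \<epsilon> (\<sigma> * x) + tent \<epsilon> (\<sigma> * x) * \<sigma> * g' (ramp \<epsilon> (\<sigma> * x)))) (at x)"
        by (rule DERIV_cmult[OF DERIV_mult[OF d_g' d_ramp']])
      moreover have "\<sigma> * (a * (p * \<sigma>) * p + k * \<sigma> * c) = a * (p * p) + c * k" for a p k c
      proof -
        have "\<sigma> * (a * (p * \<sigma>) * p + k * \<sigma> * c) = \<sigma> * (\<sigma> * (a * (p * p) + c * k))" by (simp add: algebra_simps)
        then show ?thesis by (simp only: \<sigma>2)
      qed
      ultimately show ?thesis by simp
    qed
    show "\<bar>g (ramp \<epsilon> (\<sigma> * x))\<bar> \<le> C" for x by (rule half_line_testD(3)[OF h w0])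
    show "bounded_lipschitz (\<lambda>x. \<sigma> * (g' (ramp \<epsilon> (\<sigma> * x)) * ramp' \<epsilon> (\<sigma> * x)))"
      by (intro bounded_lipschitz_mult bounded_lipschitz_const bl_g' bl_ramp')
    show "bounded_lipschitz (\<lambda>x. g'' (ramp \<epsilon> (\<sigma> * x)) * (ramp' \<epsilon> (\<sigma> * x) * ramp' \<epsilon> (\<sigma> * x)) + g' (ramp \<epsilon> (\<sigma> * x)) * tent \<epsilon> (\<sigma> * x))"
      by (intro bounded_lipschitz_add bounded_lipschitz_mult bl_g'' bl_ramp' bl_g' bl_tent)
  qed
qed

lemma test_function_add:
  assumes f: "test_function C f f' f''" and g: "test_function D g g' g''"
  shows "test_function (C + D) (\<lambda>x. f x + g x) (\<lambda>x. f' x + g' x) (\<lambda>x. f'' x + g'' x)"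
proof -
  have add: "\<bar>p + q\<bar> \<le> P + Q" if "\<bar>p\<bar> \<le> P" "\<bar>q\<bar> \<le> Q" for p q P Q :: real
    using abs_triangle_ineq[of p q] that by linarith
  have "\<bar>f'' x + g'' x - (f'' y + g'' y)\<bar> \<le> (C + D) * \<bar>x - y\<bar>" for x y
    using add[OF test_functionD(6)[OF f, of x y] test_functionD(6)[OF g, of x y]]
    by (simp only: distrib_right add_diff_add)
  moreover note add[OF test_functionD(3)[OF f] test_functionD(3)[OF g]] add[OF test_functionD(4)[OF f] test_functionD(4)[OF g]]
    add[OF test_functionD(5)[OF f] test_functionD(5)[OF g]]
  ultimately show ?thesis unfolding test_function_def
    using DERIV_add[OF test_functionD(1)[OF f] test_functionD(1)[OF g]] DERIV_add[OF test_functionD(2)[OF f] test_functionD(2)[OF g]]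
    by blast
qed

lemma exp_half_line_test:
  assumes "0 \<le> r"
  shows "half_line_test (max 1 r ^ 3) (\<lambda>x. exp (- r * x)) (\<lambda>x. - r * exp (- r * x)) (\<lambda>x. r\<^sup>2 * exp (- r * x))"
proof -
  define C where "C = max 1 r ^ 3"
  have r: "1 \<le> C" "r \<le> C" "r\<^sup>2 \<le> C" "r ^ 3 \<le> C"
  proof -
    have m: "1 \<le> max 1 r" by simp
    then show "1 \<le> C" unfolding C_def by (rule one_le_power)
    have "r \<le> max 1 r ^ 1" by simp
    also have "\<dots> \<le> C" unfolding C_def using m by (intro power_increasing) auto
    finally show "r \<le> C" .
    have "r\<^sup>2 \<le> max 1 r ^ 2" using assms by (intro power_mono) auto
    also have "\<dots> \<le> C" unfolding C_def using m by (intro power_increasing) auto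
    finally show "r\<^sup>2 \<le> C" .
    show "r ^ 3 \<le> C" unfolding C_def using assms by (intro power_mono) auto
  qed
  have e: "exp (- r * x) \<le> 1" if "0 \<le> x" for x using that assms by simp
  have sc: "\<bar>k * exp (- r * x)\<bar> \<le> C" if "0 \<le> x" "\<bar>k\<bar> \<le> C" for k x
    using mult_mono[OF that(2) e[OF that(1)]] r(1) by (simp add: abs_mult)
  have lip: "\<bar>r\<^sup>2 * exp (- r * x) - r\<^sup>2 * exp (- r * y)\<bar> \<le> C * \<bar>x - y\<bar>" if xy: "0 \<le> x" "0 \<le> y" for x y
  proof -
    have "\<exists>z. min x y \<le> z \<and> z \<le> max x y \<and> r\<^sup>2 * exp (- r * y) - r\<^sup>2 * exp (- r * x) = (- (r ^ 3) * exp (- r * z)) * (y - x)"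
      by (rule real_mvt) (auto intro!: derivative_eq_intros simp: power2_eq_square power3_eq_cube)
    then obtain z where z: "min x y \<le> z" "r\<^sup>2 * exp (- r * y) - r\<^sup>2 * exp (- r * x) = (- (r ^ 3) * exp (- r * z)) * (y - x)" by blast
    have "0 \<le> z" using z(1) xy by linarith
    then have "\<bar>- (r ^ 3) * exp (- r * z)\<bar> \<le> C" using r(4) assms by (intro sc) auto
    then have "\<bar>r\<^sup>2 * exp (- r * y) - r\<^sup>2 * exp (- r * x)\<bar> \<le> C * \<bar>y - x\<bar>"
      unfolding z(2) abs_mult[of _ "y - x"] by (intro mult_right_mono) auto
    then show ?thesis by (simp only: abs_minus_commute)
  qed
  show ?thesis unfolding half_line_test_def C_def[symmetric]
  proof (intro conjI allI impI)
    fix x :: real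
    show "((\<lambda>x. exp (- r * x)) has_real_derivative - r * exp (- r * x)) (at x)"
      by (auto intro!: derivative_eq_intros)
    show "((\<lambda>x. - r * exp (- r * x)) has_real_derivative r\<^sup>2 * exp (- r * x)) (at x)"
      by (auto intro!: derivative_eq_intros simp: power2_eq_square)
    assume x: "0 \<le> x"
    show "\<bar>exp (- r * x)\<bar> \<le> C" using sc[OF x, of 1] r by simp
    show "\<bar>- r * exp (- r * x)\<bar> \<le> C" using r assms by (intro sc[OF x]) auto
    show "\<bar>r\<^sup>2 * exp (- r * x)\<bar> \<le> C" using r assms by (intro sc[OF x]) auto
    show "\<bar>r\<^sup>2 * exp (- r * x) - r\<^sup>2 * exp (- r * y)\<bar> \<le> C * \<bar>x - y\<bar>" if "0 \<le> y" for y
      by (rule lip[OF x that])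
  qed
qed

context prob_space begin

text \<open>Bounded second moments imply uniform integrability. The proof truncates at level \<open>k\<close>; the error
  is at most \<open>C / k\<close> because \<open>h - min h k \<le> h\<^sup>2 / k\<close>.\<close>

lemma expectation_tendsto_of_second_moment:
  fixes f :: "nat \<Rightarrow> 'a \<Rightarrow> real" and g :: "'a \<Rightarrow> real"
  assumes f: "\<And>n. f n \<in> borel_measurable M" "\<And>n. AE \<omega> in M. 0 \<le> f n \<omega>" and g: "g \<in> borel_measurable M"
    and lim: "AE \<omega> in M. (\<lambda>n. f n \<omega>) \<longlonglongrightarrow> g \<omega>"
    and sq: "\<And>n. integrable M (\<lambda>\<omega>. (f n \<omega>)\<^sup>2)" "\<And>n. expectation (\<lambda>\<omega>. (f n \<omega>)\<^sup>2) \<le> C"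
  shows "integrable M g" "(\<lambda>n. expectation (f n)) \<longlonglongrightarrow> expectation g"
proof -
  note [measurable] = f(1) g
  have C0: "0 \<le> C" by (rule order_trans[OF _ sq(2)[of 0]]) simp
  have g_sq: "(\<integral>\<^sup>+\<omega>. ennreal ((g \<omega>)\<^sup>2) \<partial>M) \<le> ennreal C"
  proof -
    have "(\<integral>\<^sup>+\<omega>. ennreal ((g \<omega>)\<^sup>2) \<partial>M) = (\<integral>\<^sup>+\<omega>. liminf (\<lambda>n. ennreal ((f n \<omega>)\<^sup>2)) \<partial>M)"
    proof (rule nn_integral_cong_AE)
      show "AE \<omega> in M. ennreal ((g \<omega>)\<^sup>2) = liminf (\<lambda>n. ennreal ((f n \<omega>)\<^sup>2))"
        using lim by eventually_elim
          (intro lim_imp_Liminf[symmetric] tendsto_ennrealI tendsto_power, auto)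
    qed
    also have "\<dots> \<le> liminf (\<lambda>n. \<integral>\<^sup>+\<omega>. ennreal ((f n \<omega>)\<^sup>2) \<partial>M)" by (intro nn_integral_liminf) measurable
    also have "\<dots> \<le> liminf (\<lambda>n. ennreal C)"
      using sq by (intro Liminf_mono always_eventually allI) (subst nn_integral_eq_integral, auto intro!: ennreal_leI)
    finally show ?thesis by (simp add: Liminf_const)
  qed
  have g2: "integrable M (\<lambda>\<omega>. (g \<omega>)\<^sup>2)"
    by (rule integrableI_nonneg) (use g_sq in \<open>auto simp: order_le_less_trans\<close>)
  have g2C: "expectation (\<lambda>\<omega>. (g \<omega>)\<^sup>2) \<le> C"
    using g_sq C0 by (subst (asm) nn_integral_eq_integral[OF g2]) auto
  have int_of_sq: "integrable M h" if "integrable M (\<lambda>\<omega>. (h \<omega>)\<^sup>2)" "h \<in> borel_measurable M" for h :: "'a \<Rightarrow> real"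
  proof (rule Bochner_Integration.integrable_bound)
    show "integrable M (\<lambda>\<omega>. 1 + (h \<omega>)\<^sup>2)" using that by simp
    have "\<bar>y\<bar> \<le> 1 + y\<^sup>2" for y :: real
    proof -
      have "0 \<le> (\<bar>y\<bar> - 1)\<^sup>2" by simp
      then show ?thesis by (simp add: power2_diff)
    qed
    then show "AE \<omega> in M. norm (h \<omega>) \<le> norm (1 + (h \<omega>)\<^sup>2)" by (intro AE_I2) (simp add: abs_of_nonneg)
  qed (rule that)
  show gi: "integrable M g" by (rule int_of_sq[OF g2 g])
  have fi: "integrable M (f n)" for n by (rule int_of_sq[OF sq(1) f(1)])
  have tail: "\<bar>expectation h - expectation (\<lambda>\<omega>. min (h \<omega>) k)\<bar> \<le> C / k"
    if h: "integrable M h" "integrable M (\<lambda>\<omega>. (h \<omega>)\<^sup>2)" "expectation (\<lambda>\<omega>. (h \<omega>)\<^sup>2) \<le> C" "h \<in> borel_measurable M" and k: "0 < k" for h k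
  proof -
    note [measurable] = h(4)
    have mi: "integrable M (\<lambda>\<omega>. min (h \<omega>) k)"
      using h(1) by (intro integrable_min) auto
    have "expectation h - expectation (\<lambda>\<omega>. min (h \<omega>) k) = expectation (\<lambda>\<omega>. h \<omega> - min (h \<omega>) k)"
      using h(1) mi by simp
    also have "\<bar>\<dots>\<bar> \<le> expectation (\<lambda>\<omega>. (h \<omega>)\<^sup>2 / k)"
    proof (rule abs_integral_le)
      fix \<omega>
      show "\<bar>h \<omega> - min (h \<omega>) k\<bar> \<le> (h \<omega>)\<^sup>2 / k"
      proof (cases "h \<omega> \<le> k")
        case False
        then have "h \<omega> * k \<le> (h \<omega>)\<^sup>2" using k unfolding power2_eq_square by (intro mult_left_mono) auto
        then have "h \<omega> \<le> (h \<omega>)\<^sup>2 / k" using k by (simp add: pos_le_divide_eq)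
        then show ?thesis using False k by simp
      qed (use k in simp)
    qed (use h mi in auto)
    also have "\<dots> \<le> C / k" using h(3) k by (simp add: divide_right_mono)
    finally show ?thesis .
  qed
  show "(\<lambda>n. expectation (f n)) \<longlonglongrightarrow> expectation g"
  proof (rule LIMSEQ_I)
    fix e :: real assume e: "0 < e"
    \<comment> \<open>With this level the two truncation errors add up to at most \<open>e/2\<close>.\<close>
    define k where "k = 4 * (C + 1) / e"
    have k: "0 < k" "C / k \<le> e / 4" using e C0 by (auto simp: k_def field_simps)
    have "(\<lambda>n. expectation (\<lambda>\<omega>. min (f n \<omega>) k)) \<longlonglongrightarrow> expectation (\<lambda>\<omega>. min (g \<omega>) k)"
    proof (rule integral_dominated_convergence[where w = "\<lambda>_. k"])
      show "AE \<omega> in M. (\<lambda>n. min (f n \<omega>) k) \<longlonglongrightarrow> min (g \<omega>) k"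
        using lim by eventually_elim (intro tendsto_min tendsto_const)
      show "AE \<omega> in M. norm (min (f n \<omega>) k) \<le> k" for n
        using f(2)[of n] by eventually_elim (use k(1) in \<open>simp add: abs_of_nonneg\<close>)
    qed auto
    then have "\<forall>\<^sub>F n in sequentially. dist (expectation (\<lambda>\<omega>. min (f n \<omega>) k)) (expectation (\<lambda>\<omega>. min (g \<omega>) k)) < e / 2"
      using e by (intro tendstoD) auto
    then have "\<forall>\<^sub>F n in sequentially. norm (expectation (f n) - expectation g) < e"
    proof eventually_elim
      case (elim n)
      then show ?case
        using tail[OF fi sq f(1) k(1), of n] tail[OF gi g2 g2C g k(1)] k(2)
        unfolding dist_real_def real_norm_def by linarith
    qed
    then show "\<exists>no. \<forall>n\<ge>no. norm (expectation (f n) - expectation g) < e" by (simp add: eventually_sequentially)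
  qed
qed

end

section \<open>The mean local time\<close>

lemma square_of_time_integral:
  fixes f :: "real \<Rightarrow> real"
  assumes f: "continuous_on UNIV f" and t: "0 \<le> t"
  defines "F \<equiv> \<lambda>s. LBINT r:{0..s}. f r"
  shows "(F t)\<^sup>2 = 2 * (LBINT s:{0..t}. f s * (F t - F s))"
proof -
  have cont: "continuous_on {a..b} f" for a b by (rule continuous_on_subset[OF f]) simp
  have F_eq: "F s = integral {0..s} f" for s
    unfolding F_def by (rule set_borel_integral_eq_integral(2)[OF borel_integrable_atLeastAtMost'[OF cont]])
  have dF: "(F has_vector_derivative f s) (at s within {0..t})" if "s \<in> {0..t}" for s
    unfolding F_eq[abs_def] by (rule integral_has_vector_derivative[OF cont that])
  have "continuous_on {0..t} F"
    by (rule continuous_on_vector_derivative) (rule dF)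
  then have c2: "continuous_on {0..t} (\<lambda>s. f s * (F t - F s))" using cont by (intro continuous_intros)
  have "((\<lambda>s. 2 * (f s * (F t - F s))) has_integral (- (F t - F t)\<^sup>2 - (- (F t - F 0)\<^sup>2))) {0..t}"
  proof (rule fundamental_theorem_of_calculus[OF t])
    fix s assume s: "s \<in> {0..t}"
    have "(F has_real_derivative f s) (at s within {0..t})"
      using dF[OF s] by (simp add: has_real_derivative_iff_has_vector_derivative)
    then have "((\<lambda>s. - (F t - F s)\<^sup>2) has_real_derivative 2 * (f s * (F t - F s))) (at s within {0..t})"
      by (auto intro!: derivative_eq_intros)
    then show "((\<lambda>s. - (F t - F s)\<^sup>2) has_vector_derivative 2 * (f s * (F t - F s))) (at s within {0..t})"
      by (simp add: has_real_derivative_iff_has_vector_derivative)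
  qed
  moreover have "F 0 = 0" by (simp add: F_eq)
  ultimately have "((\<lambda>s. 2 * (f s * (F t - F s))) has_integral (F t)\<^sup>2) {0..t}" by simp
  from integral_unique[OF this]
  have "2 * integral {0..t} (\<lambda>s. f s * (F t - F s)) = (F t)\<^sup>2" by (simp only: integral_mult_right)
  then show ?thesis
    using set_borel_integral_eq_integral(2)[OF borel_integrable_atLeastAtMost'[OF c2]] by simp
qed

lemma (in prob_space) expectation_time_integral:
  fixes F :: "real \<Rightarrow> 'a \<Rightarrow> real"
  assumes F: "(\<lambda>p. F (fst p) (snd p)) \<in> borel_measurable (borel \<Otimes>\<^sub>M M)"
    and bound: "\<And>s \<omega>. \<omega> \<in> space M \<Longrightarrow> \<bar>F s \<omega>\<bar> \<le> C"
    and w: "integrable lborel w"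
  shows "expectation (\<lambda>\<omega>. \<integral>s. w s * F s \<omega> \<partial>lborel) = (\<integral>s. w s * expectation (F s) \<partial>lborel)"
    and "integrable lborel (\<lambda>s. w s * expectation (F s))"
    and "integrable M (\<lambda>\<omega>. \<integral>s. w s * F s \<omega> \<partial>lborel)"
proof -
  interpret P: pair_sigma_finite lborel M by standard
  have [measurable]: "w \<in> borel_measurable borel" using w by auto
  have F': "(\<lambda>p. w (fst p) * F (fst p) (snd p)) \<in> borel_measurable (lborel \<Otimes>\<^sub>M M)"
  proof -
    have "(\<lambda>p. F (fst p) (snd p)) \<in> borel_measurable (lborel \<Otimes>\<^sub>M M)"
      using F by (simp cong: measurable_cong_sets sets_pair_measure_cong)
    then show ?thesis by measurable
  qed
  have "integrable (lborel \<Otimes>\<^sub>M M) (\<lambda>p. w (fst p) * C)"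
  proof -
    have m: "(\<lambda>p. w (fst p) * C) \<in> borel_measurable (lborel \<Otimes>\<^sub>M M)" by measurable
    show ?thesis
      by (rule P.Fubini_integrable[OF m]) (use w in \<open>auto simp: prob_space abs_mult\<close>)
  qed
  then have int: "integrable (lborel \<Otimes>\<^sub>M M) (\<lambda>(s, \<omega>). w s * F s \<omega>)"
    unfolding case_prod_beta
  proof (rule Bochner_Integration.integrable_bound[OF _ F'], intro AE_I2)
    fix p :: "real \<times> 'a" assume "p \<in> space (lborel \<Otimes>\<^sub>M M)"
    then have "\<bar>F (fst p) (snd p)\<bar> \<le> \<bar>C\<bar>" using bound[of "snd p" "fst p"] by (auto simp: space_pair_measure)
    then show "norm (w (fst p) * F (fst p) (snd p)) \<le> norm (w (fst p) * C)"
      unfolding real_norm_def abs_mult by (intro mult_left_mono) auto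
  qed
  show "expectation (\<lambda>\<omega>. \<integral>s. w s * F s \<omega> \<partial>lborel) = (\<integral>s. w s * expectation (F s) \<partial>lborel)"
    using P.Fubini_integral[OF int] by simp
  show "integrable lborel (\<lambda>s. w s * expectation (F s))" using P.integrable_fst[OF int] by simp
  show "integrable M (\<lambda>\<omega>. \<integral>s. w s * F s \<omega> \<partial>lborel)" using P.integrable_snd[OF int] by simp
qed

lemma tent_measurable [measurable]: "tent \<epsilon> \<in> borel_measurable borel"
  unfolding tent_def[abs_def] plus_pow_def by measurable

lemma tent_continuous: "0 < \<epsilon> \<Longrightarrow> continuous_on UNIV (tent \<epsilon>)"
  by (rule continuous_of_lipschitz[OF tent_lipschitz])

context skew_bm begin

lemma time_integral_integrable:
  fixes f :: "real \<Rightarrow> real"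
  assumes "f \<in> borel_measurable borel" "\<And>y. \<bar>f y\<bar> \<le> C" "s \<le> t"
    and Z: "Z \<in> borel_measurable M" "\<And>\<omega>. \<bar>Z \<omega>\<bar> \<le> c"
  shows "integrable M (\<lambda>\<omega>. Z \<omega> * (LBINT r:{s..t}. f (x r \<omega>)))"
proof (rule integrable_const_bound[where B = "c * (C * (t - s))"])
  have c: "0 \<le> c" using order_trans[OF abs_ge_zero Z(2)] by blast
  show "AE \<omega> in M. norm (Z \<omega> * (LBINT r:{s..t}. f (x r \<omega>))) \<le> c * (C * (t - s))"
    unfolding real_norm_def abs_mult using time_integral_bound[OF assms(1-3)] Z(2) c
    by (intro AE_I2 mult_mono) auto
  show "(\<lambda>\<omega>. Z \<omega> * (LBINT r:{s..t}. f (x r \<omega>))) \<in> borel_measurable M"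
    by (intro borel_measurable_times Z(1) time_integral_measurable assms(1))
qed

text \<open>Ito's formula is applied to an even function, whose derivative vanishes at \<open>0\<close>, so that the local time
  does not enter. Its generator is at most a constant minus a multiple of the tent, while the function itself
  has values in \<open>[0, 2]\<close>. The weight \<open>Z\<close> makes this a conditional estimate given the past.\<close>

lemma tent_conditional_bound:
  assumes e: "0 < \<epsilon>" "\<epsilon> \<le> 1" and st: "0 \<le> s" "s < t"
    and Z: "Z \<in> borel_measurable (\<F> s)" "\<And>\<omega>. 0 \<le> Z \<omega>" "\<And>\<omega>. Z \<omega> \<le> c"
  shows "expectation (\<lambda>\<omega>. Z \<omega> * (LBINT r:{s..t}. tent \<epsilon> (x r \<omega>)))
    \<le> exp 1 * (2 + (2 * drift_sup + 1) * (t - s)) * expectation Z"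
proof -
  define g g' g'' :: "real \<Rightarrow> real" where "g = (\<lambda>x. exp (- 1 * x))" and "g' = (\<lambda>x. - 1 * exp (- 1 * x))"
    and "g'' = (\<lambda>x. 1\<^sup>2 * exp (- 1 * x))"
  have h: "half_line_test (max 1 1 ^ 3) g g' g''"
    unfolding g_def g'_def g''_def by (rule exp_half_line_test) simp
  obtain D1 D2 where T: "test_function D1 (\<lambda>x. g (ramp \<epsilon> (1 * x))) (\<lambda>x. 1 * (g' (ramp \<epsilon> (1 * x)) * ramp' \<epsilon> (1 * x)))
      (\<lambda>x. g'' (ramp \<epsilon> (1 * x)) * (ramp' \<epsilon> (1 * x) * ramp' \<epsilon> (1 * x)) + g' (ramp \<epsilon> (1 * x)) * tent \<epsilon> (1 * x))"
    "test_function D2 (\<lambda>x. g (ramp \<epsilon> (- 1 * x))) (\<lambda>x. - 1 * (g' (ramp \<epsilon> (- 1 * x)) * ramp' \<epsilon> (- 1 * x)))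
      (\<lambda>x. g'' (ramp \<epsilon> (- 1 * x)) * (ramp' \<epsilon> (- 1 * x) * ramp' \<epsilon> (- 1 * x)) + g' (ramp \<epsilon> (- 1 * x)) * tent \<epsilon> (- 1 * x))"
    using ramp_test[OF h e(1), of 1] ramp_test[OF h e(1), of "- 1"] by blast
  define \<phi> \<phi>' \<phi>'' where "\<phi> = (\<lambda>x. g (ramp \<epsilon> (1 * x)) + g (ramp \<epsilon> (- 1 * x)))"
    and "\<phi>' = (\<lambda>x. 1 * (g' (ramp \<epsilon> (1 * x)) * ramp' \<epsilon> (1 * x)) + - 1 * (g' (ramp \<epsilon> (- 1 * x)) * ramp' \<epsilon> (- 1 * x)))"
    and "\<phi>'' = (\<lambda>x. (g'' (ramp \<epsilon> (1 * x)) * (ramp' \<epsilon> (1 * x) * ramp' \<epsilon> (1 * x)) + g' (ramp \<epsilon> (1 * x)) * tent \<epsilon> (1 * x))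
       + (g'' (ramp \<epsilon> (- 1 * x)) * (ramp' \<epsilon> (- 1 * x) * ramp' \<epsilon> (- 1 * x)) + g' (ramp \<epsilon> (- 1 * x)) * tent \<epsilon> (- 1 * x)))"
  have tf: "test_function (D1 + D2) \<phi> \<phi>' \<phi>''"
    unfolding \<phi>_def \<phi>'_def \<phi>''_def by (rule test_function_add[OF T])
  have exp01: "0 \<le> exp (- ramp \<epsilon> y)" "exp (- ramp \<epsilon> y) \<le> 1" for y using ramp_nonneg[OF e(1), of y] by auto
  have \<phi>_bounds: "0 \<le> \<phi> y" "\<phi> y \<le> 2" for y
  proof -
    have "\<phi> y = exp (- ramp \<epsilon> y) + exp (- ramp \<epsilon> (- y))" by (simp add: \<phi>_def g_def)
    then show "0 \<le> \<phi> y" "\<phi> y \<le> 2" using exp01[of y] exp01[of "- y"] by linarith+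
  qed
  have "\<phi>' 0 = 0" by (simp add: \<phi>'_def)
  have gen_bound: "gen \<phi>' \<phi>'' y \<le> (2 * drift_sup + 1) - exp (- 1) * tent \<epsilon> y" for y
  proof -
    define p q u v where "p = ramp' \<epsilon> y" and "q = ramp' \<epsilon> (- y)" and "u = exp (- ramp \<epsilon> y)" and "v = exp (- ramp \<epsilon> (- y))"
    have pq: "0 \<le> p" "p \<le> 1" "0 \<le> q" "q \<le> 1" using ramp'_bounds[OF e(1)] by (auto simp: p_def q_def)
    have uv: "0 \<le> u" "u \<le> 1" "0 \<le> v" "v \<le> 1" using exp01 by (auto simp: u_def v_def)
    have one: "u * p \<le> 1" "v * q \<le> 1" "u * (p * p) \<le> 1" "v * (q * q) \<le> 1" "0 \<le> u * p" "0 \<le> v * q"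
      using pq uv by (auto intro!: mult_le_one)
    have two: "\<bar>v * q - u * p\<bar> \<le> 2" using one by linarith
    have "\<bar>drift y * (v * q - u * p)\<bar> \<le> drift_sup * 2"
      unfolding abs_mult by (rule mult_mono[OF drift_coeff_bound two]) auto
    then have d: "drift y * (v * q - u * p) \<le> drift_sup * 2" by linarith
    \<comment> \<open>On the support of the tent both ramps are at most \<open>1\<close>, so their exponentials are at least \<open>exp (- 1)\<close>.\<close>
    have t: "2 * (exp (- 1) * tent \<epsilon> y) \<le> u * tent \<epsilon> y + v * tent \<epsilon> y"
    proof (cases "\<bar>y\<bar> < \<epsilon>")
      case True
      then have "y \<le> \<epsilon>" "- y \<le> \<epsilon>" by auto
      then have "ramp \<epsilon> y \<le> 1" "ramp \<epsilon> (- y) \<le> 1"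
        using ramp_le[OF e(1), of y] ramp_le[OF e(1), of "- y"] e(2) by linarith+
      then have "exp (- 1) \<le> u" "exp (- 1) \<le> v" by (auto simp: u_def v_def)
      then have "exp (- 1) * tent \<epsilon> y \<le> u * tent \<epsilon> y" "exp (- 1) * tent \<epsilon> y \<le> v * tent \<epsilon> y"
        using tent_nonneg[OF e(1), of y] by (auto intro: mult_right_mono)
      then show ?thesis by linarith
    qed (simp add: tent_outside[OF e(1)])
    have gen_eq: "gen \<phi>' \<phi>'' y = drift y * (v * q - u * p) + (u * (p * p) + v * (q * q) - (u * tent \<epsilon> y + v * tent \<epsilon> y)) / 2"
      by (simp add: \<phi>'_def \<phi>''_def g'_def g''_def u_def v_def p_def q_def tent_minus[OF e(1)] algebra_simps)
    have arith: "A + (B' - C') / 2 \<le> 2 * k + 1 - E" if "A \<le> k * 2" "B' \<le> 2" "2 * E \<le> C'" for A B' C' k E :: real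
      using that by (simp add: field_simps)
    have "u * (p * p) + v * (q * q) \<le> 2" using one by linarith
    then show ?thesis unfolding gen_eq by (rule arith[OF d _ t])
  qed
  note [measurable] = test_functionD(9-11)[OF tf, THEN borel_measurable_continuous_onI]
  have Zabs: "\<bar>Z \<omega>\<bar> \<le> c" for \<omega> using Z(2,3)[of \<omega>] by simp
  have ZM[measurable]: "Z \<in> borel_measurable M" by (rule measurable_filtration_M[OF Z(1) st(1)])
  have Z_int: "integrable M Z" by (rule integrable_const_bound[where B = c]) (use Zabs in auto)
  have gen_meas: "gen \<phi>' \<phi>'' \<in> borel_measurable borel" by measurable
  have gen_abs: "\<bar>gen \<phi>' \<phi>'' y\<bar> \<le> (drift_sup + 1) * (D1 + D2)" for y
  proof -
    have "\<bar>drift y * \<phi>' y\<bar> \<le> drift_sup * (D1 + D2)"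
      unfolding abs_mult using test_functionD(4,8)[OF tf] drift_coeff_bound by (intro mult_mono) auto
    moreover have "\<bar>p + q / 2\<bar> \<le> a + c" if "\<bar>p\<bar> \<le> a" "\<bar>q\<bar> \<le> c" for p q a c :: real
      using that by linarith
    ultimately have "\<bar>gen \<phi>' \<phi>'' y\<bar> \<le> drift_sup * (D1 + D2) + (D1 + D2)"
      using test_functionD(5)[OF tf, of y] by blast
    then show ?thesis by (simp only: distrib_right mult_1)
  qed
  have tent_abs: "\<bar>tent \<epsilon> y\<bar> \<le> 1 / \<epsilon>" for y using tent_nonneg[OF e(1), of y] tent_le[OF e(1), of y] by simp
  define TI where "TI \<omega> = (LBINT r:{s..t}. tent \<epsilon> (x r \<omega>))" for \<omega>
  define GI where "GI \<omega> = (LBINT r:{s..t}. gen \<phi>' \<phi>'' (x r \<omega>))" for \<omega>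
  have ZTI: "integrable M (\<lambda>\<omega>. Z \<omega> * TI \<omega>)" and ZGI: "integrable M (\<lambda>\<omega>. Z \<omega> * GI \<omega>)"
    unfolding TI_def GI_def
    by (rule time_integral_integrable[OF tent_measurable tent_abs less_imp_le[OF st(2)] ZM Zabs]
        time_integral_integrable[OF gen_meas gen_abs less_imp_le[OF st(2)] ZM Zabs])+
  have le: "GI \<omega> \<le> (2 * drift_sup + 1) * (t - s) - exp (- 1) * TI \<omega>" if w: "\<omega> \<in> space M" for \<omega>
  proof -
    note [measurable] = path_measurable[OF w]
    have i1: "set_integrable lborel {s..t} (\<lambda>r. gen \<phi>' \<phi>'' (x r \<omega>))"
      by (rule set_integrable_bounded_borel[where C = "(drift_sup + 1) * (D1 + D2)"]) (use gen_abs in auto)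
    have i2: "set_integrable lborel {s..t} (\<lambda>r. exp (- 1) * tent \<epsilon> (x r \<omega>))"
      using set_integrable_bounded_borel[of "\<lambda>r. tent \<epsilon> (x r \<omega>)" s t "1 / \<epsilon>"] tent_abs by auto
    have i3: "set_integrable lborel {s..t} (\<lambda>r. 2 * drift_sup + 1)"
      by (rule set_integrable_bounded_borel[where C = "2 * drift_sup + 1"]) auto
    have "GI \<omega> \<le> (LBINT r:{s..t}. (2 * drift_sup + 1) - exp (- 1) * tent \<epsilon> (x r \<omega>))"
      unfolding GI_def using gen_bound i1 i2 i3 by (intro set_integral_mono set_integral_diff(1)) auto
    also have "\<dots> = (LBINT r:{s..t}. 2 * drift_sup + 1) - exp (- 1) * TI \<omega>"
      unfolding TI_def by (subst set_integral_diff(2)[OF i3 i2]) simp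
    also have "(LBINT r:{s..t}. 2 * drift_sup + 1) = (2 * drift_sup + 1) * (t - s)"
      using st by (simp add: set_lebesgue_integral_def mult.commute)
    finally show ?thesis .
  qed
  have "- 2 * expectation Z \<le> expectation (\<lambda>\<omega>. Z \<omega> * (\<phi> (x t \<omega>) - \<phi> (x s \<omega>)))"
  proof -
    have "expectation (\<lambda>\<omega>. Z \<omega> * - 2) \<le> expectation (\<lambda>\<omega>. Z \<omega> * (\<phi> (x t \<omega>) - \<phi> (x s \<omega>)))"
    proof (rule integral_mono)
      show "integrable M (\<lambda>\<omega>. Z \<omega> * (\<phi> (x t \<omega>) - \<phi> (x s \<omega>)))"
      proof (rule Bochner_Integration.integrable_bound[OF integrable_mult_left[OF Z_int, of 2]])
        show "AE \<omega> in M. norm (Z \<omega> * (\<phi> (x t \<omega>) - \<phi> (x s \<omega>))) \<le> norm (Z \<omega> * 2)"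
        proof (rule AE_I2)
          fix \<omega>
          have "\<bar>\<phi> (x t \<omega>) - \<phi> (x s \<omega>)\<bar> \<le> 2"
            using \<phi>_bounds[of "x t \<omega>"] \<phi>_bounds[of "x s \<omega>"] by linarith
          then show "norm (Z \<omega> * (\<phi> (x t \<omega>) - \<phi> (x s \<omega>))) \<le> norm (Z \<omega> * 2)"
            by (simp add: abs_mult mult_left_mono)
        qed
      qed measurable
      show "Z \<omega> * - 2 \<le> Z \<omega> * (\<phi> (x t \<omega>) - \<phi> (x s \<omega>))" for \<omega>
        using \<phi>_bounds[of "x t \<omega>"] \<phi>_bounds[of "x s \<omega>"] Z(2)[of \<omega>] by (intro mult_left_mono) linarith+
    qed (use Z_int in simp)
    then show ?thesis by (simp add: mult.commute)
  qed
  also have "\<dots> = expectation (\<lambda>\<omega>. Z \<omega> * GI \<omega>)"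
    using ito_expectation[OF st tf Z(1) Zabs] \<open>\<phi>' 0 = 0\<close> by (simp add: GI_def)
  also have "\<dots> \<le> expectation (\<lambda>\<omega>. Z \<omega> * ((2 * drift_sup + 1) * (t - s)) - exp (- 1) * (Z \<omega> * TI \<omega>))"
  proof (rule integral_mono[OF ZGI])
    show "integrable M (\<lambda>\<omega>. Z \<omega> * ((2 * drift_sup + 1) * (t - s)) - exp (- 1) * (Z \<omega> * TI \<omega>))"
      using Z_int ZTI by (intro Bochner_Integration.integrable_diff integrable_mult_left integrable_mult_right)
    fix \<omega> assume "\<omega> \<in> space M"
    from mult_left_mono[OF le[OF this] Z(2)[of \<omega>]]
    show "Z \<omega> * GI \<omega> \<le> Z \<omega> * ((2 * drift_sup + 1) * (t - s)) - exp (- 1) * (Z \<omega> * TI \<omega>)"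
      by (simp only: right_diff_distrib mult.left_commute)
  qed
  also have "\<dots> = expectation Z * ((2 * drift_sup + 1) * (t - s)) - exp (- 1) * expectation (\<lambda>\<omega>. Z \<omega> * TI \<omega>)"
    using Z_int ZTI by simp
  finally have "exp (- 1) * expectation (\<lambda>\<omega>. Z \<omega> * TI \<omega>) \<le> (2 + (2 * drift_sup + 1) * (t - s)) * expectation Z"
    by (simp add: algebra_simps)
  then have "exp 1 * (exp (- 1) * expectation (\<lambda>\<omega>. Z \<omega> * TI \<omega>)) \<le> exp 1 * ((2 + (2 * drift_sup + 1) * (t - s)) * expectation Z)"
    by (rule mult_left_mono) simp
  then show ?thesis by (simp add: TI_def mult.assoc[symmetric] exp_minus)
qed

definition "tent_time \<epsilon> t \<omega> = (LBINT r:{0..t}. tent \<epsilon> (x r \<omega>))"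

lemma tent_abs: "0 < \<epsilon> \<Longrightarrow> \<bar>tent \<epsilon> y\<bar> \<le> 1 / \<epsilon>"
  using tent_nonneg[of \<epsilon> y] tent_le[of \<epsilon> y] by simp

lemma tent_time_measurable [measurable]: "tent_time \<epsilon> t \<in> borel_measurable M"
  unfolding tent_time_def[abs_def] by (rule time_integral_measurable) measurable

lemma tent_time_bounds:
  assumes "0 < \<epsilon>" "0 \<le> t" "\<omega> \<in> space M"
  shows "0 \<le> tent_time \<epsilon> t \<omega>" "tent_time \<epsilon> t \<omega> \<le> t / \<epsilon>"
proof -
  show "0 \<le> tent_time \<epsilon> t \<omega>"
    unfolding tent_time_def set_lebesgue_integral_def using tent_nonneg[OF assms(1)] by (intro Bochner_Integration.integral_nonneg) simp
  show "tent_time \<epsilon> t \<omega> \<le> t / \<epsilon>"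
    using time_integral_bound[OF tent_measurable tent_abs[OF assms(1)] assms(2,3)] by (simp add: tent_time_def)
qed

lemma tent_time_diff:
  assumes "0 < \<epsilon>" "0 \<le> s" "s \<le> t" "\<omega> \<in> space M"
  shows "tent_time \<epsilon> t \<omega> - tent_time \<epsilon> s \<omega> = (LBINT r:{s..t}. tent \<epsilon> (x r \<omega>))"
proof -
  note [measurable] = path_measurable[OF assms(4)]
  show ?thesis
    unfolding tent_time_def
    by (subst set_integral_additive[OF _ _ assms(2,3), of _ "1 / \<epsilon>"]) (use tent_abs[OF assms(1)] in auto)
qed

lemma tent_time_joint:
  "(\<lambda>p. tent_time \<epsilon> (fst p) (snd p)) \<in> borel_measurable (borel \<Otimes>\<^sub>M M)"
proof -
  have 1: "(\<lambda>z. (snd z, snd (fst z))) \<in> measurable ((borel \<Otimes>\<^sub>M M) \<Otimes>\<^sub>M lborel) (borel \<Otimes>\<^sub>M M)" by measurable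
  have [measurable]: "(\<lambda>z. x (snd z) (snd (fst z))) \<in> borel_measurable ((borel \<Otimes>\<^sub>M M) \<Otimes>\<^sub>M lborel)"
    using measurable_compose[OF 1 x_joint] by simp
  have "(\<lambda>z. (if 0 \<le> snd z \<and> snd z \<le> fst (fst z) then tent \<epsilon> (x (snd z) (snd (fst z))) else 0))
      \<in> borel_measurable ((borel \<Otimes>\<^sub>M M) \<Otimes>\<^sub>M lborel)" by measurable
  then have "(\<lambda>(p, r). (if 0 \<le> r \<and> r \<le> fst p then tent \<epsilon> (x r (snd p)) else 0))
      \<in> borel_measurable ((borel \<Otimes>\<^sub>M M) \<Otimes>\<^sub>M lborel)" by (simp only: case_prod_beta')
  from lborel.borel_measurable_lebesgue_integral[OF this]
  have "(\<lambda>p. \<integral>r. (if 0 \<le> r \<and> r \<le> fst p then tent \<epsilon> (x r (snd p)) else 0) \<partial>lborel) \<in> borel_measurable (borel \<Otimes>\<^sub>M M)" .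
  moreover have "tent_time \<epsilon> (fst p) (snd p) = (\<integral>r. (if 0 \<le> r \<and> r \<le> fst p then tent \<epsilon> (x r (snd p)) else 0) \<partial>lborel)" for p
    unfolding tent_time_def set_lebesgue_integral_def by (intro Bochner_Integration.integral_cong refl) (simp add: indicator_def)
  ultimately show ?thesis by simp
qed

definition "tent_const t = exp 1 * (2 + (2 * drift_sup + 1) * t)"

lemma tent_const_mono: "0 \<le> s \<Longrightarrow> s \<le> t \<Longrightarrow> tent_const s \<le> tent_const t"
  unfolding tent_const_def by (intro mult_left_mono add_left_mono) auto

lemma tent_const_nonneg: "0 \<le> t \<Longrightarrow> 0 \<le> tent_const t"
  unfolding tent_const_def by simp

lemma tent_time_mean:
  assumes "0 < \<epsilon>" "\<epsilon> \<le> 1" "0 < t"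
  shows "expectation (tent_time \<epsilon> t) \<le> tent_const t"
proof -
  have "expectation (\<lambda>\<omega>. 1 * (LBINT r:{0..t}. tent \<epsilon> (x r \<omega>))) \<le> exp 1 * (2 + (2 * drift_sup + 1) * (t - 0)) * expectation (\<lambda>_. 1)"
    by (rule tent_conditional_bound[where c = 1, OF assms(1,2) order_refl assms(3)]) auto
  then show ?thesis by (simp add: tent_time_def[abs_def] tent_const_def prob_space)
qed

text \<open>The square of a time integral is twice the integral over ordered pairs of times; conditioning at the
  earlier of the two times and applying \<open>tent_conditional_bound\<close> twice gives a bound uniform in \<open>\<epsilon>\<close>.\<close>

lemma tent_time_second_moment:
  assumes e: "0 < \<epsilon>" "\<epsilon> \<le> 1" and t: "0 < t"
  shows "integrable M (\<lambda>\<omega>. (tent_time \<epsilon> t \<omega>)\<^sup>2)" "expectation (\<lambda>\<omega>. (tent_time \<epsilon> t \<omega>)\<^sup>2) \<le> 2 * (tent_const t)\<^sup>2"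
proof -
  have t0: "0 \<le> t" using t by simp
  show "integrable M (\<lambda>\<omega>. (tent_time \<epsilon> t \<omega>)\<^sup>2)"
  proof (rule integrable_const_bound[where B = "(t / \<epsilon>)\<^sup>2"], rule AE_I2)
    fix \<omega> assume "\<omega> \<in> space M"
    note bounds = tent_time_bounds[OF e(1) t0 this]
    have "(tent_time \<epsilon> t \<omega>)\<^sup>2 \<le> (t / \<epsilon>)\<^sup>2" by (rule power_mono[OF bounds(2,1)])
    then show "norm ((tent_time \<epsilon> t \<omega>)\<^sup>2) \<le> (t / \<epsilon>)\<^sup>2" by (simp only: real_norm_def abs_power2)
  qed measurable
  define w :: "real \<Rightarrow> real" where "w = indicator {0..t}"
  have w: "integrable lborel w" unfolding w_def by (rule integrable_real_indicator) (auto simp: emeasure_lborel_Icc_eq)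
  have x'[measurable]: "(\<lambda>p. x (fst p) (snd p)) \<in> borel_measurable (borel \<Otimes>\<^sub>M M)" by (rule x_joint)
  have tt[measurable]: "(\<lambda>p. tent_time \<epsilon> (fst p) (snd p)) \<in> borel_measurable (borel \<Otimes>\<^sub>M M)" by (rule tent_time_joint)
  \<comment> \<open>Clamping the time makes the integrand bounded for all \<open>s\<close>; only \<open>s\<close> in \<open>[0, t]\<close> contribute.\<close>
  define S where "S s = min t (max 0 s)" for s
  have S: "0 \<le> S s" "S s \<le> t" for s using t by (auto simp: S_def)
  define F where "F s \<omega> = tent \<epsilon> (x s \<omega>) * (tent_time \<epsilon> t \<omega> - tent_time \<epsilon> (S s) \<omega>)" for s \<omega>
  have F_meas: "(\<lambda>p. F (fst p) (snd p)) \<in> borel_measurable (borel \<Otimes>\<^sub>M M)"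
  proof -
    have "(\<lambda>p. (S (fst p), snd p)) \<in> measurable (borel \<Otimes>\<^sub>M M) (borel \<Otimes>\<^sub>M M)" unfolding S_def by measurable
    from measurable_compose[OF this tt]
    have [measurable]: "(\<lambda>p. tent_time \<epsilon> (S (fst p)) (snd p)) \<in> borel_measurable (borel \<Otimes>\<^sub>M M)" by simp
    show ?thesis unfolding F_def by measurable
  qed
  have diff_bound: "0 \<le> tent_time \<epsilon> t \<omega> - tent_time \<epsilon> (S s) \<omega>" "tent_time \<epsilon> t \<omega> - tent_time \<epsilon> (S s) \<omega> \<le> t / \<epsilon>"
    if "\<omega> \<in> space M" for s \<omega>
  proof -
    show "0 \<le> tent_time \<epsilon> t \<omega> - tent_time \<epsilon> (S s) \<omega>"
      unfolding tent_time_diff[OF e(1) S that] set_lebesgue_integral_def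
      using tent_nonneg[OF e(1)] by (intro Bochner_Integration.integral_nonneg) simp
    show "tent_time \<epsilon> t \<omega> - tent_time \<epsilon> (S s) \<omega> \<le> t / \<epsilon>"
      using tent_time_bounds(2)[OF e(1) t0 that] tent_time_bounds(1)[OF e(1) S(1)[of s] that] by linarith
  qed
  have F_bound: "\<bar>F s \<omega>\<bar> \<le> (1 / \<epsilon>) * (t / \<epsilon>)" if "\<omega> \<in> space M" for s \<omega>
  proof -
    have "\<bar>tent_time \<epsilon> t \<omega> - tent_time \<epsilon> (S s) \<omega>\<bar> \<le> t / \<epsilon>" using diff_bound[OF that, of s] by linarith
    then show ?thesis
      unfolding F_def abs_mult by (rule mult_mono[OF tent_abs[OF e(1)]]) (use e in auto)
  qed
  note fub = expectation_time_integral[OF F_meas F_bound w]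
  have G_meas: "(\<lambda>p. tent \<epsilon> (x (fst p) (snd p))) \<in> borel_measurable (borel \<Otimes>\<^sub>M M)"
    by (rule measurable_compose[OF x_joint tent_measurable])
  note fubG = expectation_time_integral[OF G_meas tent_abs[OF e(1)] w]
  have "expectation (\<lambda>\<omega>. (tent_time \<epsilon> t \<omega>)\<^sup>2) = expectation (\<lambda>\<omega>. 2 * (\<integral>s. w s * F s \<omega> \<partial>lborel))"
  proof (rule Bochner_Integration.integral_cong[OF refl])
    fix \<omega> assume w': "\<omega> \<in> space M"
    have "continuous_on UNIV (\<lambda>r. x r \<omega>)" unfolding x_def by (intro continuous_on_max0 X_continuous w')
    then have c: "continuous_on UNIV (\<lambda>r. tent \<epsilon> (x r \<omega>))"
      by (rule continuous_on_compose2[OF tent_continuous[OF e(1)]]) simp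
    have "(tent_time \<epsilon> t \<omega>)\<^sup>2 = 2 * (LBINT s:{0..t}. tent \<epsilon> (x s \<omega>) * (tent_time \<epsilon> t \<omega> - tent_time \<epsilon> s \<omega>))"
      unfolding tent_time_def by (rule square_of_time_integral[OF c t0])
    also have "(LBINT s:{0..t}. tent \<epsilon> (x s \<omega>) * (tent_time \<epsilon> t \<omega> - tent_time \<epsilon> s \<omega>)) = (\<integral>s. w s * F s \<omega> \<partial>lborel)"
      unfolding set_lebesgue_integral_def w_def F_def S_def
      by (intro Bochner_Integration.integral_cong refl) (simp add: indicator_def)
    finally show "(tent_time \<epsilon> t \<omega>)\<^sup>2 = 2 * (\<integral>s. w s * F s \<omega> \<partial>lborel)" .
  qed
  also have "\<dots> = 2 * (\<integral>s. w s * expectation (F s) \<partial>lborel)" using fub(1) by simp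
  also have "\<dots> \<le> 2 * (\<integral>s. tent_const t * (w s * expectation (\<lambda>\<omega>. tent \<epsilon> (x s \<omega>))) \<partial>lborel)"
  proof (rule mult_left_mono[OF integral_mono])
    show "integrable lborel (\<lambda>s. w s * expectation (F s))" by (rule fub(2))
    show "integrable lborel (\<lambda>s. tent_const t * (w s * expectation (\<lambda>\<omega>. tent \<epsilon> (x s \<omega>))))"
      using fubG(2) by (rule integrable_mult_right)
    fix s :: real
    show "w s * expectation (F s) \<le> tent_const t * (w s * expectation (\<lambda>\<omega>. tent \<epsilon> (x s \<omega>)))"
    proof (cases "s \<in> {0..<t}")
      case True
      then have s: "0 \<le> s" "s < t" by auto
      have "expectation (F s) = expectation (\<lambda>\<omega>. tent \<epsilon> (x s \<omega>) * (LBINT r:{s..t}. tent \<epsilon> (x r \<omega>)))"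
        unfolding F_def using tent_time_diff[OF e(1) s(1) less_imp_le[OF s(2)]] s
        by (intro Bochner_Integration.integral_cong) (auto simp: S_def min_def max_def)
      also have "\<dots> \<le> exp 1 * (2 + (2 * drift_sup + 1) * (t - s)) * expectation (\<lambda>\<omega>. tent \<epsilon> (x s \<omega>))"
        by (rule tent_conditional_bound[where c = "1 / \<epsilon>", OF e s])
           (use tent_nonneg[OF e(1)] tent_le[OF e(1)] measurable_compose[OF x_adapted[OF s(1)] tent_measurable] in auto)
      also have "\<dots> \<le> tent_const t * expectation (\<lambda>\<omega>. tent \<epsilon> (x s \<omega>))"
        using tent_const_mono[of "t - s" t] s tent_nonneg[OF e(1)]
        by (intro mult_right_mono) (auto simp: tent_const_def)
      finally show ?thesis using True by (simp add: w_def)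
    next
      case False
      show ?thesis
      proof (cases "s = t")
        case True
        then have "F s = (\<lambda>_. 0)" using t by (simp add: F_def S_def fun_eq_iff)
        then show ?thesis using tent_const_nonneg[OF t0] tent_nonneg[OF e(1)] True t
          by (simp add: w_def)
      next
        case ne: False
        then have "s \<notin> {0..t}" using False by auto
        then show ?thesis by (simp add: w_def)
      qed
    qed
  qed simp
  also have "\<dots> = 2 * (tent_const t * (\<integral>s. w s * expectation (\<lambda>\<omega>. tent \<epsilon> (x s \<omega>)) \<partial>lborel))"
    by (simp only: integral_mult_right_zero)
  also have "(\<integral>s. w s * expectation (\<lambda>\<omega>. tent \<epsilon> (x s \<omega>)) \<partial>lborel) = expectation (tent_time \<epsilon> t)"
    using fubG(1) by (simp add: tent_time_def[abs_def] set_lebesgue_integral_def w_def)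
  also have "2 * (tent_const t * expectation (tent_time \<epsilon> t)) \<le> 2 * (tent_const t * tent_const t)"
    by (intro mult_left_mono tent_time_mean e t tent_const_nonneg t0) simp
  finally show "expectation (\<lambda>\<omega>. (tent_time \<epsilon> t \<omega>)\<^sup>2) \<le> 2 * (tent_const t)\<^sup>2" by (simp add: power2_eq_square)
qed

text \<open>This is the mean of \<open>L t\<close>. Defining it as a limit avoids the question whether \<open>L t\<close> itself is measurable.\<close>

definition "local_time_mean t = lim (\<lambda>n. expectation (tent_time (1 / real (Suc n)) t))"

lemma local_time_mean:
  assumes t: "0 < t"
  shows "(\<lambda>n. expectation (tent_time (1 / real (Suc n)) t)) \<longlonglongrightarrow> local_time_mean t"
    and "expectation (V t) = \<beta> * local_time_mean t"
proof -
  define f where "f n = tent_time (1 / real (Suc n)) t" for n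
  define h where "h \<omega> = lim (\<lambda>n. f n \<omega>)" for \<omega>
  have pos: "0 < 1 / real (Suc n)" "1 / real (Suc n) \<le> 1" for n by auto
  have [measurable]: "f n \<in> borel_measurable M" for n unfolding f_def by measurable
  have h[measurable]: "h \<in> borel_measurable M" unfolding h_def by measurable
  have seq: "filterlim (\<lambda>n. 1 / real (Suc n)) (at_right 0) sequentially"
    unfolding filterlim_at
  proof
    show "\<forall>\<^sub>F n in sequentially. 1 / real (Suc n) \<in> {0<..} \<and> 1 / real (Suc n) \<noteq> 0" by (intro always_eventually) auto
    show "(\<lambda>n. 1 / real (Suc n)) \<longlonglongrightarrow> 0" by (rule LIMSEQ_Suc[OF lim_const_over_n])
  qed
  have ae: "AE \<omega> in M. (\<lambda>n. f n \<omega>) \<longlonglongrightarrow> h \<omega> \<and> V t \<omega> = \<beta> * h \<omega>"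
    using AE_good
  proof eventually_elim
    case (elim \<omega>)
    interpret refracted_path "\<lambda>t. x t \<omega>" "\<lambda>t. b t \<omega>" "\<lambda>t. L t \<omega>" \<beta> \<mu>\<^sub>p \<mu>\<^sub>m
      using elim by (simp add: good_def)
    have "(\<lambda>n. f n \<omega>) \<longlonglongrightarrow> L t \<omega>"
      unfolding f_def tent_time_def using filterlim_compose[OF tent_integral_tendsto[OF less_imp_le[OF t]] seq] .
    then show ?case unfolding h_def using good_V[OF elim less_imp_le[OF t]] by (simp add: limI)
  qed
  have fp: "AE \<omega> in M. 0 \<le> f n \<omega>" for n
    unfolding f_def using tent_time_bounds(1)[OF pos(1) less_imp_le[OF t]] by (intro AE_I2)
  have lim: "integrable M h" "(\<lambda>n. expectation (f n)) \<longlonglongrightarrow> expectation h"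
    using expectation_tendsto_of_second_moment[of f h "2 * (tent_const t)\<^sup>2"] ae fp
      tent_time_second_moment[OF pos t] unfolding f_def[symmetric] by auto
  then have eq: "local_time_mean t = expectation h"
    unfolding local_time_mean_def f_def[symmetric] by (intro limI)
  then show "(\<lambda>n. expectation (tent_time (1 / real (Suc n)) t)) \<longlonglongrightarrow> local_time_mean t"
    using lim(2) by (simp add: f_def)
  have "expectation (V t) = expectation (\<lambda>\<omega>. \<beta> * h \<omega>)"
    by (rule integral_cong_AE) (use ae in auto)
  then show "expectation (V t) = \<beta> * local_time_mean t" using eq by simp
qed

end

section \<open>Tanaka's formula in expectation\<close>

lemma ramp_near:
  assumes e: "0 < \<epsilon>" shows "\<bar>ramp \<epsilon> y - max 0 y\<bar> \<le> \<epsilon>"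
proof -
  consider "y \<le> - \<epsilon>" | "- \<epsilon> < y" "y < \<epsilon>" | "\<epsilon> \<le> y" by linarith
  then show ?thesis
  proof cases
    case 2
    then show ?thesis using ramp_nonneg[OF e, of y] ramp_le[OF e, of y] by (auto simp: max_def abs_le_iff)
  qed (use e ramp_left[OF e] ramp_right[OF e] in auto)
qed

lemma inverse_Suc_tendsto: "(\<lambda>n. 1 / real (Suc n)) \<longlonglongrightarrow> 0"
  by (rule LIMSEQ_Suc[OF lim_const_over_n])

context skew_bm begin

definition half_generator ::
    "real \<Rightarrow> (real \<Rightarrow> real) \<Rightarrow> (real \<Rightarrow> real) \<Rightarrow> real \<Rightarrow> real" where
  "half_generator \<sigma> g' g'' y = (if 0 < \<sigma> * y then \<sigma> * drift y * g' (\<sigma> * y) + g'' (\<sigma> * y) / 2 else 0)"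

lemma half_generator_bound:
  assumes h: "half_line_test C g g' g''" and \<sigma>: "\<sigma> = 1 \<or> \<sigma> = - 1"
  shows "\<bar>half_generator \<sigma> g' g'' y\<bar> \<le> (drift_sup + 1) * C"
proof (cases "0 < \<sigma> * y")
  case True
  have C0: "0 \<le> C" by (rule half_line_testD(7)[OF h])
  have "\<bar>\<sigma> * drift y\<bar> \<le> drift_sup" using drift_coeff_bound[of \<mu>\<^sub>p \<mu>\<^sub>m y] \<sigma> by (auto simp: abs_mult)
  from mult_mono[OF this half_line_testD(4)[OF h less_imp_le[OF True]]]
  have "\<bar>\<sigma> * drift y * g' (\<sigma> * y)\<bar> \<le> drift_sup * C" unfolding abs_mult by simp
  moreover have "\<bar>g'' (\<sigma> * y)\<bar> \<le> C" by (rule half_line_testD(5)[OF h less_imp_le[OF True]])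
  moreover have "\<bar>p + q / 2\<bar> \<le> a + c" if "\<bar>p\<bar> \<le> a" "\<bar>q\<bar> \<le> c" for p q a c :: real
    using that by linarith
  ultimately have "\<bar>half_generator \<sigma> g' g'' y\<bar> \<le> drift_sup * C + C" unfolding half_generator_def using True by presburger
  then show ?thesis by (simp only: distrib_right mult_1)
next
  case False
  then show ?thesis using half_line_testD(7)[OF h] by (simp add: half_generator_def)
qed

lemma half_line_test_measurable:
  assumes h: "half_line_test C g g' g''"
  shows "g \<in> borel_measurable borel" "g' \<in> borel_measurable borel" "(\<lambda>x. g'' (max 0 x)) \<in> borel_measurable borel"
proof -
  show "g \<in> borel_measurable borel" "g' \<in> borel_measurable borel"
    by (rule borel_measurable_continuous_onI, rule DERIV_continuous_on,
        rule half_line_testD(1)[OF h, THEN has_field_derivative_at_within] half_line_testD(2)[OF h, THEN has_field_derivative_at_within])+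
  have "\<bar>g'' (max 0 x) - g'' (max 0 y)\<bar> \<le> C * \<bar>x - y\<bar>" for x y
  proof -
    have "\<bar>g'' (max 0 x) - g'' (max 0 y)\<bar> \<le> C * \<bar>max 0 x - max 0 y\<bar>"
      by (rule half_line_testD(6)[OF h]) auto
    also have "\<dots> \<le> C * \<bar>x - y\<bar>" using half_line_testD(7)[OF h] by (intro mult_left_mono) auto
    finally show ?thesis .
  qed
  then show "(\<lambda>x. g'' (max 0 x)) \<in> borel_measurable borel"
    by (intro borel_measurable_continuous_onI continuous_of_lipschitz)
qed

lemma half_generator_measurable:
  assumes h: "half_line_test C g g' g''"
  shows "half_generator \<sigma> g' g'' \<in> borel_measurable borel"
proof -
  note [measurable] = half_line_test_measurable[OF h]
  have [measurable]: "(\<lambda>y. g'' (max 0 (\<sigma> * y))) \<in> borel_measurable borel"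
    by (rule measurable_compose[OF _ half_line_test_measurable(3)[OF h]]) measurable
  have "half_generator \<sigma> g' g'' = (\<lambda>y. if 0 < \<sigma> * y then \<sigma> * drift y * g' (\<sigma> * y) + g'' (max 0 (\<sigma> * y)) / 2 else 0)"
    by (auto simp: half_generator_def fun_eq_iff)
  also have "\<dots> \<in> borel_measurable borel" by measurable
  finally show ?thesis .
qed

lemma AE_not_at_zero:
  assumes "good \<omega>" "0 \<le> t"
  shows "AE r in lborel. r \<in> {0..t} \<longrightarrow> x r \<omega> \<noteq> 0"
proof -
  interpret refracted_path "\<lambda>t. x t \<omega>" "\<lambda>t. b t \<omega>" "\<lambda>t. L t \<omega>" \<beta> \<mu>\<^sub>p \<mu>\<^sub>m
    using assms(1) by (simp add: good_def)
  define N where "N = {r \<in> {0..t}. \<bar>x r \<omega>\<bar> \<le> 0}"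
  have "N \<in> fmeasurable lborel" using level_set_fmeasurable[of 0 t 0] by (simp add: N_def)
  moreover have "measure lborel N = 0" using zero_set_measure[OF assms(2)] by (simp add: N_def)
  moreover have "emeasure lborel N = ennreal (measure lborel N)"
    using \<open>N \<in> fmeasurable lborel\<close> by (intro emeasure_eq_ennreal_measure) (auto simp: fmeasurable_def)
  ultimately have "N \<in> null_sets lborel" by (simp add: null_sets_def fmeasurable_def)
  from AE_not_in[OF this] show ?thesis by eventually_elim (auto simp: N_def)
qed

text \<open>Ito's formula for \<open>g(ramp(\<sigma> X))\<close> as the width of the tent shrinks. The generator splits into a
  bounded part \<open>A\<close>, which converges off the zero set of the path, and the part \<open>Q\<close> carrying the tent, which contributes
  \<open>g'(0)/2\<close> times the mean local time. The local time term of the equation is multiplied by the slope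
  \<open>\<sigma> g'(0)/2\<close> of the smoothed function at \<open>0\<close>.\<close>

lemma tanaka_expectation:
  assumes t: "0 < t" and h: "half_line_test C g g' g''" and g0: "g 0 = 0" and \<sigma>: "\<sigma> = 1 \<or> \<sigma> = - 1"
  shows "expectation (\<lambda>\<omega>. g (max 0 (\<sigma> * x t \<omega>)))
    = expectation (\<lambda>\<omega>. LBINT r:{0..t}. half_generator \<sigma> g' g'' (x r \<omega>)) + g' 0 / 2 * (1 + \<sigma> * \<beta>) * local_time_mean t"
proof -
  define e where "e n = 1 / real (Suc n)" for n
  have e: "0 < e n" for n by (simp add: e_def)
  have e_lim: "e \<longlonglongrightarrow> 0" unfolding e_def[abs_def] by (rule inverse_Suc_tendsto)
  have C0: "0 \<le> C" by (rule half_line_testD(7)[OF h])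
  note [measurable] = half_line_test_measurable[OF h]
  have g_cont: "isCont g y" "isCont g' y" for y
    using DERIV_isCont[OF half_line_testD(1)[OF h]] DERIV_isCont[OF half_line_testD(2)[OF h]] by auto
  have ramp_meas[measurable]: "ramp (e n) \<in> borel_measurable borel" "ramp' (e n) \<in> borel_measurable borel" for n
    unfolding ramp_def[abs_def] ramp'_def[abs_def] plus_pow_def by measurable
  have g''_meas[measurable]: "(\<lambda>y. g'' (ramp (e n) (\<sigma> * y))) \<in> borel_measurable borel" for n
  proof -
    have "(\<lambda>y. g'' (max 0 (ramp (e n) (\<sigma> * y)))) \<in> borel_measurable borel"
      by (rule measurable_compose[OF _ half_line_test_measurable(3)[OF h]]) measurable
    then show ?thesis using ramp_nonneg[OF e] by (simp add: max_absorb2)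
  qed
  define A where "A n y = drift y * (\<sigma> * (g' (ramp (e n) (\<sigma> * y)) * ramp' (e n) (\<sigma> * y)))
    + g'' (ramp (e n) (\<sigma> * y)) * (ramp' (e n) (\<sigma> * y) * ramp' (e n) (\<sigma> * y)) / 2" for n y
  define Q where "Q n y = g' (ramp (e n) (\<sigma> * y)) * tent (e n) y" for n y
  have A_meas[measurable]: "A n \<in> borel_measurable borel" for n unfolding A_def[abs_def] by measurable
  have Q_meas[measurable]: "Q n \<in> borel_measurable borel" for n unfolding Q_def[abs_def] by measurable
  define D where "D = (drift_sup + 1) * C"
  have D0: "0 \<le> D" using C0 by (simp add: D_def)
  have A_bound: "\<bar>A n y\<bar> \<le> D" for n y
  proof -
    let ?w = "ramp (e n) (\<sigma> * y)" and ?w' = "ramp' (e n) (\<sigma> * y)"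
    have w: "0 \<le> ?w" "\<bar>?w'\<bar> \<le> 1" using ramp_nonneg[OF e] ramp'_bounds[OF e] by (auto simp: abs_le_iff intro: order_trans)
    have s: "\<bar>\<sigma>\<bar> = 1" using \<sigma> by auto
    have "\<bar>g' ?w * ?w'\<bar> \<le> C * 1" unfolding abs_mult by (intro mult_mono half_line_testD(4)[OF h w(1)] w(2) C0) simp
    then have 1: "\<bar>drift y * (\<sigma> * (g' ?w * ?w'))\<bar> \<le> drift_sup * C"
      unfolding abs_mult[of "drift y"] abs_mult[of \<sigma>] s by (intro mult_mono drift_coeff_bound) auto
    have "\<bar>?w' * ?w'\<bar> \<le> 1 * 1" unfolding abs_mult by (intro mult_mono w(2)) auto
    then have 2: "\<bar>g'' ?w * (?w' * ?w')\<bar> \<le> C * (1 * 1)"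
      unfolding abs_mult[of "g'' ?w"] by (intro mult_mono half_line_testD(5)[OF h w(1)] C0) auto
    have "\<bar>p + q / 2\<bar> \<le> a + c" if "\<bar>p\<bar> \<le> a" "\<bar>q\<bar> \<le> c" for p q a c :: real
      using that by linarith
    from this[OF 1 2] show ?thesis unfolding A_def D_def by (simp only: distrib_right mult_1 mult_1_right)
  qed
  have Q_bound: "\<bar>Q n y\<bar> \<le> C * (1 / e n)" for n y
    unfolding Q_def abs_mult by (intro mult_mono half_line_testD(4)[OF h ramp_nonneg[OF e]] tent_abs[OF e] C0) simp
  define IA where "IA n \<omega> = (LBINT r:{0..t}. A n (x r \<omega>))" for n \<omega>
  define IQ where "IQ n \<omega> = (LBINT r:{0..t}. Q n (x r \<omega>))" for n \<omega>
  define IH where "IH \<omega> = (LBINT r:{0..t}. half_generator \<sigma> g' g'' (x r \<omega>))" for \<omega>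
  have one: "(\<lambda>_. 1 :: real) \<in> borel_measurable M" "\<bar>1 :: real\<bar> \<le> 1" by auto
  have IA_int: "integrable M (IA n)" and IQ_int: "integrable M (IQ n)" for n
    using time_integral_integrable[OF A_meas A_bound less_imp_le[OF t] one]
      time_integral_integrable[OF Q_meas Q_bound less_imp_le[OF t] one] unfolding IA_def IQ_def by simp_all
  have V0: "AE \<omega> in M. V 0 \<omega> = 0"
    using AE_good
  proof eventually_elim
    case (elim \<omega>)
    interpret refracted_path "\<lambda>t. x t \<omega>" "\<lambda>t. b t \<omega>" "\<lambda>t. L t \<omega>" \<beta> \<mu>\<^sub>p \<mu>\<^sub>m
      using elim by (simp add: good_def)
    show ?case using good_V[OF elim, of 0] l_0 by simp
  qed
  have x0: "AE \<omega> in M. x 0 \<omega> = 0"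
    using AE_good by eventually_elim (auto simp: good_def refracted_path_def)
  have step: "expectation (\<lambda>\<omega>. g (ramp (e n) (\<sigma> * x t \<omega>))) - g (e n / 6)
    = expectation (IA n) + expectation (IQ n) / 2 + \<sigma> * g' (e n / 6) / 2 * (\<beta> * local_time_mean t)" for n
  proof -
    obtain D' where tf: "test_function D' (\<lambda>y. g (ramp (e n) (\<sigma> * y))) (\<lambda>y. \<sigma> * (g' (ramp (e n) (\<sigma> * y)) * ramp' (e n) (\<sigma> * y)))
      (\<lambda>y. g'' (ramp (e n) (\<sigma> * y)) * (ramp' (e n) (\<sigma> * y) * ramp' (e n) (\<sigma> * y)) + g' (ramp (e n) (\<sigma> * y)) * tent (e n) (\<sigma> * y))"
      using ramp_test[OF h e \<sigma>] by blast
    have tent_eq': "tent (e n) (\<sigma> * y) = tent (e n) y" for y using \<sigma> tent_minus[OF e] by auto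
    have "expectation (\<lambda>\<omega>. 1 * (g (ramp (e n) (\<sigma> * x t \<omega>)) - g (ramp (e n) (\<sigma> * x 0 \<omega>))))
      = expectation (\<lambda>\<omega>. 1 * ((LBINT r:{0..t}. A n (x r \<omega>) + Q n (x r \<omega>) / 2)
        + \<sigma> * (g' (ramp (e n) (\<sigma> * 0)) * ramp' (e n) (\<sigma> * 0)) * (V t \<omega> - V 0 \<omega>)))"
      using ito_expectation[OF order_refl t tf, of "\<lambda>_. 1" 1]
      unfolding A_def Q_def tent_eq' by (simp only: measurable_const space_borel UNIV_I abs_one order_refl add_divide_distrib add.assoc True_implies_equals)
    moreover have "expectation (\<lambda>\<omega>. 1 * (g (ramp (e n) (\<sigma> * x t \<omega>)) - g (ramp (e n) (\<sigma> * x 0 \<omega>))))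
      = expectation (\<lambda>\<omega>. g (ramp (e n) (\<sigma> * x t \<omega>))) - g (e n / 6)"
    proof -
      have "expectation (\<lambda>\<omega>. 1 * (g (ramp (e n) (\<sigma> * x t \<omega>)) - g (ramp (e n) (\<sigma> * x 0 \<omega>))))
        = expectation (\<lambda>\<omega>. g (ramp (e n) (\<sigma> * x t \<omega>)) - g (e n / 6))"
      proof (rule integral_cong_AE)
        show "AE \<omega> in M. 1 * (g (ramp (e n) (\<sigma> * x t \<omega>)) - g (ramp (e n) (\<sigma> * x 0 \<omega>)))
          = g (ramp (e n) (\<sigma> * x t \<omega>)) - g (e n / 6)"
          using x0 by eventually_elim (simp only: mult_zero_right mult_1 ramp_0[OF e])
      qed measurable
      also have "\<dots> = expectation (\<lambda>\<omega>. g (ramp (e n) (\<sigma> * x t \<omega>))) - expectation (\<lambda>_. g (e n / 6))"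
        by (intro Bochner_Integration.integral_diff integrable_const_bound[where B = C])
           (use half_line_testD(3)[OF h ramp_nonneg[OF e]] half_line_testD(3)[OF h, of "e n / 6"] e[of n] in auto)
      finally show ?thesis by (simp add: prob_space)
    qed
    moreover have "expectation (\<lambda>\<omega>. 1 * ((LBINT r:{0..t}. A n (x r \<omega>) + Q n (x r \<omega>) / 2)
        + \<sigma> * (g' (ramp (e n) (\<sigma> * 0)) * ramp' (e n) (\<sigma> * 0)) * (V t \<omega> - V 0 \<omega>)))
      = expectation (\<lambda>\<omega>. (IA n \<omega> + IQ n \<omega> / 2) + \<sigma> * g' (e n / 6) / 2 * V t \<omega>)"
    proof (rule integral_cong_AE)
      have [measurable]: "(\<lambda>\<omega>. LBINT r:{0..t}. A n (x r \<omega>) + Q n (x r \<omega>) / 2) \<in> borel_measurable M"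
        by (rule time_integral_measurable) measurable
      show "(\<lambda>\<omega>. 1 * ((LBINT r:{0..t}. A n (x r \<omega>) + Q n (x r \<omega>) / 2)
        + \<sigma> * (g' (ramp (e n) (\<sigma> * 0)) * ramp' (e n) (\<sigma> * 0)) * (V t \<omega> - V 0 \<omega>))) \<in> borel_measurable M" by measurable
      have [measurable]: "IA n \<in> borel_measurable M" "IQ n \<in> borel_measurable M"
        unfolding IA_def[abs_def] IQ_def[abs_def] by (auto intro: time_integral_measurable)
      show "(\<lambda>\<omega>. (IA n \<omega> + IQ n \<omega> / 2) + \<sigma> * g' (e n / 6) / 2 * V t \<omega>) \<in> borel_measurable M" by measurable
      show "AE \<omega> in M. 1 * ((LBINT r:{0..t}. A n (x r \<omega>) + Q n (x r \<omega>) / 2)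
        + \<sigma> * (g' (ramp (e n) (\<sigma> * 0)) * ramp' (e n) (\<sigma> * 0)) * (V t \<omega> - V 0 \<omega>))
        = (IA n \<omega> + IQ n \<omega> / 2) + \<sigma> * g' (e n / 6) / 2 * V t \<omega>"
        using V0 AE_space
      proof eventually_elim
        case (elim \<omega>)
        note [measurable] = path_measurable[OF elim(2)]
        have i1: "set_integrable lborel {0..t} (\<lambda>r. A n (x r \<omega>))"
          by (rule set_integrable_bounded_borel[where C = D]) (use A_bound in auto)
        have i2: "set_integrable lborel {0..t} (\<lambda>r. Q n (x r \<omega>) / 2)"
          using set_integrable_bounded_borel[of "\<lambda>r. Q n (x r \<omega>)" 0 t "C * (1 / e n)"] Q_bound by auto
        have "(LBINT r:{0..t}. A n (x r \<omega>) + Q n (x r \<omega>) / 2) = IA n \<omega> + IQ n \<omega> / 2"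
          unfolding IA_def IQ_def set_integral_add(2)[OF i1 i2] by simp
        then show ?case using elim(1) by (simp add: ramp_0[OF e] ramp'_0[OF e])
      qed
    qed
    moreover have "expectation (\<lambda>\<omega>. (IA n \<omega> + IQ n \<omega> / 2) + \<sigma> * g' (e n / 6) / 2 * V t \<omega>)
      = expectation (IA n) + expectation (IQ n) / 2 + \<sigma> * g' (e n / 6) / 2 * expectation (V t)"
      using IA_int IQ_int V_integrable[OF less_imp_le[OF t]] by simp
    ultimately show ?thesis using local_time_mean(2)[OF t] by simp
  qed
  have lim1: "(\<lambda>n. expectation (\<lambda>\<omega>. g (ramp (e n) (\<sigma> * x t \<omega>)))) \<longlonglongrightarrow> expectation (\<lambda>\<omega>. g (max 0 (\<sigma> * x t \<omega>)))"
  proof (rule integral_dominated_convergence[where w = "\<lambda>_. C"])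
    have "(\<lambda>n. ramp (e n) y) \<longlonglongrightarrow> max 0 y" for y
      by (rule LIM_zero_cancel, rule Lim_null_comparison[OF _ e_lim]) (simp only: real_norm_def ramp_near[OF e] eventually_True)
    then show "AE \<omega> in M. (\<lambda>n. g (ramp (e n) (\<sigma> * x t \<omega>))) \<longlonglongrightarrow> g (max 0 (\<sigma> * x t \<omega>))"
      by (intro AE_I2 isCont_tendsto_compose[OF g_cont(1)])
    show "AE \<omega> in M. norm (g (ramp (e n) (\<sigma> * x t \<omega>))) \<le> C" for n
      unfolding real_norm_def by (intro AE_I2 half_line_testD(3)[OF h ramp_nonneg[OF e]])
  qed auto
  have e6: "(\<lambda>n. e n / 6) \<longlonglongrightarrow> 0" using tendsto_divide[OF e_lim tendsto_const, of 6] by simp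
  have lim2: "(\<lambda>n. g (e n / 6)) \<longlonglongrightarrow> 0" and lim3: "(\<lambda>n. g' (e n / 6)) \<longlonglongrightarrow> g' 0"
    using isCont_tendsto_compose[OF g_cont(1) e6] isCont_tendsto_compose[OF g_cont(2) e6] g0 by auto
  \<comment> \<open>Off the zeros of the path the integrand eventually equals its limit, and the zero set has measure \<open>0\<close>.\<close>
  have lim4: "(\<lambda>n. expectation (IA n)) \<longlonglongrightarrow> expectation IH"
  proof (rule integral_dominated_convergence[where w = "\<lambda>_. D * t"])
    show "IH \<in> borel_measurable M" unfolding IH_def[abs_def]
      by (intro time_integral_measurable half_generator_measurable[OF h])
    show "IA n \<in> borel_measurable M" for n using IA_int by auto
    show "AE \<omega> in M. norm (IA n \<omega>) \<le> D * t" for n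
      unfolding IA_def real_norm_def using time_integral_bound[OF A_meas A_bound less_imp_le[OF t]] by (intro AE_I2) simp
    show "AE \<omega> in M. (\<lambda>n. IA n \<omega>) \<longlonglongrightarrow> IH \<omega>"
      using AE_good AE_space
    proof eventually_elim
      case (elim \<omega>)
      note [measurable] = path_measurable[OF elim(2)] half_generator_measurable[OF h]
      show ?case unfolding IA_def IH_def set_lebesgue_integral_def
      proof (rule integral_dominated_convergence[where w = "\<lambda>r. indicator {0..t} r * D"])
        have "integrable lborel (indicator {0..t} :: real \<Rightarrow> real)"
          by (rule integrable_real_indicator) (auto simp: emeasure_lborel_Icc_eq)
        then show "integrable lborel (\<lambda>r. indicator {0..t} r * D)" by simp
        show "AE r in lborel. norm (indicator {0..t} r *\<^sub>R A n (x r \<omega>)) \<le> indicator {0..t} r * D" for n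
          using A_bound by (intro AE_I2) (simp add: indicator_def)
        show "AE r in lborel. (\<lambda>n. indicator {0..t} r *\<^sub>R A n (x r \<omega>)) \<longlonglongrightarrow> indicator {0..t} r *\<^sub>R half_generator \<sigma> g' g'' (x r \<omega>)"
          using AE_not_at_zero[OF elim(1) less_imp_le[OF t]]
        proof eventually_elim
          case (elim r)
          have "(\<lambda>n. A n (x r \<omega>)) \<longlonglongrightarrow> half_generator \<sigma> g' g'' (x r \<omega>)" if r: "r \<in> {0..t}"
          proof (rule tendsto_eventually)
            have "\<sigma> * x r \<omega> \<noteq> 0" using elim r \<sigma> by auto
            then have "0 < \<bar>\<sigma> * x r \<omega>\<bar>" by simp
            from order_tendstoD(2)[OF e_lim this]
            show "\<forall>\<^sub>F n in sequentially. A n (x r \<omega>) = half_generator \<sigma> g' g'' (x r \<omega>)"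
            proof eventually_elim
              case (elim n)
              show ?case
              proof (cases "0 < \<sigma> * x r \<omega>")
                case True
                then have "e n \<le> \<sigma> * x r \<omega>" using elim by simp
                then show ?thesis using True
                  by (simp add: A_def half_generator_def ramp_right[OF e] ramp'_right[OF e])
              next
                case False
                then have "\<sigma> * x r \<omega> \<le> - e n" using elim by simp
                then show ?thesis using False
                  by (simp add: A_def half_generator_def ramp'_left[OF e])
              qed
            qed
          qed
          then show ?case by (cases "r \<in> {0..t}") auto
        qed
      qed auto
    qed
  qed auto
  \<comment> \<open>On the support of the tent the ramp is at most \<open>e n\<close>, so \<open>g'\<close> may be replaced there by \<open>g' 0\<close> with an error of order \<open>e n\<close>.\<close>
  have lim5: "(\<lambda>n. expectation (IQ n)) \<longlonglongrightarrow> g' 0 * local_time_mean t"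
  proof -
    have g'_lip: "\<bar>g' y - g' 0\<bar> \<le> C * y" if y: "0 \<le> y" for y
    proof -
      obtain z where z: "min 0 y \<le> z" "g' y - g' 0 = g'' z * (y - 0)"
        using real_mvt[OF half_line_testD(2)[OF h], of 0 y] by blast
      have "0 \<le> z" using z(1) y by simp
      from mult_right_mono[OF half_line_testD(5)[OF h this] y] show ?thesis
        unfolding z(2) abs_mult using y by simp
    qed
    have Q_near: "\<bar>Q n y - g' 0 * tent (e n) y\<bar> \<le> C * e n * tent (e n) y" for n y
    proof (cases "\<bar>y\<bar> < e n")
      case True
      then have "\<sigma> * y \<le> e n" using \<sigma> by auto
      from ramp_le[OF e this] have "C * ramp (e n) (\<sigma> * y) \<le> C * e n" using C0 by (rule mult_left_mono)
      then have "\<bar>g' (ramp (e n) (\<sigma> * y)) - g' 0\<bar> \<le> C * e n" using g'_lip[OF ramp_nonneg[OF e, of n "\<sigma> * y"]] by linarith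
      from mult_right_mono[OF this tent_nonneg[OF e, of n y]] show ?thesis
        unfolding Q_def left_diff_distrib[symmetric] abs_mult using tent_nonneg[OF e, of n y] by simp
    qed (simp add: Q_def tent_outside[OF e])
    have diff: "\<bar>expectation (IQ n) - g' 0 * expectation (tent_time (e n) t)\<bar> \<le> C * e n * expectation (tent_time (e n) t)" for n
    proof -
      have T_int: "integrable M (tent_time (e n) t)"
        using time_integral_integrable[OF tent_measurable tent_abs[OF e] less_imp_le[OF t] one] by (simp add: tent_time_def[abs_def])
      have "expectation (IQ n) - g' 0 * expectation (tent_time (e n) t) = expectation (\<lambda>\<omega>. IQ n \<omega> - g' 0 * tent_time (e n) t \<omega>)"
        using IQ_int T_int by simp
      also have "\<bar>\<dots>\<bar> \<le> expectation (\<lambda>\<omega>. C * e n * tent_time (e n) t \<omega>)"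
      proof (rule abs_integral_le)
        fix \<omega> assume w: "\<omega> \<in> space M"
        note [measurable] = path_measurable[OF w]
        have i1: "set_integrable lborel {0..t} (\<lambda>r. Q n (x r \<omega>))"
          by (rule set_integrable_bounded_borel[where C = "C * (1 / e n)"]) (use Q_bound in auto)
        have i2: "set_integrable lborel {0..t} (\<lambda>r. k * tent (e n) (x r \<omega>))" for k
          using set_integrable_bounded_borel[of "\<lambda>r. tent (e n) (x r \<omega>)" 0 t "1 / e n"] tent_abs[OF e] by auto
        have "IQ n \<omega> - g' 0 * tent_time (e n) t \<omega> = (LBINT r:{0..t}. Q n (x r \<omega>) - g' 0 * tent (e n) (x r \<omega>))"
          unfolding IQ_def tent_time_def set_integral_diff(2)[OF i1 i2] by simp
        also have "\<bar>\<dots>\<bar> \<le> (LBINT r:{0..t}. C * e n * tent (e n) (x r \<omega>))"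
          unfolding set_lebesgue_integral_def
        proof (rule abs_integral_le)
          show "integrable lborel (\<lambda>r. indicator {0..t} r *\<^sub>R (Q n (x r \<omega>) - g' 0 * tent (e n) (x r \<omega>)))"
            "integrable lborel (\<lambda>r. indicator {0..t} r *\<^sub>R (C * e n * tent (e n) (x r \<omega>)))"
            using set_integral_diff(1)[OF i1 i2] i2 unfolding set_integrable_def by blast+
          show "\<bar>indicator {0..t} r *\<^sub>R (Q n (x r \<omega>) - g' 0 * tent (e n) (x r \<omega>))\<bar> \<le> indicator {0..t} r *\<^sub>R (C * e n * tent (e n) (x r \<omega>))" for r
            using Q_near[of n "x r \<omega>"] by (simp add: indicator_def)
        qed
        finally show "\<bar>IQ n \<omega> - g' 0 * tent_time (e n) t \<omega>\<bar> \<le> C * e n * tent_time (e n) t \<omega>"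
          by (simp add: tent_time_def)
      qed (use IQ_int T_int in auto)
      finally show ?thesis by simp
    qed
    have lm: "(\<lambda>n. expectation (tent_time (e n) t)) \<longlonglongrightarrow> local_time_mean t"
      unfolding e_def by (rule local_time_mean(1)[OF t])
    have "(\<lambda>n. C * e n * expectation (tent_time (e n) t)) \<longlonglongrightarrow> C * 0 * local_time_mean t"
      by (intro tendsto_intros e_lim lm)
    then have "(\<lambda>n. C * e n * expectation (tent_time (e n) t)) \<longlonglongrightarrow> 0" by simp
    then have "(\<lambda>n. expectation (IQ n) - g' 0 * expectation (tent_time (e n) t)) \<longlonglongrightarrow> 0"
      by (rule Lim_null_comparison[rotated]) (simp only: real_norm_def diff eventually_True)
    from tendsto_add[OF this tendsto_mult_left[OF lm, of "g' 0"]] show ?thesis by simp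
  qed
  have "(\<lambda>n. expectation (\<lambda>\<omega>. g (ramp (e n) (\<sigma> * x t \<omega>))) - g (e n / 6)) \<longlonglongrightarrow> expectation (\<lambda>\<omega>. g (max 0 (\<sigma> * x t \<omega>))) - 0"
    by (intro tendsto_diff lim1 lim2)
  moreover have "(\<lambda>n. expectation (\<lambda>\<omega>. g (ramp (e n) (\<sigma> * x t \<omega>))) - g (e n / 6))
    \<longlonglongrightarrow> expectation IH + g' 0 * local_time_mean t / 2 + \<sigma> * g' 0 / 2 * (\<beta> * local_time_mean t)"
    unfolding step by (intro tendsto_intros lim3 lim4 lim5) simp_all
  ultimately have "expectation (\<lambda>\<omega>. g (max 0 (\<sigma> * x t \<omega>))) - 0
    = expectation IH + g' 0 * local_time_mean t / 2 + \<sigma> * g' 0 / 2 * (\<beta> * local_time_mean t)"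
    by (rule LIMSEQ_unique)
  then show ?thesis unfolding IH_def by (simp add: algebra_simps)
qed

end

section \<open>The law at an exponential time\<close>

lemma exponential_tail:
  assumes q: "0 < q" and r: "0 \<le> r"
  shows "has_bochner_integral lborel (\<lambda>t. indicator {r..} t * exponential_density q t) (exp (- r * q))"
proof (rule has_bochner_integral_nn_integral)
  have "(\<integral>\<^sup>+t. ennreal (q * exp (- t * q)) * indicator {r..} t \<partial>lborel) = ennreal (0 - (- exp (- r * q)))"
  proof (rule nn_integral_FTC_atLeast)
    show "DERIV (\<lambda>t. - exp (- t * q)) t :> q * exp (- t * q)" for t
      by (auto intro!: derivative_eq_intros)
    have "filterlim (\<lambda>t. - t * q) at_bot at_top"
      using filterlim_tendsto_pos_mult_at_bot[OF tendsto_const q filterlim_uminus_at_bot_at_top] by (simp add: mult.commute)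
    then have "((\<lambda>t. exp (- t * q)) \<longlongrightarrow> 0) at_top" by (rule filterlim_compose[OF exp_at_bot])
    from tendsto_minus[OF this] show "((\<lambda>t. - exp (- t * q)) \<longlongrightarrow> 0) at_top" by simp
  qed (use q in auto)
  moreover have "(\<integral>\<^sup>+t. ennreal (indicator {r..} t * exponential_density q t) \<partial>lborel)
      = (\<integral>\<^sup>+t. ennreal (q * exp (- t * q)) * indicator {r..} t \<partial>lborel)"
    using r by (intro nn_integral_cong) (auto simp: exponential_density_def indicator_def)
  ultimately show "(\<integral>\<^sup>+t. ennreal (indicator {r..} t * exponential_density q t) \<partial>lborel) = ennreal (exp (- r * q))" by simp
qed (use q in \<open>auto simp: exponential_density_def\<close>)

lemma exponential_density_integrable:
  assumes "0 < q" shows "integrable lborel (exponential_density q)"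
proof -
  have "(\<lambda>t. indicator {0..} t * exponential_density q t) = exponential_density q"
    by (auto simp: exponential_density_def fun_eq_iff)
  then show ?thesis using integrable.intros[OF exponential_tail[OF assms order_refl]] by simp
qed

text \<open>Exchanging the order of integration, since the exponential tail beyond \<open>r\<close> is the density at \<open>r\<close> divided by \<open>q\<close>.\<close>

lemma laplace_of_primitive:
  fixes u :: "real \<Rightarrow> real"
  assumes q: "0 < q" and u[measurable]: "u \<in> borel_measurable borel" and bound: "\<And>r. \<bar>u r\<bar> \<le> D"
  shows "integrable lborel (\<lambda>t. exponential_density q t * (LBINT r:{0..t}. u r))"
    and "(\<integral>t. exponential_density q t * (LBINT r:{0..t}. u r) \<partial>lborel) = (\<integral>r. exponential_density q r * u r \<partial>lborel) / q"
proof -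
  define f where "f r t = indicator {0..} r * u r * (indicator {r..} t * exponential_density q t)" for r t :: real
  have ed_nonneg: "0 \<le> exponential_density q t" for t using q by (simp add: exponential_density_def)
  have f_eq: "f r t = indicator {0..} r * u r * (if r \<le> t then exponential_density q t else 0)" for r t
    by (simp add: f_def indicator_def)
  have f_meas: "(\<lambda>p. f (fst p) (snd p)) \<in> borel_measurable (lborel \<Otimes>\<^sub>M lborel)"
    unfolding f_eq by measurable
  have inner: "(\<integral>t. f r t \<partial>lborel) = exponential_density q r * u r / q"
    and inner_norm: "(\<integral>t. norm (f r t) \<partial>lborel) = exponential_density q r * \<bar>u r\<bar> / q"
    and inner_int: "integrable lborel (f r)" for r
  proof -
    have "(\<integral>t. f r t \<partial>lborel) = exponential_density q r * u r / q \<and>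
      (\<integral>t. norm (f r t) \<partial>lborel) = exponential_density q r * \<bar>u r\<bar> / q \<and> integrable lborel (f r)"
    proof (cases "0 \<le> r")
      case True
      note T = exponential_tail[OF q True]
      have n: "norm (f r t) = \<bar>u r\<bar> * (indicator {r..} t * exponential_density q t)" for t
        using True ed_nonneg[of t] by (simp add: f_def abs_mult)
      have "(\<integral>t. f r t \<partial>lborel) = u r * exp (- r * q)"
        unfolding f_def using True has_bochner_integral_integral_eq[OF T] by simp
      moreover have "(\<integral>t. norm (f r t) \<partial>lborel) = \<bar>u r\<bar> * exp (- r * q)"
        unfolding n using has_bochner_integral_integral_eq[OF T] by simp
      moreover have "integrable lborel (f r)"
        unfolding f_def using True integrable.intros[OF T] by simp
      ultimately show ?thesis using True q by (simp add: exponential_density_def)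
    next
      case False
      then have "f r = (\<lambda>_. 0)" by (simp add: f_def fun_eq_iff)
      then show ?thesis using False by (simp add: exponential_density_def)
    qed
    then show "(\<integral>t. f r t \<partial>lborel) = exponential_density q r * u r / q"
      "(\<integral>t. norm (f r t) \<partial>lborel) = exponential_density q r * \<bar>u r\<bar> / q" "integrable lborel (f r)" by blast+
  qed
  have "integrable lborel (\<lambda>r. exponential_density q r * \<bar>u r\<bar> / q)"
  proof (rule Bochner_Integration.integrable_bound)
    show "integrable lborel (\<lambda>r. exponential_density q r * D / q)"
      using exponential_density_integrable[OF q] by simp
    show "AE r in lborel. norm (exponential_density q r * \<bar>u r\<bar> / q) \<le> norm (exponential_density q r * D / q)"
    proof (rule AE_I2)
      fix r
      have "exponential_density q r * \<bar>u r\<bar> / q \<le> exponential_density q r * D / q"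
        using bound[of r] ed_nonneg[of r] q by (intro divide_right_mono mult_left_mono) auto
      moreover have "0 \<le> exponential_density q r * \<bar>u r\<bar> / q" using ed_nonneg[of r] q by simp
      ultimately show "norm (exponential_density q r * \<bar>u r\<bar> / q) \<le> norm (exponential_density q r * D / q)"
        unfolding real_norm_def by linarith
    qed
  qed measurable
  then have int: "integrable (lborel \<Otimes>\<^sub>M lborel) (\<lambda>p. f (fst p) (snd p))"
    by (intro lborel_pair.Fubini_integrable[OF f_meas]) (simp_all add: inner_norm[unfolded real_norm_def] inner_int)
  then have int': "integrable (lborel \<Otimes>\<^sub>M lborel) (\<lambda>(r, t). f r t)" by (simp add: case_prod_beta')
  have outer: "(\<integral>r. f r t \<partial>lborel) = exponential_density q t * (LBINT r:{0..t}. u r)" for t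
  proof -
    have "f r t = exponential_density q t * (indicator {0..t} r *\<^sub>R u r)" for r
      by (auto simp: f_def indicator_def)
    then show ?thesis by (simp add: set_lebesgue_integral_def)
  qed
  show "integrable lborel (\<lambda>t. exponential_density q t * (LBINT r:{0..t}. u r))"
    using lborel_pair.integrable_snd[OF int'] unfolding outer .
  show "(\<integral>t. exponential_density q t * (LBINT r:{0..t}. u r) \<partial>lborel) = (\<integral>r. exponential_density q r * u r \<partial>lborel) / q"
    using lborel_pair.Fubini_integral[OF int'] unfolding outer inner by simp
qed

context skew_bm begin

definition "resolvent q f = (\<integral>t. exponential_density q t * expectation (\<lambda>\<omega>. f (x t \<omega>)) \<partial>lborel)"

lemma observable_joint:
  assumes "f \<in> borel_measurable borel"
  shows "(\<lambda>p. f (x (fst p) (snd p))) \<in> borel_measurable (borel \<Otimes>\<^sub>M M)"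
  by (rule measurable_compose[OF x_joint assms])

lemma mean_measurable:
  fixes f :: "real \<Rightarrow> real"
  assumes f: "f \<in> borel_measurable borel"
  shows "(\<lambda>t. expectation (\<lambda>\<omega>. f (x t \<omega>))) \<in> borel_measurable borel"
proof -
  have "(\<lambda>(t, \<omega>). f (x t \<omega>)) \<in> borel_measurable (borel \<Otimes>\<^sub>M M)"
    using observable_joint[OF f] by (simp only: case_prod_beta')
  then show ?thesis by (rule borel_measurable_lebesgue_integral)
qed

lemma mean_bound:
  fixes f :: "real \<Rightarrow> real"
  assumes f: "f \<in> borel_measurable borel" "\<And>y. \<bar>f y\<bar> \<le> C"
  shows "\<bar>expectation (\<lambda>\<omega>. f (x t \<omega>))\<bar> \<le> C"
proof -
  have "\<bar>expectation (\<lambda>\<omega>. f (x t \<omega>))\<bar> \<le> expectation (\<lambda>_. C)"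
  proof (rule abs_integral_le)
    show "integrable M (\<lambda>\<omega>. f (x t \<omega>))"
      by (rule integrable_const_bound[where B = C]) (use f measurable_compose[OF x_measurable f(1)] in auto)
  qed (use f in auto)
  then show ?thesis by (simp add: prob_space)
qed

lemma resolvent_integrable:
  fixes f :: "real \<Rightarrow> real"
  assumes "0 < q" and f: "f \<in> borel_measurable borel" "\<And>y. \<bar>f y\<bar> \<le> C"
  shows "integrable lborel (\<lambda>t. exponential_density q t * expectation (\<lambda>\<omega>. f (x t \<omega>)))"
  using expectation_time_integral(2)[OF observable_joint[OF f(1)] f(2) exponential_density_integrable[OF assms(1)]] .

lemma resolvent_tanaka:
  assumes q: "0 < q" and h: "half_line_test C g g' g''" and g0: "g 0 = 0" and \<sigma>: "\<sigma> = 1 \<or> \<sigma> = - 1"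
  shows "resolvent q (\<lambda>y. g (max 0 (\<sigma> * y)))
    = resolvent q (half_generator \<sigma> g' g'') / q
      + g' 0 / 2 * (1 + \<sigma> * \<beta>) * (\<integral>t. exponential_density q t * local_time_mean t \<partial>lborel)"
proof -
  define G where "G = half_generator \<sigma> g' g''"
  define D where "D = (drift_sup + 1) * C"
  have G: "G \<in> borel_measurable borel" "\<And>y. \<bar>G y\<bar> \<le> D"
    unfolding G_def D_def using half_generator_measurable[OF h] half_generator_bound[OF h \<sigma>] by auto
  define p where "p = (\<lambda>y. g (max 0 (\<sigma> * y)))"
  have p: "p \<in> borel_measurable borel" "\<And>y. \<bar>p y\<bar> \<le> C"
  proof -
    note [measurable] = half_line_test_measurable(1)[OF h]
    show "p \<in> borel_measurable borel" unfolding p_def by measurable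
    show "\<bar>p y\<bar> \<le> C" for y unfolding p_def by (rule half_line_testD(3)[OF h]) simp
  qed
  define \<kappa> where "\<kappa> = g' 0 / 2 * (1 + \<sigma> * \<beta>)"
  define u where "u r = expectation (\<lambda>\<omega>. G (x r \<omega>))" for r
  have u: "u \<in> borel_measurable borel" "\<And>r. \<bar>u r\<bar> \<le> D"
    unfolding u_def using mean_measurable[OF G(1)] mean_bound[OF G] by auto
  have eq: "expectation (\<lambda>\<omega>. p (x t \<omega>)) = (LBINT r:{0..t}. u r) + \<kappa> * local_time_mean t" if t: "0 < t" for t
  proof -
    have "integrable lborel (indicator {0..t} :: real \<Rightarrow> real)"
      by (rule integrable_real_indicator) (auto simp: emeasure_lborel_Icc_eq)
    from expectation_time_integral(1)[OF observable_joint[OF G(1)] G(2) this]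
    have "expectation (\<lambda>\<omega>. LBINT r:{0..t}. G (x r \<omega>)) = (LBINT r:{0..t}. u r)"
      by (simp add: set_lebesgue_integral_def u_def)
    then show ?thesis using tanaka_expectation[OF t h g0 \<sigma>] by (simp add: p_def G_def \<kappa>_def)
  qed
  have AE0: "AE t in lborel. t \<noteq> (0 :: real)" by (rule AE_lborel_singleton)
  note lap = laplace_of_primitive[OF q u]
  have p_int: "integrable lborel (\<lambda>t. exponential_density q t * expectation (\<lambda>\<omega>. p (x t \<omega>)))"
    by (rule resolvent_integrable[OF q p])
  let ?k = "\<lambda>t. exponential_density q t * expectation (\<lambda>\<omega>. p (x t \<omega>)) - exponential_density q t * (LBINT r:{0..t}. u r)"
  have ae: "AE t in lborel. ?k t = \<kappa> * (exponential_density q t * local_time_mean t)"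
    using AE0
  proof eventually_elim
    case (elim t)
    then consider "t < 0" | "0 < t" by linarith
    then show ?case
    proof cases
      case 2
      then show ?thesis using eq[OF 2] by (simp add: algebra_simps)
    qed (simp add: exponential_density_def)
  qed
  have "(\<integral>t. ?k t \<partial>lborel) = (\<integral>t. \<kappa> * (exponential_density q t * local_time_mean t) \<partial>lborel)"
  proof (rule integral_cong_AE[OF _ _ ae])
    show km: "?k \<in> borel_measurable lborel" using p_int lap(1) by auto
    \<comment> \<open>The convergence defining \<open>local_time_mean\<close> is known for positive times only, hence the indicator.\<close>
    have "(\<lambda>t. local_time_mean t * indicator {0<..} t) \<in> borel_measurable borel"
    proof (rule borel_measurable_LIMSEQ_real)
      show "(\<lambda>t. expectation (\<lambda>\<omega>. tent_time (1 / real (Suc n)) t \<omega>) * indicator {0<..} t) \<in> borel_measurable borel" for n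
      proof -
        have "(\<lambda>(t, \<omega>). tent_time (1 / real (Suc n)) t \<omega>) \<in> borel_measurable (borel \<Otimes>\<^sub>M M)"
          using tent_time_joint by (simp only: case_prod_beta')
        from borel_measurable_lebesgue_integral[OF this]
        show ?thesis by (intro borel_measurable_times) auto
      qed
      show "(\<lambda>n. expectation (\<lambda>\<omega>. tent_time (1 / real (Suc n)) t \<omega>) * indicator {0<..} t) \<longlonglongrightarrow> local_time_mean t * indicator {0<..} t" for t
        using local_time_mean(1)[of t] by (cases "0 < t") (auto simp: indicator_def)
    qed
    then have "(\<lambda>t. \<kappa> * (exponential_density q t * (local_time_mean t * indicator {0<..} t)) + \<kappa> * (exponential_density q 0 * local_time_mean 0) * indicator {0} t) \<in> borel_measurable lborel"
      by measurable
    also have "(\<lambda>t. \<kappa> * (exponential_density q t * (local_time_mean t * indicator {0<..} t)) + \<kappa> * (exponential_density q 0 * local_time_mean 0) * indicator {0} t)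
      = (\<lambda>t. \<kappa> * (exponential_density q t * local_time_mean t))"
      by (auto simp: fun_eq_iff indicator_def exponential_density_def)
    finally show "(\<lambda>t. \<kappa> * (exponential_density q t * local_time_mean t)) \<in> borel_measurable lborel" .
  qed
  moreover have "(\<integral>t. ?k t \<partial>lborel) = resolvent q p - resolvent q G / q"
    using p_int lap by (simp add: resolvent_def u_def)
  ultimately show ?thesis unfolding p_def G_def \<kappa>_def by simp
qed

lemma resolvent_at_zero:
  assumes q: "0 < q" shows "resolvent q (indicator {0}) = 0"
proof -
  have f: "(indicator {0} :: real \<Rightarrow> real) \<in> borel_measurable borel" "\<And>y :: real. \<bar>indicator {0} y :: real\<bar> \<le> 1"
    by (auto simp: indicator_def)
  have "AE \<omega> in M. (\<integral>s. exponential_density q s * indicator {0} (x s \<omega>) \<partial>lborel) = 0"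
    using AE_good
  proof eventually_elim
    case (elim \<omega>)
    have "AE s in lborel. \<forall>n :: nat. s \<in> {0..real n} \<longrightarrow> x s \<omega> \<noteq> 0"
      unfolding AE_all_countable using AE_not_at_zero[OF elim] by auto
    then have "AE s in lborel. exponential_density q s * indicator {0} (x s \<omega>) = 0"
    proof eventually_elim
      case (elim s)
      show ?case
      proof (cases "0 \<le> s")
        case True
        then have "x s \<omega> \<noteq> 0" using elim real_arch_simple[of s] by auto
        then show ?thesis by simp
      qed (simp add: exponential_density_def)
    qed
    then show ?case by (rule integral_eq_zero_AE)
  qed
  then have "expectation (\<lambda>\<omega>. \<integral>s. exponential_density q s * indicator {0} (x s \<omega>) \<partial>lborel) = 0"
    by (rule integral_eq_zero_AE)
  then show ?thesis
    unfolding resolvent_def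
    using expectation_time_integral(1)[OF observable_joint[OF f(1)] f(2) exponential_density_integrable[OF q]] by simp
qed

text \<open>By independence the pair of \<open>e\<close> and the process has a product law, so one may integrate over the
  time first. The process is encoded by the identity map into the sample space with the smaller \<open>\<sigma>\<close>-algebra it generates.\<close>

lemma exponential_time_law:
  fixes f :: "real \<Rightarrow> real"
  assumes q: "0 < q" and e0: "\<And>\<omega>. \<omega> \<in> space M \<Longrightarrow> e \<omega> \<ge> 0"
    and e: "distributed M lborel e (exponential_density q)"
    and ind: "indep_set (process_events M X {0..}) (sigma_sets (space M) {e -` A \<inter> space M | A. A \<in> sets borel})"
  shows "(\<lambda>\<omega>. X (e \<omega>) \<omega>) \<in> borel_measurable M"
    and "f \<in> borel_measurable borel \<Longrightarrow> (\<And>y. \<bar>f y\<bar> \<le> C) \<Longrightarrow> expectation (\<lambda>\<omega>. f (X (e \<omega>) \<omega>)) = resolvent q f"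
proof -
  have e_meas[measurable]: "e \<in> measurable M lborel" using e by (rule distributed_measurable)
  define T where "T = sigma (space M) (process_events M X {0..})"
  have PE: "process_events M X {0..} \<subseteq> sets M" using indep_setD_ev1[OF ind] .
  then have "process_events M X {0..} \<subseteq> Pow (space M)" using sets.sets_into_space[of _ M] by blast
  moreover have "sigma_sets (space M) (process_events M X {0..}) = process_events M X {0..}"
    unfolding process_events_def by (rule sigma_sets_sigma_sets_eq) auto
  ultimately have T: "space T = space M" "sets T = process_events M X {0..}"
    unfolding T_def by simp_all
  have X_T: "X t \<in> borel_measurable T" if "0 \<le> t" for t
  proof (rule measurableI)
    fix A :: "real set" assume "A \<in> sets borel"
    then have "X t -` A \<inter> space M \<in> process_events M X {0..}"
      unfolding process_events_def using that by (intro sigma_sets.Basic) auto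
    then show "X t -` A \<inter> space T \<in> sets T" by (simp add: T)
  qed simp
  have joint: "(\<lambda>p. x (fst p) (snd p)) \<in> borel_measurable (borel \<Otimes>\<^sub>M T)"
    unfolding x_def by (rule jointly_measurable_of_continuous[OF X_T X_continuous]) (simp_all add: T)
  have id_T: "(\<lambda>\<omega>. \<omega>) \<in> measurable M T" using PE by (auto simp: measurable_def T)
  have pair: "(\<lambda>\<omega>. (e \<omega>, \<omega>)) \<in> measurable M (lborel \<Otimes>\<^sub>M T)" using e_meas id_T by measurable
  interpret E: prob_space "distr M lborel e" by (rule prob_space_distr[OF e_meas])
  interpret I: prob_space "distr M T (\<lambda>\<omega>. \<omega>)" by (rule prob_space_distr[OF id_T])
  have distr_eq: "distr M lborel e \<Otimes>\<^sub>M distr M T (\<lambda>\<omega>. \<omega>) = distr M (lborel \<Otimes>\<^sub>M T) (\<lambda>\<omega>. (e \<omega>, \<omega>))"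
  proof (rule pair_measure_eqI)
    show "sigma_finite_measure (distr M lborel e)" "sigma_finite_measure (distr M T (\<lambda>\<omega>. \<omega>))" by unfold_locales
    show "sets (distr M lborel e \<Otimes>\<^sub>M distr M T (\<lambda>\<omega>. \<omega>)) = sets (distr M (lborel \<Otimes>\<^sub>M T) (\<lambda>\<omega>. (e \<omega>, \<omega>)))"
      by (simp cong: sets_pair_measure_cong)
    fix A D assume "A \<in> sets (distr M lborel e)" "D \<in> sets (distr M T (\<lambda>\<omega>. \<omega>))"
    then have A: "A \<in> sets borel" and D: "D \<in> sets T" by auto
    have D_M: "D \<in> sets M" "D \<subseteq> space M" using D T PE sets.sets_into_space by blast+
    have E_M: "e -` A \<inter> space M \<in> sets M" using A by (intro measurable_sets[OF e_meas]) simp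
    have "prob (D \<inter> (e -` A \<inter> space M)) = prob D * prob (e -` A \<inter> space M)"
      using A D T by (intro indep_setD[OF ind] sigma_sets.Basic) auto
    moreover have "(\<lambda>\<omega>. (e \<omega>, \<omega>)) -` (A \<times> D) \<inter> space M = D \<inter> (e -` A \<inter> space M)" using D_M(2) by auto
    moreover have "(\<lambda>\<omega>. \<omega>) -` D \<inter> space M = D" using D_M(2) by auto
    ultimately show "emeasure (distr M lborel e) A * emeasure (distr M T (\<lambda>\<omega>. \<omega>)) D
        = emeasure (distr M (lborel \<Otimes>\<^sub>M T) (\<lambda>\<omega>. (e \<omega>, \<omega>))) (A \<times> D)"
      using A D by (simp add: emeasure_distr[OF e_meas] emeasure_distr[OF id_T] emeasure_distr[OF pair]
          emeasure_eq_measure ennreal_mult[symmetric] mult.commute)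
  qed
  have joint': "(\<lambda>p. x (fst p) (snd p)) \<in> borel_measurable (lborel \<Otimes>\<^sub>M T)"
    using joint by (simp cong: measurable_cong_sets sets_pair_measure_cong)
  have Xe: "X (e \<omega>) \<omega> = x (e \<omega>) \<omega>" if "\<omega> \<in> space M" for \<omega> using e0[OF that] by (simp add: x_def max_absorb2)
  have "(\<lambda>\<omega>. x (e \<omega>) \<omega>) \<in> borel_measurable M" using measurable_compose[OF pair joint'] by simp
  then show "(\<lambda>\<omega>. X (e \<omega>) \<omega>) \<in> borel_measurable M" by (rule measurable_cong[THEN iffD2, rotated]) (rule Xe)
  assume f: "f \<in> borel_measurable borel" "\<And>y. \<bar>f y\<bar> \<le> C"
  define F where "F p = f (x (fst p) (snd p))" for p
  have F: "F \<in> borel_measurable (lborel \<Otimes>\<^sub>M T)" unfolding F_def by (rule measurable_compose[OF joint' f(1)])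
  interpret P: pair_prob_space "distr M lborel e" "distr M T (\<lambda>\<omega>. \<omega>)" by unfold_locales
  have F': "F \<in> borel_measurable (distr M lborel e \<Otimes>\<^sub>M distr M T (\<lambda>\<omega>. \<omega>))"
    using F by (simp cong: measurable_cong_sets sets_pair_measure_cong)
  have F_int: "integrable (distr M lborel e \<Otimes>\<^sub>M distr M T (\<lambda>\<omega>. \<omega>)) (\<lambda>(t, \<omega>). F (t, \<omega>))"
    unfolding case_prod_eta by (rule P.integrable_const_bound[where B = C, OF _ F']) (use f in \<open>auto simp: F_def\<close>)
  have "expectation (\<lambda>\<omega>. f (X (e \<omega>) \<omega>)) = expectation (\<lambda>\<omega>. F (e \<omega>, \<omega>))"
    by (rule Bochner_Integration.integral_cong) (auto simp: F_def Xe)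
  also have "\<dots> = (\<integral>p. F p \<partial>distr M (lborel \<Otimes>\<^sub>M T) (\<lambda>\<omega>. (e \<omega>, \<omega>)))"
    by (rule integral_distr[OF pair F, symmetric])
  also have "\<dots> = (\<integral>p. F p \<partial>(distr M lborel e \<Otimes>\<^sub>M distr M T (\<lambda>\<omega>. \<omega>)))" by (simp only: distr_eq)
  also have "\<dots> = (\<integral>t. (\<integral>\<omega>. F (t, \<omega>) \<partial>distr M T (\<lambda>\<omega>. \<omega>)) \<partial>distr M lborel e)"
    using P.integral_fst'[of F] F_int by (simp add: case_prod_eta)
  also have "\<dots> = (\<integral>t. expectation (\<lambda>\<omega>. f (x t \<omega>)) \<partial>distr M lborel e)"
  proof -
    have "(\<integral>\<omega>. F (t, \<omega>) \<partial>distr M T (\<lambda>\<omega>. \<omega>)) = expectation (\<lambda>\<omega>. f (x t \<omega>))" for t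
    proof -
      have "(\<lambda>\<omega>. F (t, \<omega>)) \<in> borel_measurable T"
        by (rule measurable_compose[OF _ F]) measurable
      from integral_distr[OF id_T this] show ?thesis by (simp add: F_def)
    qed
    then show ?thesis by simp
  qed
  also have "\<dots> = (\<integral>t. expectation (\<lambda>\<omega>. f (x t \<omega>)) \<partial>density lborel (exponential_density q))"
    using distributed_distr_eq_density[OF e] by simp
  also have "\<dots> = resolvent q f"
    unfolding resolvent_def using mean_measurable[OF f(1)] q
    by (subst integral_density) (auto simp: exponential_density_def)
  finally show "expectation (\<lambda>\<omega>. f (X (e \<omega>) \<omega>)) = resolvent q f" .
qed

end

section \<open>Fourier transforms on the half-lines\<close>

lemma exponential_fourier_half_line:
  assumes \<rho>: "0 < \<rho>"
  shows "has_bochner_integral lborel (\<lambda>y. (indicator {0<..} y * exp (- \<rho> * y)) *\<^sub>R iexp (u * y))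
    (1 / (complex_of_real \<rho> - \<i> * complex_of_real u))"
proof -
  define z where "z = complex_of_real \<rho> - \<i> * complex_of_real u"
  have z: "z \<noteq> 0" "Re z = \<rho>" using \<rho> by (auto simp: z_def complex_eq_iff)
  define f where "f y = exp (- (z * complex_of_real y))" for y
  have f_eq: "f y = exp (- \<rho> * y) *\<^sub>R iexp (u * y)" for y
  proof -
    have "- (z * complex_of_real y) = complex_of_real (- \<rho> * y) + \<i> * complex_of_real (u * y)"
      by (simp add: z_def algebra_simps)
    then show ?thesis unfolding f_def by (simp only: exp_add exp_of_real scaleR_conv_of_real)
  qed
  have norm_f: "norm (f y) = exp (- \<rho> * y)" for y by (simp add: f_def z(2))
  have f_meas: "f \<in> borel_measurable borel" unfolding f_def by measurable
  have "integrable lborel (\<lambda>y. indicator {0<..} y * exp (- \<rho> * y))"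
  proof -
    have "integrable lborel (\<lambda>y. (1 / \<rho>) * exponential_density \<rho> y)"
      using exponential_density_integrable[OF \<rho>] by simp
    then show ?thesis
      by (rule Bochner_Integration.integrable_bound) (use \<rho> in \<open>auto simp: exponential_density_def indicator_def mult.commute\<close>)
  qed
  then have int: "integrable lborel (\<lambda>y. indicator {0<..} y *\<^sub>R f y)"
    by (rule Bochner_Integration.integrable_bound) (use f_meas in \<open>auto simp: norm_f indicator_def\<close>)
  have "(LBINT y=ereal 0..\<infinity>. f y) = 0 - (- (1 / z))"
  proof (rule interval_integral_FTC_integrable[where F = "\<lambda>y. - (f y / z)"])
    show "((\<lambda>y. - (f y / z)) has_vector_derivative f y) (at y)" for y
    proof -
      have "((\<lambda>w. - (exp (- (z * w)) / z)) has_field_derivative exp (- (z * complex_of_real y))) (at (complex_of_real y))"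
        by (auto intro!: derivative_eq_intros simp: z(1))
      then show ?thesis unfolding f_def by (rule has_vector_derivative_real_field)
    qed
    show "isCont f y" for y unfolding f_def by (intro continuous_intros)
    show "set_integrable lborel (einterval (ereal 0) \<infinity>) f"
      using int by (simp add: set_integrable_def)
    have "isCont (\<lambda>y. - (f y / z)) 0" unfolding f_def by (intro continuous_intros z(1))
    then have "((\<lambda>y. - (f y / z)) \<longlongrightarrow> - (f 0 / z)) (at_right 0)"
      by (auto simp: isCont_def intro: tendsto_within_subset)
    then show "(((\<lambda>y. - (f y / z)) \<circ> real_of_ereal) \<longlongrightarrow> - (1 / z)) (at_right (ereal 0))"
      by (simp add: ereal_tendsto_simps f_def)
    have "filterlim (\<lambda>y. - \<rho> * y) at_bot at_top"
      using filterlim_tendsto_pos_mult_at_bot[OF tendsto_const \<rho> filterlim_uminus_at_bot_at_top] by simp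
    then have "((\<lambda>y. exp (- \<rho> * y)) \<longlongrightarrow> 0) at_top" by (rule filterlim_compose[OF exp_at_bot])
    then have "(f \<longlongrightarrow> 0) at_top" unfolding norm_f[symmetric] by (rule tendsto_norm_zero_cancel)
    then have "((\<lambda>y. - (f y / z)) \<longlongrightarrow> - (0 / z)) at_top" by (intro tendsto_intros z(1))
    then show "(((\<lambda>y. - (f y / z)) \<circ> real_of_ereal) \<longlongrightarrow> 0) (at_left \<infinity>)"
      by (simp add: ereal_tendsto_simps)
  qed simp
  then have "(\<integral>y. indicator {0<..} y *\<^sub>R f y \<partial>lborel) = 1 / z"
    by (simp add: interval_lebesgue_integral_def set_lebesgue_integral_def)
  then show ?thesis
    using int by (simp add: has_bochner_integral_iff f_eq z_def)
qed

lemma half_line_test_diff: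
  assumes f: "half_line_test C f f' f''" and g: "half_line_test D g g' g''"
  shows "half_line_test (C + D) (\<lambda>x. f x - g x) (\<lambda>x. f' x - g' x) (\<lambda>x. f'' x - g'' x)"
proof -
  have diff: "\<bar>p - q\<bar> \<le> P + Q" if "\<bar>p\<bar> \<le> P" "\<bar>q\<bar> \<le> Q" for p q P Q :: real
    using abs_triangle_ineq4[of p q] that by linarith
  have "\<bar>f'' x - g'' x - (f'' y - g'' y)\<bar> \<le> (C + D) * \<bar>x - y\<bar>" if "0 \<le> x" "0 \<le> y" for x y
  proof -
    have "f'' x - g'' x - (f'' y - g'' y) = (f'' x - f'' y) - (g'' x - g'' y)" by simp
    then show ?thesis using diff[OF half_line_testD(6)[OF f that] half_line_testD(6)[OF g that]] by (simp only: distrib_right)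
  qed
  moreover note diff[OF half_line_testD(3)[OF f] half_line_testD(3)[OF g]] diff[OF half_line_testD(4)[OF f] half_line_testD(4)[OF g]]
    diff[OF half_line_testD(5)[OF f] half_line_testD(5)[OF g]]
  ultimately show ?thesis unfolding half_line_test_def
    using DERIV_diff[OF half_line_testD(1)[OF f] half_line_testD(1)[OF g]] DERIV_diff[OF half_line_testD(2)[OF f] half_line_testD(2)[OF g]]
    by blast
qed

text \<open>The phase \<open>\<theta>\<close> covers sine and cosine at once.\<close>

lemma sinusoid_half_line_test:
  fixes u \<theta> :: real
  shows "half_line_test (max 1 \<bar>u\<bar> ^ 3) (\<lambda>x. cos (u * x + \<theta>)) (\<lambda>x. - u * sin (u * x + \<theta>)) (\<lambda>x. - (u\<^sup>2) * cos (u * x + \<theta>))"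
proof -
  define C where "C = max 1 \<bar>u\<bar> ^ 3"
  have m: "1 \<le> max 1 \<bar>u\<bar>" by simp
  have C: "1 \<le> C" "\<bar>u\<bar> \<le> C" "\<bar>u\<bar> ^ 2 \<le> C" "\<bar>u\<bar> ^ 3 \<le> C"
  proof -
    show "1 \<le> C" unfolding C_def using m by (rule one_le_power)
    have "\<bar>u\<bar> \<le> max 1 \<bar>u\<bar> ^ 1" by simp
    also have "\<dots> \<le> C" unfolding C_def using m by (intro power_increasing) auto
    finally show "\<bar>u\<bar> \<le> C" .
    have "\<bar>u\<bar> ^ 2 \<le> max 1 \<bar>u\<bar> ^ 2" by (intro power_mono) auto
    also have "\<dots> \<le> C" unfolding C_def using m by (intro power_increasing) auto
    finally show "\<bar>u\<bar> ^ 2 \<le> C" .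
    show "\<bar>u\<bar> ^ 3 \<le> C" unfolding C_def by (intro power_mono) auto
  qed
  have sc: "\<bar>k * c\<bar> \<le> C" if "\<bar>k\<bar> \<le> C" "\<bar>c\<bar> \<le> 1" for k c
    using mult_mono[OF that] C(1) by (simp add: abs_mult)
  have lip: "\<bar>- (u\<^sup>2) * cos (u * x + \<theta>) - - (u\<^sup>2) * cos (u * y + \<theta>)\<bar> \<le> C * \<bar>x - y\<bar>" for x y
  proof (rule lipschitz_of_deriv_bound)
    show "((\<lambda>x. - (u\<^sup>2) * cos (u * x + \<theta>)) has_real_derivative (u ^ 3) * sin (u * x + \<theta>)) (at x)" for x
      by (auto intro!: derivative_eq_intros simp: power2_eq_square power3_eq_cube)
    show "\<bar>(u ^ 3) * sin (u * x + \<theta>)\<bar> \<le> C" for x using C(4) by (intro sc) (simp_all only: power_abs abs_sin_le_one)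
  qed
  show ?thesis unfolding half_line_test_def C_def[symmetric]
  proof (intro conjI allI impI lip)
    fix x :: real
    show "((\<lambda>x. cos (u * x + \<theta>)) has_real_derivative - u * sin (u * x + \<theta>)) (at x)"
      "((\<lambda>x. - u * sin (u * x + \<theta>)) has_real_derivative - (u\<^sup>2) * cos (u * x + \<theta>)) (at x)"
      by (auto intro!: derivative_eq_intros simp: power2_eq_square)
    show "\<bar>cos (u * x + \<theta>)\<bar> \<le> C" using abs_cos_le_one[of "u * x + \<theta>"] C(1) by linarith
    show "\<bar>- u * sin (u * x + \<theta>)\<bar> \<le> C" using C(2) by (intro sc) simp_all
    show "\<bar>- (u\<^sup>2) * cos (u * x + \<theta>)\<bar> \<le> C" using C(3) by (intro sc) simp_all
  qed
qed

text \<open>\<open>N\<close> is to be the law of \<open>X\<close> at the exponential time; only its expression through the resolvent is used.\<close>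

locale resolvent_law = skew_bm M B X \<beta> \<mu>\<^sub>p \<mu>\<^sub>m
  for M :: "'w measure" and B X :: "real \<Rightarrow> 'w \<Rightarrow> real" and \<beta> \<mu>\<^sub>p \<mu>\<^sub>m :: real +
  fixes q :: real and N :: "real measure"
  assumes q: "0 < q" and N: "real_distribution N"
    and N_resolvent: "\<And>f C. f \<in> borel_measurable borel \<Longrightarrow> (\<And>y. \<bar>f y\<bar> \<le> C) \<Longrightarrow> integral\<^sup>L N f = resolvent q f"
begin

interpretation N: real_distribution N by (rule N)

text \<open>The drift away from \<open>0\<close> on the half-line with sign \<open>\<sigma>\<close>. The roots of \<open>r\<^sup>2/2 - \<mu> r - q\<close> for this drift \<open>\<mu>\<close> are
  \<open>dual_rate\<close> and minus \<open>rate\<close>.\<close>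

definition "side_drift (\<sigma> :: real) = (if \<sigma> = 1 then \<mu>\<^sub>p else - \<mu>\<^sub>m)"
definition "rate (\<sigma> :: real) = sqrt ((side_drift \<sigma>)\<^sup>2 + 2 * q) - side_drift \<sigma>"
definition "dual_rate (\<sigma> :: real) = sqrt ((side_drift \<sigma>)\<^sup>2 + 2 * q) + side_drift \<sigma>"
text \<open>The mean of \<open>L\<close> at the exponential time, multiplied by \<open>q\<close>.\<close>

definition "zero_local_time = q * (\<integral>t. exponential_density q t * local_time_mean t \<partial>lborel)"

lemma rates_pos: "0 < rate \<sigma>" "0 < dual_rate \<sigma>"
proof -
  have "\<bar>side_drift \<sigma>\<bar> < sqrt ((side_drift \<sigma>)\<^sup>2 + 2 * q)"
    using q by (intro real_less_rsqrt) simp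
  then show "0 < rate \<sigma>" "0 < dual_rate \<sigma>" unfolding rate_def dual_rate_def by linarith+
qed

lemma rates_mult: "rate \<sigma> * dual_rate \<sigma> = 2 * q"
proof -
  have "(sqrt ((side_drift \<sigma>)\<^sup>2 + 2 * q))\<^sup>2 = (side_drift \<sigma>)\<^sup>2 + 2 * q" using q by (intro real_sqrt_pow2) simp
  then show ?thesis unfolding rate_def dual_rate_def by (simp add: algebra_simps power2_eq_square)
qed

lemma dual_rate_root: "(dual_rate \<sigma>)\<^sup>2 / 2 - side_drift \<sigma> * dual_rate \<sigma> - q = 0"
proof -
  have "rate \<sigma> = dual_rate \<sigma> - 2 * side_drift \<sigma>" by (simp add: rate_def dual_rate_def)
  then have "(dual_rate \<sigma> - 2 * side_drift \<sigma>) * dual_rate \<sigma> = 2 * q" using rates_mult[of \<sigma>] by simp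
  then show ?thesis by (simp add: algebra_simps power2_eq_square)
qed

text \<open>Subtracting the generator from \<open>q g\<close> on the half-line leaves only the boundary term at \<open>0\<close>.\<close>

lemma stationary_identity:
  assumes h: "half_line_test C g g' g''" and g0: "g 0 = 0" and \<sigma>: "\<sigma> = 1 \<or> \<sigma> = - 1"
  shows "(\<integral>y. indicator {0<..} (\<sigma> * y) * (q * g (\<sigma> * y) - side_drift \<sigma> * g' (\<sigma> * y) - g'' (\<sigma> * y) / 2) \<partial>N)
    = g' 0 / 2 * (1 + \<sigma> * \<beta>) * zero_local_time"
proof -
  note [measurable] = half_line_test_measurable[OF h] half_generator_measurable[OF h, of \<sigma>]
  define p where "p = (\<lambda>y. g (max 0 (\<sigma> * y)))"
  have p: "p \<in> borel_measurable borel" "\<bar>p y\<bar> \<le> C" for y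
    unfolding p_def by (measurable, rule half_line_testD(3)[OF h], simp)
  note G = half_generator_measurable[OF h, of \<sigma>] half_generator_bound[OF h \<sigma>]
  have "integrable N p"
    by (rule N.integrable_const_bound[where B = C]) (use p in auto)
  moreover have "integrable N (half_generator \<sigma> g' g'')"
    by (rule N.integrable_const_bound[where B = "(drift_sup + 1) * C"]) (use G in auto)
  ultimately have pG: "integrable N p" "integrable N (half_generator \<sigma> g' g'')" by blast+
  have "indicator {0<..} (\<sigma> * y) * (q * g (\<sigma> * y) - side_drift \<sigma> * g' (\<sigma> * y) - g'' (\<sigma> * y) / 2)
    = q * p y - half_generator \<sigma> g' g'' y" for y
  proof (cases "0 < \<sigma> * y")
    case True
    then have "\<sigma> * drift y = side_drift \<sigma>" using \<sigma> by (auto simp: side_drift_def drift_coeff_def)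
    then show ?thesis using True by (simp add: p_def half_generator_def)
  qed (simp add: p_def half_generator_def g0)
  then have "(\<integral>y. indicator {0<..} (\<sigma> * y) * (q * g (\<sigma> * y) - side_drift \<sigma> * g' (\<sigma> * y) - g'' (\<sigma> * y) / 2) \<partial>N)
    = q * integral\<^sup>L N p - integral\<^sup>L N (half_generator \<sigma> g' g'')"
    using pG by simp
  also have "\<dots> = q * resolvent q p - resolvent q (half_generator \<sigma> g' g'')"
    using N_resolvent[OF p] N_resolvent[OF G] by simp
  also have "resolvent q p = resolvent q (half_generator \<sigma> g' g'') / q + g' 0 / 2 * (1 + \<sigma> * \<beta>) * (zero_local_time / q)"
    using resolvent_tanaka[OF q h g0 \<sigma>] q by (simp add: p_def zero_local_time_def)
  also have "q * (R / q + k * (zero_local_time / q)) - R = k * zero_local_time" for R k using q by (simp add: distrib_left)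
  finally show ?thesis .
qed

text \<open>The test functions are the real and imaginary parts of \<open>exp(i u y) - exp(- r y)\<close> with \<open>r\<close> the \<open>dual_rate\<close>. They vanish at \<open>0\<close>,
  and the term \<open>exp(- r y)\<close> drops out of \<open>stationary_identity\<close>. The two real equations combine to the
  complex equation \<open>(\<rho> - i u) (r + i u) \<Phi> = (1 + \<sigma> \<beta>) c (r + i u)\<close> for the transform \<open>\<Phi>\<close>, with \<open>c\<close> the constant \<open>zero_local_time\<close>.\<close>

lemma half_transform:
  assumes \<sigma>: "\<sigma> = 1 \<or> \<sigma> = - 1"
  shows "(\<integral>y. indicator {0<..} (\<sigma> * y) *\<^sub>R iexp (u * (\<sigma> * y)) \<partial>N)
    = complex_of_real ((1 + \<sigma> * \<beta>) * zero_local_time) / (complex_of_real (rate \<sigma>) - \<i> * complex_of_real u)"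
proof -
  define m r \<rho> \<kappa> where "m = side_drift \<sigma>" and "r = dual_rate \<sigma>" and "\<rho> = rate \<sigma>" and "\<kappa> = (1 + \<sigma> * \<beta>) * zero_local_time / 2"
  have r: "0 < r" "0 < \<rho>" "\<rho> * r = 2 * q" "r - \<rho> = 2 * m" "r\<^sup>2 / 2 - m * r - q = 0"
    using rates_pos[of \<sigma>] rates_mult[of \<sigma>] dual_rate_root[of \<sigma>]
    by (auto simp: m_def r_def \<rho>_def) (simp add: rate_def dual_rate_def)
  define I where "I y = (indicator {0<..} (\<sigma> * y) :: real)" for y
  have [measurable]: "I \<in> borel_measurable borel" unfolding I_def by measurable
  define Co Si where "Co = (\<integral>y. I y * cos (u * (\<sigma> * y)) \<partial>N)" and "Si = (\<integral>y. I y * sin (u * (\<sigma> * y)) \<partial>N)"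
  have ci: "integrable N (\<lambda>y. I y * cos (u * (\<sigma> * y)))" and si: "integrable N (\<lambda>y. I y * sin (u * (\<sigma> * y)))"
    by (rule N.integrable_const_bound[where B = 1]; simp add: I_def indicator_def)+
  note cos_test = sinusoid_half_line_test[of u 0] and sin_test = sinusoid_half_line_test[of u "- pi / 2"]
  have shift: "cos (a + - pi / 2) = sin a" "sin (a + - pi / 2) = - cos a" for a :: real
    by (simp_all add: cos_diff sin_diff)
  have e1: "(q + u\<^sup>2 / 2) * Co + m * u * Si = r * \<kappa>"
  proof -
    from stationary_identity[OF half_line_test_diff[OF cos_test exp_half_line_test[OF less_imp_le[OF r(1)]]] _ \<sigma>]
    have "(\<integral>y. I y * (q * (cos (u * (\<sigma> * y)) - exp (- r * (\<sigma> * y)))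
        - m * (- u * sin (u * (\<sigma> * y)) - - r * exp (- r * (\<sigma> * y)))
        - (- (u\<^sup>2) * cos (u * (\<sigma> * y)) - r\<^sup>2 * exp (- r * (\<sigma> * y))) / 2) \<partial>N) = r * \<kappa>"
      by (simp add: I_def m_def \<kappa>_def)
    also have "(\<lambda>y. I y * (q * (cos (u * (\<sigma> * y)) - exp (- r * (\<sigma> * y)))
        - m * (- u * sin (u * (\<sigma> * y)) - - r * exp (- r * (\<sigma> * y)))
        - (- (u\<^sup>2) * cos (u * (\<sigma> * y)) - r\<^sup>2 * exp (- r * (\<sigma> * y))) / 2))
      = (\<lambda>y. (q + u\<^sup>2 / 2) * (I y * cos (u * (\<sigma> * y))) + m * u * (I y * sin (u * (\<sigma> * y))))"
    proof
      fix y
      have id: "q * (c - E) - m * (- u * s - - r * E) - (- (u\<^sup>2) * c - r\<^sup>2 * E) / 2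
        = (q + u\<^sup>2 / 2) * c + m * u * s + (r\<^sup>2 / 2 - m * r - q) * E" for c s E :: real
        by (simp add: field_simps)
      show "I y * (q * (cos (u * (\<sigma> * y)) - exp (- r * (\<sigma> * y)))
        - m * (- u * sin (u * (\<sigma> * y)) - - r * exp (- r * (\<sigma> * y)))
        - (- (u\<^sup>2) * cos (u * (\<sigma> * y)) - r\<^sup>2 * exp (- r * (\<sigma> * y))) / 2)
        = (q + u\<^sup>2 / 2) * (I y * cos (u * (\<sigma> * y))) + m * u * (I y * sin (u * (\<sigma> * y)))"
        unfolding id r(5) by (simp add: algebra_simps)
    qed
    finally show ?thesis using ci si by (simp add: Co_def Si_def)
  qed
  have e2: "(q + u\<^sup>2 / 2) * Si - m * u * Co = u * \<kappa>"
  proof -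
    from stationary_identity[OF sin_test _ \<sigma>]
    have "(\<integral>y. I y * (q * sin (u * (\<sigma> * y)) - m * (- u * - cos (u * (\<sigma> * y))) - (- (u\<^sup>2) * sin (u * (\<sigma> * y))) / 2) \<partial>N) = u * \<kappa>"
      unfolding shift by (simp add: I_def m_def \<kappa>_def)
    also have "(\<lambda>y. I y * (q * sin (u * (\<sigma> * y)) - m * (- u * - cos (u * (\<sigma> * y))) - (- (u\<^sup>2) * sin (u * (\<sigma> * y))) / 2))
      = (\<lambda>y. (q + u\<^sup>2 / 2) * (I y * sin (u * (\<sigma> * y))) - m * u * (I y * cos (u * (\<sigma> * y))))"
      by (simp add: fun_eq_iff field_simps)
    finally show ?thesis using ci si by (simp add: Co_def Si_def)
  qed
  define \<Phi> where "\<Phi> = (\<integral>y. indicator {0<..} (\<sigma> * y) *\<^sub>R iexp (u * (\<sigma> * y)) \<partial>N)"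
  have \<Phi>: "\<Phi> = complex_of_real Co + \<i> * complex_of_real Si"
  proof -
    have split: "indicator {0<..} (\<sigma> * y) *\<^sub>R iexp (u * (\<sigma> * y))
      = complex_of_real (I y * cos (u * (\<sigma> * y))) + \<i> * complex_of_real (I y * sin (u * (\<sigma> * y)))" for y
      by (simp add: I_def complex_eq_iff Re_exp Im_exp)
    have "\<Phi> = (\<integral>y. complex_of_real (I y * cos (u * (\<sigma> * y))) \<partial>N) + (\<integral>y. \<i> * complex_of_real (I y * sin (u * (\<sigma> * y))) \<partial>N)"
      unfolding \<Phi>_def split
      by (intro Bochner_Integration.integral_add integrable_mult_right integrable_of_real ci si)
    then show ?thesis unfolding Co_def Si_def by (simp only: integral_mult_right_zero integral_complex_of_real)
  qed
  have \<Phi>_parts: "Re \<Phi> = Co" "Im \<Phi> = Si" unfolding \<Phi> by simp_all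
  define zr z\<rho> where "zr = complex_of_real r + \<i> * complex_of_real u" and "z\<rho> = complex_of_real \<rho> - \<i> * complex_of_real u"
  have nz: "zr \<noteq> 0" "z\<rho> \<noteq> 0" using r by (auto simp: zr_def z\<rho>_def complex_eq_iff)
  \<comment> \<open>The eigenvalue \<open>q + u\<^sup>2/2 - i m u\<close> factors because \<open>\<rho> r = 2 q\<close> and \<open>r - \<rho> = 2 m\<close>.\<close>
  have prod: "z\<rho> * zr = 2 * Complex (q + u\<^sup>2 / 2) (- m * u)"
  proof -
    have "Re (z\<rho> * zr) = \<rho> * r + u\<^sup>2" "Im (z\<rho> * zr) = - (r - \<rho>) * u"
      by (simp_all add: zr_def z\<rho>_def power2_eq_square algebra_simps)
    then show ?thesis unfolding complex_eq_iff r(3,4) by simp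
  qed
  have "Complex (q + u\<^sup>2 / 2) (- m * u) * \<Phi> = complex_of_real \<kappa> * zr"
    using e1 e2 by (simp add: complex_eq_iff \<Phi>_parts zr_def algebra_simps)
  then have "(z\<rho> * zr) * \<Phi> = complex_of_real (2 * \<kappa>) * zr" unfolding prod by simp
  then have "z\<rho> * \<Phi> * zr = complex_of_real (2 * \<kappa>) * zr" by (simp only: mult_ac)
  then have "z\<rho> * \<Phi> = complex_of_real (2 * \<kappa>)" using mult_right_cancel[OF nz(1)] by blast
  then have "\<Phi> = complex_of_real (2 * \<kappa>) / z\<rho>" using nz(2) by (simp add: field_simps)
  then show ?thesis unfolding \<Phi>_def z\<rho>_def \<rho>_def \<kappa>_def by simp
qed

lemma char_N:
  "char N u = complex_of_real ((1 + \<beta>) * zero_local_time) / (complex_of_real (rate 1) - \<i> * complex_of_real u)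
    + complex_of_real ((1 - \<beta>) * zero_local_time) / (complex_of_real (rate (- 1)) + \<i> * complex_of_real u)"
proof -
  have zero: "AE y in N. y \<noteq> 0"
  proof -
    have "measure N {0} = integral\<^sup>L N (indicator {0})" by simp
    also have "\<dots> = resolvent q (indicator {0})" by (rule N_resolvent[where C = 1]) (auto simp: indicator_def)
    finally have "{0} \<in> null_sets N" using resolvent_at_zero[OF q] by (simp add: null_sets_def N.emeasure_eq_measure)
    from AE_not_in[OF this] show ?thesis by simp
  qed
  have int: "integrable N (\<lambda>y. indicator {0<..} (\<sigma> * y) *\<^sub>R iexp (v * y))" for \<sigma> v
    by (rule N.integrable_const_bound[where B = 1]) (auto simp: indicator_def)
  have "char N u = (\<integral>y. indicator {0<..} (1 * y) *\<^sub>R iexp (u * y) + indicator {0<..} (- 1 * y) *\<^sub>R iexp (u * y) \<partial>N)"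
    unfolding char_def
  proof (rule integral_cong_AE)
    show "AE y in N. iexp (u * y) = indicator {0<..} (1 * y) *\<^sub>R iexp (u * y) + indicator {0<..} (- 1 * y) *\<^sub>R iexp (u * y)"
      using zero by eventually_elim (auto simp: indicator_def)
  qed auto
  also have "\<dots> = (\<integral>y. indicator {0<..} (1 * y) *\<^sub>R iexp (u * y) \<partial>N) + (\<integral>y. indicator {0<..} (- 1 * y) *\<^sub>R iexp (u * y) \<partial>N)"
    by (intro Bochner_Integration.integral_add int)
  also have "(\<integral>y. indicator {0<..} (1 * y) *\<^sub>R iexp (u * y) \<partial>N) = (\<integral>y. indicator {0<..} (1 * y) *\<^sub>R iexp (u * (1 * y)) \<partial>N)"
    by simp
  also have "\<dots> = complex_of_real ((1 + 1 * \<beta>) * zero_local_time) / (complex_of_real (rate 1) - \<i> * complex_of_real u)"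
    by (rule half_transform) simp
  also have "(\<integral>y. indicator {0<..} (- 1 * y) *\<^sub>R iexp (u * y) \<partial>N) = (\<integral>y. indicator {0<..} (- 1 * y) *\<^sub>R iexp (- u * (- 1 * y)) \<partial>N)"
    by simp
  also have "\<dots> = complex_of_real ((1 + - 1 * \<beta>) * zero_local_time) / (complex_of_real (rate (- 1)) - \<i> * complex_of_real (- u))"
    by (rule half_transform) simp
  finally show ?thesis by simp
qed

text \<open>The transform at frequency \<open>0\<close> is the total mass of the law.\<close>

lemma total_mass: "zero_local_time * ((1 + \<beta>) / rate 1 + (1 - \<beta>) / rate (- 1)) = 1"
proof -
  have "complex_of_real (zero_local_time * ((1 + \<beta>) / rate 1 + (1 - \<beta>) / rate (- 1))) = char N 0"
    unfolding char_N by (simp add: algebra_simps)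
  also have "\<dots> = complex_of_real 1" by (simp add: N.char_zero)
  finally show ?thesis by (simp only: of_real_eq_iff)
qed

definition "resolvent_density y =
  (if 0 < y then (1 + \<beta>) * zero_local_time * exp (- rate 1 * y) else if y < 0 then (1 - \<beta>) * zero_local_time * exp (rate (- 1) * y) else 0)"

lemma zero_local_time_pos: "0 < zero_local_time"
proof -
  have "0 < (1 + \<beta>) / rate 1 + (1 - \<beta>) / rate (- 1)"
    using skewness rates_pos by (intro add_pos_pos[OF divide_pos_pos divide_pos_pos]) auto
  then show ?thesis using total_mass by (metis zero_less_mult_pos2 zero_less_one)
qed

lemma resolvent_density_measurable [measurable]: "resolvent_density \<in> borel_measurable borel"
  unfolding resolvent_density_def[abs_def] by measurable

lemma resolvent_density_nonneg: "0 \<le> resolvent_density y"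
  using skewness zero_local_time_pos by (simp add: resolvent_density_def)

lemma density_transform:
  "has_bochner_integral lborel (\<lambda>y. resolvent_density y *\<^sub>R iexp (u * y)) (char N u)"
proof -
  have plus: "has_bochner_integral lborel (\<lambda>y. complex_of_real ((1 + \<beta>) * zero_local_time) * ((indicator {0<..} y * exp (- rate 1 * y)) *\<^sub>R iexp (u * y)))
    (complex_of_real ((1 + \<beta>) * zero_local_time) * (1 / (complex_of_real (rate 1) - \<i> * complex_of_real u)))"
    by (intro has_bochner_integral_mult_right exponential_fourier_half_line rates_pos)
  have "has_bochner_integral lborel (\<lambda>y. (indicator {0<..} (0 + - 1 * y) * exp (- rate (- 1) * (0 + - 1 * y))) *\<^sub>R iexp (- u * (0 + - 1 * y)))
    ((1 / (complex_of_real (rate (- 1)) - \<i> * complex_of_real (- u))) /\<^sub>R \<bar>- 1\<bar>)"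
    by (rule lborel_has_bochner_integral_real_affine_iff[THEN iffD1, OF _ exponential_fourier_half_line[OF rates_pos(1)]]) simp
  then have "has_bochner_integral lborel (\<lambda>y. (indicator {0<..} (- y) * exp (rate (- 1) * y)) *\<^sub>R iexp (u * y))
    (1 / (complex_of_real (rate (- 1)) + \<i> * complex_of_real u))" by simp
  then have minus: "has_bochner_integral lborel (\<lambda>y. complex_of_real ((1 - \<beta>) * zero_local_time) * ((indicator {0<..} (- y) * exp (rate (- 1) * y)) *\<^sub>R iexp (u * y)))
    (complex_of_real ((1 - \<beta>) * zero_local_time) * (1 / (complex_of_real (rate (- 1)) + \<i> * complex_of_real u)))"
    by (rule has_bochner_integral_mult_right)
  have "resolvent_density y *\<^sub>R iexp (u * y) = complex_of_real ((1 + \<beta>) * zero_local_time) * ((indicator {0<..} y * exp (- rate 1 * y)) *\<^sub>R iexp (u * y))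
    + complex_of_real ((1 - \<beta>) * zero_local_time) * ((indicator {0<..} (- y) * exp (rate (- 1) * y)) *\<^sub>R iexp (u * y))" for y
    by (simp add: resolvent_density_def indicator_def scaleR_conv_of_real)
  then show ?thesis using has_bochner_integral_add[OF plus minus] by (simp add: char_N)
qed

lemma N_density: "N = density lborel (\<lambda>y. ennreal (resolvent_density y))"
proof (rule Levy_uniqueness[OF N])
  have "has_bochner_integral lborel (\<lambda>y. complex_of_real (resolvent_density y)) 1"
    using density_transform[of 0] by (simp add: N.char_zero scaleR_conv_of_real)
  then have one: "has_bochner_integral lborel resolvent_density 1"
    by (simp add: has_bochner_integral_iff complex_of_real_integrable_eq) 
  have "(\<integral>\<^sup>+y. ennreal (resolvent_density y) \<partial>lborel) = ennreal 1"
    using has_bochner_integral_integral_eq[OF one] nn_integral_eq_integral[OF integrable.intros[OF one] AE_I2[OF resolvent_density_nonneg]] by simp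
  then show rd: "real_distribution (density lborel (\<lambda>y. ennreal (resolvent_density y)))"
    unfolding real_distribution_def real_distribution_axioms_def
    by (auto intro!: prob_spaceI simp: emeasure_density)
  show "char N = char (density lborel (\<lambda>y. ennreal (resolvent_density y)))"
  proof
    fix u
    have "char (density lborel (\<lambda>y. ennreal (resolvent_density y))) u = (\<integral>y. resolvent_density y *\<^sub>R iexp (u * y) \<partial>lborel)"
      unfolding char_def using resolvent_density_nonneg by (subst integral_density) auto
    then show "char N u = char (density lborel (\<lambda>y. ennreal (resolvent_density y))) u"
      using has_bochner_integral_integral_eq[OF density_transform] by simp
  qed
qed

lemma zero_local_time_eq: "zero_local_time = 2 * q / ((1 + \<beta>) * dual_rate 1 + (1 - \<beta>) * dual_rate (- 1))"
proof -
  have inv: "1 / rate \<sigma> = dual_rate \<sigma> / (2 * q)" for \<sigma>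
    using rates_mult[of \<sigma>] rates_pos[of \<sigma>] q by (simp add: field_simps)
  have "zero_local_time * ((1 + \<beta>) * dual_rate 1 + (1 - \<beta>) * dual_rate (- 1)) = 2 * q * (zero_local_time * ((1 + \<beta>) * (1 / rate 1) + (1 - \<beta>) * (1 / rate (- 1))))"
    unfolding inv using q by (simp add: field_simps)
  also have "\<dots> = 2 * q" using total_mass by simp
  finally have eq: "zero_local_time * ((1 + \<beta>) * dual_rate 1 + (1 - \<beta>) * dual_rate (- 1)) = 2 * q" .
  have "0 < (1 + \<beta>) * dual_rate 1 + (1 - \<beta>) * dual_rate (- 1)"
    using skewness rates_pos by (intro add_pos_pos[OF mult_pos_pos mult_pos_pos]) auto
  then show ?thesis using eq by (simp add: eq_divide_eq)
qed

end

theorem theorem3: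
  fixes M :: "'w measure" and B X :: "real \<Rightarrow> 'w \<Rightarrow> real" and e :: "'w \<Rightarrow> real"
    and \<beta> \<mu>\<^sub>p \<mu>\<^sub>m q :: real
  assumes "-1 < \<beta>" "\<beta> < 1" and "q > 0"
    and "refracted_skew_brownian_motion M B X \<beta> \<mu>\<^sub>p \<mu>\<^sub>m 0 0"
    and "\<And>\<omega>. \<omega> \<in> space M \<Longrightarrow> e \<omega> \<ge> 0"
    and "distributed M lborel e (exponential_density q)"
    and "prob_space.indep_set M (process_events M X {0..})
           (sigma_sets (space M) {e -` A \<inter> space M | A. A \<in> sets borel})"
  shows "distributed M lborel (\<lambda>\<omega>. X (e \<omega>) \<omega>)
    (\<lambda>y. ennreal
      (if y > 0 then
         2 * (1 + \<beta>) * q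
           / ((1 + \<beta>) * \<mu>\<^sub>p - (1 - \<beta>) * \<mu>\<^sub>m
              + (1 + \<beta>) * sqrt (\<mu>\<^sub>p\<^sup>2 + 2 * q) + (1 - \<beta>) * sqrt (\<mu>\<^sub>m\<^sup>2 + 2 * q))
           * exp ((\<mu>\<^sub>p - sqrt (\<mu>\<^sub>p\<^sup>2 + 2 * q)) * y)
       else if y < 0 then
         2 * (1 - \<beta>) * q
           / ((1 + \<beta>) * \<mu>\<^sub>p - (1 - \<beta>) * \<mu>\<^sub>m
              + (1 + \<beta>) * sqrt (\<mu>\<^sub>p\<^sup>2 + 2 * q) + (1 - \<beta>) * sqrt (\<mu>\<^sub>m\<^sup>2 + 2 * q))
           * exp ((\<mu>\<^sub>m + sqrt (\<mu>\<^sub>m\<^sup>2 + 2 * q)) * y)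
       else 0))" (is "distributed M lborel _ (\<lambda>y. ennreal (?d y))")
proof -
  interpret refracted_skew_brownian_motion M B X \<beta> \<mu>\<^sub>p \<mu>\<^sub>m 0 0 by (rule assms(4))
  interpret S: skew_bm M B X \<beta> \<mu>\<^sub>p \<mu>\<^sub>m by unfold_locales
  note law = S.exponential_time_law[OF assms(3,5,6,7)]
  define Y where "Y \<omega> = X (e \<omega>) \<omega>" for \<omega>
  have Y[measurable]: "Y \<in> borel_measurable M" unfolding Y_def by (rule law(1))
  define N where "N = distr M borel Y"
  have N: "real_distribution N" unfolding N_def by (rule real_distribution_distr) (rule Y)
  interpret R: resolvent_law M B X \<beta> \<mu>\<^sub>p \<mu>\<^sub>m q N
  proof (intro resolvent_law.intro resolvent_law_axioms.intro)
    show "skew_bm M B X \<beta> \<mu>\<^sub>p \<mu>\<^sub>m" by (rule S.skew_bm_axioms)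
    show "0 < q" by (rule assms(3))
    show "real_distribution N" by (rule N)
    fix f :: "real \<Rightarrow> real" and C assume f: "f \<in> borel_measurable borel" "\<And>y. \<bar>f y\<bar> \<le> C"
    have "integral\<^sup>L N f = expectation (\<lambda>\<omega>. f (Y \<omega>))" unfolding N_def by (rule integral_distr[OF Y f(1)])
    also have "\<dots> = S.resolvent q f" unfolding Y_def by (rule law(2)[OF _ f]) simp
    finally show "integral\<^sup>L N f = S.resolvent q f" .
  qed
  have d: "?d y = R.resolvent_density y" for y
    unfolding R.resolvent_density_def R.zero_local_time_eq R.rate_def R.dual_rate_def R.side_drift_def
    by (simp add: algebra_simps)
  have "distr M lborel Y = N" unfolding N_def by (rule distr_cong) auto
  then have "distr M lborel Y = density lborel (\<lambda>y. ennreal (?d y))" unfolding d using R.N_density by simp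
  moreover have "(\<lambda>y. ennreal (?d y)) \<in> borel_measurable lborel" unfolding d by measurable
  ultimately show ?thesis unfolding distributed_def Y_def[symmetric] using Y by (simp add: Y_def[abs_def])
qed

end
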